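(* Let $\sigma\in\mathbb{C}$ with $0<\arg(\sigma)<\pi$. Let $\Omega\subset\mathbb{C}$ be a bounded convex domain and let $\phi$ be a solution in $\Omega$ of the complex Helmholtz equation $\Delta\phi-4\sigma\phi=0$ that is $C^2$ in some neighborhood of $\overline\Omega$. Let $T$ be a trapezoid inscribed in $\Omega$ as described in the context, with associated boundary arcs $I_1,\dots,I_4$, angles $\beta_1,\dots,\beta_4$ and contours $L^{(\sigma)}_{\beta_1},\dots,L^{(\sigma)}_{\beta_4}$. For $t\in\mathbb{C}\setminus\{0\}$ and $j=1,\dots,4$ put $$\rho_j(t)=\int_{I_j}e^{-\mathrm{i}t\zeta+\mathrm{i}\sigma\overline{\zeta}/t}\Big[\phi(\zeta)\,\frac{\mathrm{i}\sigma}{t}\,d\overline{\zeta}+\frac{\partial\phi}{\partial\zeta}(\zeta)\,d\zeta\Big].$$ Then, for every $z\in\mathrm{int}(T)$, $$\phi(z)=\frac{1}{2\pi \mathrm{i}}\sum_{j=1}^4\int_{L^{(\sigma)}_{\beta_j}}e^{\mathrm{i}tz-\mathrm{i}\sigma\overline{z}/t}\,\rho_j(t)\,\frac{dt}{t}.$$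
   Context: $\Delta=\partial^2/\partial x^2+\partial^2/\partial y^2$, and $\partial/\partial\zeta=\tfrac12(\partial_x-\mathrm{i}\partial_y)$ for $\zeta=x+\mathrm{i}y$. A trapezoid is a quadrilateral with at least one pair of parallel sides. Throughout, $T$ is a trapezoid with two parallel sides that are parallel to the $x$-axis (horizontal), whose vertices lie on $\partial\Omega$, and whose closure is contained in $\overline\Omega$; $\mathrm{int}(T)$ is its interior. Labelling: $T_1$ is the lowest horizontal side of $T$, and $T_2,T_3,T_4$ are the remaining sides in the order met when traversing the boundary of $T$ counterclockwise starting from $T_1$. The vertex $v_1$ is the leftmost vertex of $T_1$, and $v_2,v_3,v_4$ follow in counterclockwise order; thus $T_k$ joins $v_k$ to $v_{k+1}$ (with $v_5=v_1$). The vertices partition $\partial\Omega$ into four adjacent arcs; $I_k$ is the arc subtended by $T_k$, i.e. the arc of $\partial\Omega$ going counterclockwise from $v_k$ to $v_{k+1}$. Integrals over $I_k$ are taken counterclockwise. Angles: fix $\alpha\in\mathrm{int}(T)$. For $k=1,\dots,4$, $\beta_k\in[0,2\pi)$ is an angle such that the map $\Psi_k(w)=e^{-\mathrm{i}\beta_k}(w-\alpha)$ satisfies $\operatorname{Im}\Psi_k(\zeta)<0$ and $\operatorname{Im}\Psi_k(\zeta)<\operatorname{Im}\Psi_k(z)$ for all $\zeta\in I_k$ and $z\in\mathrm{int}(T)$. Contours: $L^{(\sigma)}_0$ is a piecewise smooth contour in $\mathbb{C}\setminus\{0\}$ going from $0$ to $\infty$, coinciding near $0$ with a ray of argument $\arg\sigma$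 and near $\infty$ with a ray of argument $0$, where along the contour a continuous branch of $\arg t$ goes from $\arg\sigma\in(0,\pi)$ (at $0$) to $0$ (at $\infty$), i.e. there is no extra winding around $0$. For real $\chi$, $L^{(\sigma)}_\chi$ is the rotation of $L^{(\sigma)}_0$ about the origin through the angle $-\chi$; it leaves $0$ at angle $\arg\sigma-\chi$ and goes to $\infty$ at angle $-\chi$. The contours are such that the free-space Green's function $G(\zeta,z)=-\frac{1}{2\pi}K_0(2\sqrt{\sigma}\,|z-\zeta|)$ of $\Delta-4\sigma$ ($K_0$ the modified Bessel function of order zero, $\sqrt\sigma$ the principal root) is represented as $G(\zeta,z)=-\frac{1}{4\pi}\int_{L^{(\sigma)}_\chi}e^{\mathrm{i}t(z-\zeta)-\mathrm{i}\sigma\overline{(z-\zeta)}/t}\,\frac{dt}{t}$ whenever $\chi<\arg(z-\zeta)<\chi+\pi$. *)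

theory Defs
  imports "HOL-Complex_Analysis.Complex_Analysis"
begin

definition dir_deriv :: "complex \<Rightarrow> (complex \<Rightarrow> complex) \<Rightarrow> complex \<Rightarrow> complex" where
  "dir_deriv u f \<zeta> = vector_derivative (\<lambda>s::real. f (\<zeta> + s *\<^sub>R u)) (at 0)"

abbreviation partial_x :: "(complex \<Rightarrow> complex) \<Rightarrow> complex \<Rightarrow> complex" where
  "partial_x \<equiv> dir_deriv 1"

abbreviation partial_y :: "(complex \<Rightarrow> complex) \<Rightarrow> complex \<Rightarrow> complex" where
  "partial_y \<equiv> dir_deriv \<i>"

definition wirtinger_deriv :: "(complex \<Rightarrow> complex) \<Rightarrow> complex \<Rightarrow> complex" where
  "wirtinger_deriv f \<zeta> = (partial_x f \<zeta> - \<i> * partial_y f \<zeta>) / 2"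

definition laplacian :: "(complex \<Rightarrow> complex) \<Rightarrow> complex \<Rightarrow> complex" where
  "laplacian f \<zeta> = partial_x (partial_x f) \<zeta> + partial_y (partial_y f) \<zeta>"

definition real_C1_on :: "(complex \<Rightarrow> complex) \<Rightarrow> complex set \<Rightarrow> bool" where
  "real_C1_on f U \<longleftrightarrow>
     (\<forall>u\<in>{1, \<i>}. (\<forall>\<zeta>\<in>U. (\<lambda>s::real. f (\<zeta> + s *\<^sub>R u)) differentiable (at 0)) \<and>
                  continuous_on U (dir_deriv u f))"

definition real_C2_on :: "(complex \<Rightarrow> complex) \<Rightarrow> complex set \<Rightarrow> bool" where
  "real_C2_on f U \<longleftrightarrow>
     real_C1_on f U \<and> real_C1_on (partial_x f) U \<and> real_C1_on (partial_y f) U"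

text \<open>
  The boundary of a bounded convex domain is rectifiable but in general not piecewise smooth (it may
  have infinitely many corners), so the boundary arcs are parametrized by Lipschitz paths;
  parametrization proportional to arc length is one. The second conjunct follows
  from the first by Rademacher's theorem and so excludes no Lipschitz path. For such paths
  \<^const>\<open>contour_integral\<close>, which uses the derivative of the path almost everywhere,
  is the usual line integral.
\<close>

definition lipschitz_path :: "(real \<Rightarrow> complex) \<Rightarrow> bool" where
  "lipschitz_path g \<longleftrightarrow>
     (\<exists>C. C-lipschitz_on {0..1} g) \<and>
     (\<exists>N. negligible N \<and> (\<forall>s\<in>{0..1} - N. g differentiable (at s within {0..1})))"

definition ccw_boundary :: "complex set \<Rightarrow> (real \<Rightarrow> complex) \<Rightarrow> bool" where
  "ccw_boundary \<Omega> g \<longleftrightarrow>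
     simple_path g \<and> pathfinish g = pathstart g \<and> path_image g = frontier \<Omega> \<and>
     (\<forall>w\<in>\<Omega>. winding_number g w = 1)"

definition contour_integral_cnj :: "(real \<Rightarrow> complex) \<Rightarrow> (complex \<Rightarrow> complex) \<Rightarrow> complex" where
  "contour_integral_cnj g f =
     integral {0..1} (\<lambda>s. f (g s) * cnj (vector_derivative g (at s within {0..1})))"

definition rho :: "complex \<Rightarrow> (complex \<Rightarrow> complex) \<Rightarrow> (real \<Rightarrow> complex) \<Rightarrow> complex \<Rightarrow> complex" where
  "rho \<sigma> \<phi> I t =
     contour_integral_cnj I (\<lambda>\<zeta>. exp (- \<i> * t * \<zeta> + \<i> * \<sigma> * cnj \<zeta> / t) * (\<phi> \<zeta> * (\<i> * \<sigma> / t))) +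
     contour_integral I (\<lambda>\<zeta>. exp (- \<i> * t * \<zeta> + \<i> * \<sigma> * cnj \<zeta> / t) * wirtinger_deriv \<phi> \<zeta>)"

text \<open>
  \<open>v 1, v 2, v 3, v 4\<close> are the vertices in counterclockwise order, \<open>v 1\<close> being the left end point of
  the lower horizontal side.
\<close>

definition horizontal_trapezoid :: "(nat \<Rightarrow> complex) \<Rightarrow> bool" where
  "horizontal_trapezoid v \<longleftrightarrow>
     Im (v 1) = Im (v 2) \<and> Im (v 3) = Im (v 4) \<and> Im (v 1) < Im (v 3) \<and>
     Re (v 1) < Re (v 2) \<and> Re (v 4) < Re (v 3)"

text \<open>
  Contours from \<open>0\<close> to \<open>\<infinity>\<close> are parametrized by \<open>{0<..}\<close>, with the modulus as the
  parameter on the initial and the final ray. The function \<open>\<theta>\<close> is the continuous branch of the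
  argument along the contour.
\<close>

definition helmholtz_contour :: "complex \<Rightarrow> (real \<Rightarrow> complex) \<Rightarrow> bool" where
  "helmholtz_contour \<sigma> L \<longleftrightarrow>
     (\<exists>a b \<theta>. 0 < a \<and> a < b \<and>
        L piecewise_C1_differentiable_on {a..b} \<and>
        (\<forall>s\<in>{0<..a}. L s = of_real s * cis (Arg \<sigma>)) \<and>
        (\<forall>s\<in>{b..}. L s = of_real s) \<and>
        (\<forall>s\<in>{0<..}. L s \<noteq> 0 \<and> L s = of_real (cmod (L s)) * cis (\<theta> s)) \<and>
        continuous_on {0<..} \<theta> \<and>
        (\<forall>s\<in>{0<..a}. \<theta> s = Arg \<sigma>) \<and>
        (\<forall>s\<in>{b..}. \<theta> s = 0))"

definition rotate_contour :: "real \<Rightarrow> (real \<Rightarrow> complex) \<Rightarrow> real \<Rightarrow> complex" where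
  "rotate_contour b L s = cis (- b) * L s"

definition contour_integrable_0_inf :: "(real \<Rightarrow> complex) \<Rightarrow> (complex \<Rightarrow> complex) \<Rightarrow> bool" where
  "contour_integrable_0_inf L f \<longleftrightarrow> (\<lambda>s. f (L s) * vector_derivative L (at s)) integrable_on {0<..}"

definition contour_integral_0_inf :: "(real \<Rightarrow> complex) \<Rightarrow> (complex \<Rightarrow> complex) \<Rightarrow> complex" where
  "contour_integral_0_inf L f = integral {0<..} (\<lambda>s. f (L s) * vector_derivative L (at s))"

end

theory Submission
  imports Defs "HOL-Real_Asymp.Real_Asymp"
begin

text \<open>
  Put \<open>E(t, w) = exp (i t w - i \<sigma> cnj w / t)\<close>. For fixed \<open>t\<close> this is a solution of the Helmholtz equation
  in \<open>w\<close>, and its integral \<open>F(w)\<close> against \<open>dt / t\<close> along a rotated contour is a multiple of the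
  free-space Green's function. On the arc \<open>I j\<close> the rotated differences
  \<open>w = exp (- i \<beta> j) (z - \<zeta>)\<close> have imaginary part bounded below by a positive constant, which makes
  \<open>E\<close> decay exponentially at both ends of the contour. So the integral over the contour and the
  integral over the arc may be exchanged, and the right-hand side of the theorem becomes the boundary
  integral of
  \<open>F(z - \<zeta>) \<partial>\<phi>(\<zeta>) d\<zeta> - \<phi>(\<zeta>) (\<partial>F/\<partial>cnj w)(z - \<zeta>) d(cnj \<zeta>)\<close>.
  The theorem is then Green's representation formula. Three points carry the proof.

  First, the four arcs use four different rotations, so \<open>F\<close> must not depend on the rotation, that is,
  it must be radial. A rotation of \<open>w\<close> acts on \<open>E\<close> like the Euler derivation \<open>t d/dt\<close>,
  hence the angular derivative of \<open>F\<close> is the integral of a total derivative, which vanishes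
  (\<open>moment_recurrence\<close>, \<open>moment_rotation\<close>). The same recurrence gives the radial differential equation,
  and \<open>radial_flux_tendsto\<close> gives the strength of the logarithmic singularity at \<open>0\<close>.

  Second, the boundary is merely a Lipschitz curve \<open>g\<close>. By convexity the dilated curve
  \<open>z + s (g - z)\<close> stays in \<open>\<Omega>\<close> for \<open>0 < s < 1\<close>, and since the form above is closed away from \<open>z\<close>,
  its integral does not depend on \<open>s\<close>. Letting \<open>s\<close> tend to \<open>1\<close> gives the boundary integral; letting
  \<open>s\<close> tend to \<open>0\<close> gives \<open>\<phi>(z)\<close> times the logarithmic integral of the curve, that is, its winding
  number (\<open>closed_form_integral_chain\<close>, \<open>green_representation\<close>). The fundamental theorem of calculus
  used along the curve is the one for Lipschitz functions (\<open>FTC_locally_Lipschitz\<close>).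

  Third, the derivative of a piecewise \<open>C\<^sup>1\<close> contour may be unbounded near the exceptional
  points, so that the integral over the contour need not be absolutely convergent and Fubini's theorem
  does not apply to it directly. The transforms of the arcs are holomorphic in \<open>t\<close> off \<open>0\<close>, hence the
  contour can be exchanged for an explicit one with the same ends and the same change of argument,
  parametrized by the modulus (\<open>has_integral_helmholtz_path\<close>). All estimates are made there.
\<close>

section \<open>Differentiation under the integral sign\<close>

text \<open>
  The remainder of the first-order expansion, divided by the norm of the increment, tends to \<open>0\<close>
  pointwise and is at most \<open>2 B\<close> by the mean value inequality, so dominated convergence applies. The
  Frechet form covers the three uses below: a real dilation parameter, holomorphy in \<open>t\<close>, and real
  differentiability in a complex variable.
\<close>

lemma has_derivative_lebesgue_integral:
  fixes F :: "'k::{real_normed_vector, perfect_space} \<Rightarrow> 'a \<Rightarrow> 'b::{banach, second_countable_topology}"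
  assumes S: "open S" "convex S" "x0 \<in> S"
    and int: "\<And>x. x \<in> S \<Longrightarrow> integrable M (F x)"
    and der: "\<And>x t. x \<in> S \<Longrightarrow> t \<in> space M \<Longrightarrow> ((\<lambda>x. F x t) has_derivative F' x t) (at x)"
    and bd: "\<And>x t h. x \<in> S \<Longrightarrow> t \<in> space M \<Longrightarrow> norm (F' x t h) \<le> B t * norm h"
    and B: "integrable M B"
    and meas: "\<And>h. (\<lambda>t. F' x0 t h) \<in> borel_measurable M"
  shows "((\<lambda>x. \<integral>t. F x t \<partial>M) has_derivative (\<lambda>h. \<integral>t. F' x0 t h \<partial>M)) (at x0)"
proof -
  have intF': "integrable M (\<lambda>t. F' x0 t h)" for h
  proof (rule Bochner_Integration.integrable_bound[of M "\<lambda>t. B t * norm h"])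
    show "AE t in M. norm (F' x0 t h) \<le> norm (B t * norm h)"
      using bd[OF S(3)] by (intro AE_I2) (metis abs_ge_self order_trans real_norm_def)
  qed (use B meas in auto)
  have lin: "linear (F' x0 t)" if "t \<in> space M" for t
    using der[OF S(3) that] by (simp add: bounded_linear.linear has_derivative_bounded_linear)
  have bl: "bounded_linear (\<lambda>h. \<integral>t. F' x0 t h \<partial>M)"
  proof (rule bounded_linear_intro[where K="\<integral>t. B t \<partial>M"])
    fix x y show "(\<integral>t. F' x0 t (x + y) \<partial>M) = (\<integral>t. F' x0 t x \<partial>M) + (\<integral>t. F' x0 t y \<partial>M)"
      by (subst Bochner_Integration.integral_add[symmetric])
        (auto intro!: intF' Bochner_Integration.integral_cong linear_add lin)
  next
    fix r x show "(\<integral>t. F' x0 t (r *\<^sub>R x) \<partial>M) = r *\<^sub>R (\<integral>t. F' x0 t x \<partial>M)"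
      by (simp add: linear_cmul[OF lin] flip: integral_scaleR_right cong: Bochner_Integration.integral_cong)
  next
    fix x
    have "norm (\<integral>t. F' x0 t x \<partial>M) \<le> (\<integral>t. norm (F' x0 t x) \<partial>M)" by simp
    also have "\<dots> \<le> (\<integral>t. B t * norm x \<partial>M)"
      by (intro integral_mono integrable_norm intF' integrable_mult_left B bd S)
    finally show "norm (\<integral>t. F' x0 t x \<partial>M) \<le> norm x * (\<integral>t. B t \<partial>M)" by (simp add: mult.commute)
  qed
  let ?q = "\<lambda>y. norm ((\<integral>t. F y t \<partial>M) - (\<integral>t. F x0 t \<partial>M) - (\<integral>t. F' x0 t (y - x0) \<partial>M)) / norm (y - x0)"
  have "((\<lambda>y. ?q y) \<longlongrightarrow> 0) (at x0)"
    unfolding tendsto_at_iff_sequentially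
  proof (intro allI impI)
    fix X assume X: "\<forall>i. X i \<in> UNIV - {x0}" "X \<longlonglongrightarrow> x0"
    then have "eventually (\<lambda>n. X n \<in> S) sequentially"
      using S by (simp add: topological_tendstoD)
    then obtain k where k: "\<And>n. n \<ge> k \<Longrightarrow> X n \<in> S" by (auto simp: eventually_sequentially)
    define Y where "Y n = X (n + k)" for n
    have Y: "Y n \<in> S" "Y n \<noteq> x0" for n using k X by (auto simp: Y_def)
    have Yl: "Y \<longlonglongrightarrow> x0" unfolding Y_def using X(2) by (rule LIMSEQ_ignore_initial_segment)
    define q where "q n t = norm (F (Y n) t - F x0 t - F' x0 t (Y n - x0)) / norm (Y n - x0)" for n t
    have q0: "(\<lambda>n. q n t) \<longlonglongrightarrow> 0" if "t \<in> space M" for t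
    proof -
      have "((\<lambda>y. norm (F y t - F x0 t - F' x0 t (y - x0)) / norm (y - x0)) \<longlongrightarrow> 0) (at x0)"
        using der[OF S(3) that] by (simp add: has_derivative_iff_norm)
      moreover have "filterlim Y (at x0) sequentially"
        using Y Yl by (simp add: filterlim_at)
      ultimately show ?thesis
        unfolding q_def by (rule filterlim_compose)
    qed
    have qB: "q n t \<le> 2 * B t" if t: "t \<in> space M" for n t
    proof -
      have "norm (F (Y n) t - F x0 t) \<le> B t * norm (Y n - x0)"
      proof (rule differentiable_bound[OF S(2), where f' = "\<lambda>x. F' x t"])
        show "((\<lambda>x. F x t) has_derivative F' x t) (at x within S)" if "x \<in> S" for x
          using der[OF that t] by (rule has_derivative_at_withinI)
        show "onorm (F' x t) \<le> B t" if "x \<in> S" for x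
          by (rule onorm_le) (use bd[OF that t] in auto)
      qed (use Y S in auto)
      moreover have "norm (F' x0 t (Y n - x0)) \<le> B t * norm (Y n - x0)" by (rule bd[OF S(3) t])
      ultimately have "norm (F (Y n) t - F x0 t - F' x0 t (Y n - x0)) \<le> 2 * B t * norm (Y n - x0)"
        using norm_triangle_ineq4[of "F (Y n) t - F x0 t" "F' x0 t (Y n - x0)"] by (simp add: algebra_simps)
      then show ?thesis unfolding q_def using Y(2)[of n] by (simp add: divide_le_eq)
    qed
    have intD: "integrable M (\<lambda>t. F (Y n) t - F x0 t - F' x0 t (Y n - x0))" for n
      by (intro Bochner_Integration.integrable_diff int intF' Y S)
    have qlim: "(\<lambda>n. \<integral>t. q n t \<partial>M) \<longlonglongrightarrow> (\<integral>t. 0 \<partial>M)"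
    proof (rule integral_dominated_convergence[where w="\<lambda>t. 2 * B t"])
      show "(\<lambda>t. 0) \<in> borel_measurable M" by simp
      show "q n \<in> borel_measurable M" for n
        unfolding q_def using borel_measurable_integrable[OF intD[of n]] by measurable
      show "integrable M (\<lambda>t. 2 * B t)" using B by simp
      show "AE t in M. (\<lambda>n. q n t) \<longlonglongrightarrow> 0" using q0 by auto
      show "AE t in M. norm (q n t) \<le> 2 * B t" for n
        using qB by (auto simp: q_def)
    qed
    have "(\<lambda>n. ?q (Y n)) \<longlonglongrightarrow> 0"
    proof (rule tendsto_sandwich[OF _ _ tendsto_const])
      show "(\<lambda>n. \<integral>t. q n t \<partial>M) \<longlonglongrightarrow> 0" using qlim by simp
      show "\<forall>\<^sub>F n in sequentially. ?q (Y n) \<le> (\<integral>t. q n t \<partial>M)"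
      proof (intro always_eventually allI)
        fix n
        have "(\<integral>t. F (Y n) t \<partial>M) - (\<integral>t. F x0 t \<partial>M) - (\<integral>t. F' x0 t (Y n - x0) \<partial>M)
           = (\<integral>t. F (Y n) t - F x0 t - F' x0 t (Y n - x0) \<partial>M)"
          by (simp add: int intF' Y S Bochner_Integration.integrable_diff)
        also have "norm \<dots> \<le> (\<integral>t. norm (F (Y n) t - F x0 t - F' x0 t (Y n - x0)) \<partial>M)"
          by (rule integral_norm_bound)
        finally show "?q (Y n) \<le> (\<integral>t. q n t \<partial>M)"
          unfolding q_def by (simp add: divide_right_mono)
      qed
    qed auto
    then show "((\<lambda>y. ?q y) \<circ> X) \<longlonglongrightarrow> 0"
      unfolding Y_def comp_def by (rule LIMSEQ_offset)
  qed
  with bl show ?thesis by (simp add: has_derivative_iff_norm)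
qed

section \<open>The fundamental theorem of calculus for Lipschitz functions\<close>

lemma has_vector_derivative_imp_quotient_LIMSEQ:
  assumes f: "(f has_vector_derivative D) (at x within S)"
    and X: "X \<longlonglongrightarrow> 0" "\<And>n. X n \<noteq> 0" "eventually (\<lambda>n. x + X n \<in> S) sequentially"
  shows "(\<lambda>n. (f (x + X n) - f x) /\<^sub>R X n) \<longlonglongrightarrow> D"
proof -
  have "((\<lambda>y. norm (f y - f x - (y - x) *\<^sub>R D) / norm (y - x)) \<longlongrightarrow> 0) (at x within S)"
    using f by (simp add: has_vector_derivative_def has_derivative_iff_norm)
  moreover have "filterlim (\<lambda>n. x + X n) (at x within S) sequentially"
    using X tendsto_add[OF tendsto_const X(1), of x] by (simp add: filterlim_at)
  ultimately have "(\<lambda>n. norm (f (x + X n) - f x - X n *\<^sub>R D) / norm (X n)) \<longlonglongrightarrow> 0"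
    by (auto dest: filterlim_compose)
  also have "(\<lambda>n. norm (f (x + X n) - f x - X n *\<^sub>R D) / norm (X n)) = (\<lambda>n. norm ((f (x + X n) - f x) /\<^sub>R X n - D))"
  proof
    fix n
    have "(f (x + X n) - f x) /\<^sub>R X n - D = (f (x + X n) - f x - X n *\<^sub>R D) /\<^sub>R X n"
      using X(2)[of n] by (simp add: scaleR_diff_right)
    then show "norm (f (x + X n) - f x - X n *\<^sub>R D) / norm (X n) = norm ((f (x + X n) - f x) /\<^sub>R X n - D)"
      by (simp add: divide_inverse)
  qed
  finally show ?thesis
    using LIM_zero_cancel tendsto_norm_zero_iff by blast
qed

text \<open>
  Extended by its end values, \<open>h\<close> has continuous difference quotients that are bounded by \<open>C\<close> and
  converge to \<open>h'\<close> wherever the derivative exists. If \<open>P\<close> is a primitive of the extension, the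
  integral of a difference quotient of \<open>h\<close> is the difference of the difference quotients of \<open>P\<close> at
  \<open>1\<close> and at \<open>0\<close>, which converges to \<open>h 1 - h 0\<close>.
\<close>

lemma difference_quotients_locally_Lipschitz:
  fixes h :: "real \<Rightarrow> 'a::euclidean_space"
  assumes cont: "continuous_on {0..1} h" and "0 < \<delta>" "0 \<le> C"
    and lip: "\<And>x y. x \<in> {0..1} \<Longrightarrow> y \<in> {0..1} \<Longrightarrow> \<bar>x - y\<bar> < \<delta> \<Longrightarrow> norm (h x - h y) \<le> C * \<bar>x - y\<bar>"
    and der: "\<And>x. x \<in> {0..1} - N \<Longrightarrow> (h has_vector_derivative h' x) (at x within {0..1})"
  obtains f :: "nat \<Rightarrow> real \<Rightarrow> 'a"
  where "\<And>n. continuous_on UNIV (f n)" "\<And>n x. norm (f n x) \<le> C"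
    "\<And>x. x \<in> {0..1} - (N \<union> {1}) \<Longrightarrow> (\<lambda>n. f n x) \<longlonglongrightarrow> h' x"
    "(\<lambda>n. integral {0..1} (f n)) \<longlonglongrightarrow> h 1 - h 0"
proof -
  define cl where "cl x = min 1 (max 0 x)" for x :: real
  define k where "k = h \<circ> cl"
  \<comment> \<open>The steps are shorter than \<open>\<delta>\<close>, where the Lipschitz bound holds.\<close>
  define e where "e n = min \<delta> 1 / (real n + 2)" for n
  have e: "0 < e n" "e n < \<delta>" "e n < 1" for n
  proof -
    have m: "0 < min \<delta> 1" using \<open>0 < \<delta>\<close> by simp
    then have "e n < min \<delta> 1" unfolding e_def by (subst divide_less_eq) auto
    with m show "0 < e n" "e n < \<delta>" "e n < 1" by (auto simp: e_def)
  qed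
  have e0: "e \<longlonglongrightarrow> 0" unfolding e_def by real_asymp
  have ck: "continuous_on UNIV k"
    unfolding k_def by (rule continuous_on_compose) (auto simp: cl_def intro!: continuous_intros continuous_on_subset[OF cont])
  obtain P where P: "\<And>x. x \<in> {-1..3} \<Longrightarrow> (P has_vector_derivative k x) (at x within {-1..3})"
    using antiderivative_continuous[OF continuous_on_subset[OF ck]] by blast
  have P': "(P has_vector_derivative k x) (at x)" if "x \<in> {-1<..<3}" for x
    using P[of x] that by (simp add: at_within_Icc_at)
  define f where "f n x = (k (x + e n) - k x) /\<^sub>R e n" for n x
  show ?thesis
  proof
    show "continuous_on UNIV (f n)" for n
      unfolding f_def by (intro continuous_intros continuous_on_compose2[OF ck]) auto
    show "norm (f n x) \<le> C" for n x
    proof -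
      have c: "cl (x + e n) \<in> {0..1}" "cl x \<in> {0..1}" "\<bar>cl (x + e n) - cl x\<bar> \<le> e n"
        using e[of n] by (auto simp: cl_def)
      have "norm (k (x + e n) - k x) \<le> C * \<bar>cl (x + e n) - cl x\<bar>"
        unfolding k_def comp_def using lip[OF c(1,2)] c(3) e[of n] by auto
      also have "\<dots> \<le> C * e n" using c \<open>0 \<le> C\<close> by (intro mult_left_mono) auto
      finally show ?thesis using e[of n] by (simp add: f_def divide_simps mult.commute)
    qed
    show "(\<lambda>n. f n x) \<longlonglongrightarrow> h' x" if x: "x \<in> {0..1} - (N \<union> {1})" for x
    proof -
      have ev: "eventually (\<lambda>n. x + e n \<in> {0..1}) sequentially"
      proof -
        have "eventually (\<lambda>n. e n < 1 - x) sequentially"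
          using order_tendstoD(2)[OF e0, of "1 - x"] x by auto
        then show ?thesis by eventually_elim (use e x in \<open>auto simp: less_imp_le add_nonneg_nonneg\<close>)
      qed
      have "(\<lambda>n. (h (x + e n) - h x) /\<^sub>R e n) \<longlonglongrightarrow> h' x"
        using x e0 e ev by (intro has_vector_derivative_imp_quotient_LIMSEQ[OF der]) (auto simp: less_imp_neq[THEN not_sym])
      moreover have "\<forall>\<^sub>F n in sequentially. (h (x + e n) - h x) /\<^sub>R e n = f n x"
        using ev by eventually_elim (use x in \<open>auto simp: f_def k_def cl_def\<close>)
      ultimately show ?thesis by (rule Lim_transform_eventually)
    qed
    have fi: "integral {0..1} (f n) = (P (1 + e n) - P 1) /\<^sub>R e n - (P (0 + e n) - P 0) /\<^sub>R e n" for n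
    proof -
      have "(f n has_integral ((P (1 + e n) - P 1) /\<^sub>R e n) - ((P (0 + e n) - P 0) /\<^sub>R e n)) {0..1}"
      proof (rule fundamental_theorem_of_calculus)
        fix x :: real assume x: "x \<in> {0..1}"
        have "((\<lambda>x. P (x + e n)) has_vector_derivative k (x + e n)) (at x)"
          using vector_diff_chain_at[of "\<lambda>x. x + e n" 1 x P "k (x + e n)"] P'[of "x + e n"] x e[of n]
          by (auto simp: comp_def has_vector_derivative_add_const intro!: derivative_eq_intros)
        then have "((\<lambda>x. (P (x + e n) - P x) /\<^sub>R e n) has_vector_derivative f n x) (at x)"
          unfolding f_def using P'[of x] x
          by (auto intro!: derivative_eq_intros)
        then show "((\<lambda>x. (P (x + e n) - P x) /\<^sub>R e n) has_vector_derivative f n x) (at x within {0..1})"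
          by (rule has_vector_derivative_at_within)
      qed simp
      then show ?thesis by (rule integral_unique)
    qed
    have "(\<lambda>n. (P (1 + e n) - P 1) /\<^sub>R e n - (P (0 + e n) - P 0) /\<^sub>R e n) \<longlonglongrightarrow> k 1 - k 0"
      using e e0 by (intro tendsto_diff has_vector_derivative_imp_quotient_LIMSEQ[OF P'])
        (auto simp: less_imp_neq[THEN not_sym])
    then show "(\<lambda>n. integral {0..1} (f n)) \<longlonglongrightarrow> h 1 - h 0"
      unfolding fi by (simp add: k_def cl_def)
  qed
qed

text \<open>
  Dominated convergence along the difference quotients. The Lipschitz bound is asked for nearby
  points only, because for a function composed with a curve it is available only there.
\<close>

theorem FTC_locally_Lipschitz:
  fixes h :: "real \<Rightarrow> 'a::euclidean_space"
  assumes cont: "continuous_on {0..1} h" and "0 < \<delta>" "0 \<le> C"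
    and lip: "\<And>x y. x \<in> {0..1} \<Longrightarrow> y \<in> {0..1} \<Longrightarrow> \<bar>x - y\<bar> < \<delta> \<Longrightarrow> norm (h x - h y) \<le> C * \<bar>x - y\<bar>"
    and N: "negligible N"
    and der: "\<And>x. x \<in> {0..1} - N \<Longrightarrow> (h has_vector_derivative h' x) (at x within {0..1})"
  shows "(h' has_integral (h 1 - h 0)) {0..1}"
proof -
  obtain f where f: "\<And>n. continuous_on UNIV (f n)" "\<And>n x. norm (f n x) \<le> C"
    "\<And>x. x \<in> {0..1} - (N \<union> {1}) \<Longrightarrow> (\<lambda>n. f n x) \<longlonglongrightarrow> h' x"
    "(\<lambda>n. integral {0..1} (f n)) \<longlonglongrightarrow> h 1 - h 0"
    by (rule difference_quotients_locally_Lipschitz[OF assms(1-4) der]) blast+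
  define g where "g x = (if x \<in> N \<union> {1} then 0 else h' x)" for x
  define F where "F n x = (if x \<in> N \<union> {1} then 0 else f n x)" for n x
  have N1: "negligible (N \<union> {1})" using N by simp
  have Fint: "F n integrable_on {0..1} \<and> integral {0..1} (F n) = integral {0..1} (f n)" for n
  proof -
    have fi: "f n integrable_on {0..1}" using f(1) continuous_on_subset integrable_continuous_real by blast
    then have "(F n has_integral integral {0..1} (f n)) {0..1}"
      by (intro has_integral_spike[OF N1 _ integrable_integral[OF fi]]) (auto simp: F_def)
    then show ?thesis by blast
  qed
  have dc: "g integrable_on {0..1}" "(\<lambda>n. integral {0..1} (F n)) \<longlonglongrightarrow> integral {0..1} g"
  proof -
    have 1: "F n integrable_on {0..1}" for n using Fint by blast
    have 2: "norm (F n x) \<le> C" for n x using f(2)[of n x] \<open>0 \<le> C\<close> by (simp add: F_def)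
    have 3: "(\<lambda>n. F n x) \<longlonglongrightarrow> g x" if "x \<in> {0..1}" for x
      using f(3)[of x] that by (auto simp: F_def g_def)
    show "g integrable_on {0..1}" "(\<lambda>n. integral {0..1} (F n)) \<longlonglongrightarrow> integral {0..1} g"
      by (rule dominated_convergence[where h="\<lambda>_. C" and f=F], use 1 2 3 in auto)+
  qed
  then have "integral {0..1} g = h 1 - h 0" using f(4) Fint LIMSEQ_unique by auto
  with dc(1) have "(g has_integral (h 1 - h 0)) {0..1}" using integrable_integral by fastforce
  then show ?thesis
    by (rule has_integral_spike[OF N1, rotated]) (auto simp: g_def)
qed

text \<open>
  As a limit of difference quotients the derivative is measurable and bounded by the Lipschitz
  constant. Setting it to \<open>0\<close> on the null set where the limit is not known makes both properties hold
  everywhere, as measurability on a product space requires.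
\<close>

lemma lipschitz_path_derivative:
  assumes "lipschitz_path g"
  obtains C D N where "negligible N" "0 \<le> C" "C-lipschitz_on {0..1} g"
    "D \<in> borel_measurable (lebesgue_on {0..1})" "\<And>x. norm (D x) \<le> C"
    "\<And>x. x \<in> {0..1} - N \<Longrightarrow> (g has_vector_derivative D x) (at x within {0..1})"
proof -
  obtain C N where C: "C-lipschitz_on {0..1} g" and N: "negligible N"
    and d: "\<And>s. s \<in> {0..1} - N \<Longrightarrow> g differentiable (at s within {0..1})"
    using assms unfolding lipschitz_path_def by blast
  have C0: "0 \<le> C" using C by (rule lipschitz_on_nonneg)
  define v where "v x = vector_derivative g (at x within {0..1})" for x
  have der: "(g has_vector_derivative v x) (at x within {0..1})" if "x \<in> {0..1} - N" for x
    using d[OF that] unfolding v_def vector_derivative_works .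
  have lip: "norm (g x - g y) \<le> C * \<bar>x - y\<bar>" if "x \<in> {0..1}" "y \<in> {0..1}" for x y
    using lipschitz_onD[OF C that] by (simp add: dist_norm)
  obtain f where f: "\<And>n. continuous_on UNIV (f n)" "\<And>n x. norm (f n x) \<le> C"
    "\<And>x. x \<in> {0..1} - (N \<union> {1}) \<Longrightarrow> (\<lambda>n. f n x) \<longlonglongrightarrow> v x"
    "(\<lambda>n. integral {0..1} (f n)) \<longlonglongrightarrow> g 1 - g 0"
    by (rule difference_quotients_locally_Lipschitz[of g 1 C N v])
      (use der lip C0 lipschitz_on_continuous_on[OF C] in auto)
  define E where "E = {0..1} - (N \<union> {1})"
  have E: "E \<in> sets lebesgue"
    unfolding E_def using N by (intro sets.Diff sets.Un) (auto simp: negligible_imp_sets)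
  define D where "D x = (if x \<in> E then v x else 0)" for x
  show ?thesis
  proof
    \<comment> \<open>The quotients look forward, so nothing is known about their limit at \<open>1\<close>.\<close>
    show "negligible (N \<union> {1})" using N by simp
    show "0 \<le> C" "C-lipschitz_on {0..1} g" by fact+
    show "D \<in> borel_measurable (lebesgue_on {0..1})"
    proof (rule borel_measurable_LIMSEQ_metric)
      show "(\<lambda>x. if x \<in> E then f n x else 0) \<in> borel_measurable (lebesgue_on {0..1})" for n
      proof (rule measurable_If_set)
        show "f n \<in> borel_measurable (lebesgue_on {0..1})"
          using f(1) by (auto intro!: continuous_imp_measurable_on_sets_lebesgue intro: continuous_on_subset)
        show "E \<inter> space (lebesgue_on {0..1}) \<in> sets (lebesgue_on {0..1})"
          using E by (auto simp: sets_restrict_space image_iff Int_commute)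
      qed simp
      show "(\<lambda>n. if x \<in> E then f n x else 0) \<longlonglongrightarrow> D x" for x
        using f(3)[of x] by (auto simp: D_def E_def)
    qed
    show "norm (D x) \<le> C" for x
    proof (cases "x \<in> E")
      case True
      then have "(\<lambda>n. f n x) \<longlonglongrightarrow> v x" using f(3)[of x] by (auto simp: E_def)
      then show ?thesis
        using f(2) True by (auto simp: D_def intro: LIMSEQ_le_const2 tendsto_norm)
    qed (use C0 in \<open>auto simp: D_def\<close>)
    show "(g has_vector_derivative D x) (at x within {0..1})" if "x \<in> {0..1} - (N \<union> {1})" for x
      using der[of x] that by (auto simp: D_def E_def)
  qed
qed

section \<open>Logarithms and winding numbers along paths\<close>

text \<open>
  Near \<open>x\<close> the increments of \<open>q\<close> stay in the strip where \<open>Ln\<close> inverts \<open>exp\<close>, so \<open>q\<close> is locally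
  \<open>q x + Ln (p y / p x)\<close>.
\<close>

lemma has_vector_derivative_continuous_log:
  fixes p q :: "real \<Rightarrow> complex"
  assumes p: "(p has_vector_derivative d) (at x within S)"
    and q: "continuous (at x within S) q"
    and pq: "\<And>y. y \<in> S \<Longrightarrow> p y = exp (q y)" and x: "x \<in> S"
  shows "(q has_vector_derivative d / p x) (at x within S)"
proof -
  have nz: "p x \<noteq> 0" using pq[OF x] by simp
  obtain e where e: "0 < e" "\<And>y. y \<in> S \<Longrightarrow> dist y x < e \<Longrightarrow> dist (q y) (q x) < 1"
    using q unfolding continuous_within_eps_delta by (meson zero_less_one)
  have "((\<lambda>y. Ln (p y / p x)) has_vector_derivative (d / p x) * 1) (at x within S)"
  proof -
    have "((\<lambda>y. p y / p x) has_vector_derivative d / p x) (at x within S)"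
      using p by (auto intro!: derivative_eq_intros simp: divide_inverse)
    moreover have "(Ln has_field_derivative 1) (at (p x / p x) within (\<lambda>y. p y / p x) ` S)"
      using nz has_field_derivative_Ln[of 1] by (auto simp: has_field_derivative_at_within)
    ultimately show ?thesis
      using field_vector_diff_chain_within by (fastforce simp: comp_def)
  qed
  then have "((\<lambda>y. q x + Ln (p y / p x)) has_vector_derivative d / p x) (at x within S)"
    by (auto intro!: derivative_eq_intros)
  then show ?thesis
  proof (rule has_vector_derivative_transform_within[OF _ e(1) x])
    fix y assume y: "y \<in> S" "dist y x < e"
    have "\<bar>Im (q y - q x)\<bar> \<le> cmod (q y - q x)" by (rule abs_Im_le_cmod)
    also have "\<dots> < pi" using e(2)[OF y] pi_gt3 by (simp add: dist_norm)
    finally have "Ln (exp (q y - q x)) = q y - q x" by (intro Ln_exp) auto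
    then show "q x + Ln (p y / p x) = q y" using pq[OF x] pq[OF y(1)] by (simp add: exp_diff)
  qed
qed

text \<open>
  The winding number is the increment of a continuous logarithm \<open>q\<close> of \<open>g - z\<close>. Since
  \<open>Ln (1 + w)\<close> is at most \<open>2 w\<close> in modulus for small \<open>w\<close>, the logarithm is again locally Lipschitz,
  and the fundamental theorem recovers its increment from its derivative.
\<close>

theorem winding_number_lipschitz_path:
  assumes g: "C-lipschitz_on {0..1} g" and z: "z \<notin> path_image g"
    and N: "negligible N"
    and D: "\<And>t. t \<in> {0..1} - N \<Longrightarrow> (g has_vector_derivative D t) (at t within {0..1})"
  shows "((\<lambda>t. D t / (g t - z)) has_integral 2 * pi * \<i> * winding_number g z) {0..1}"
proof -
  have pg: "path g" using g by (simp add: path_def lipschitz_on_continuous_on)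
  obtain q where q: "path q" "pathfinish q - pathstart q = 2 * of_real pi * \<i> * winding_number g z"
    "\<And>t. t \<in> {0..1} \<Longrightarrow> g t = z + exp (q t)"
    using winding_number_as_continuous_log[OF pg z] by blast
  have cq: "continuous_on {0..1} q" using q(1) by (simp add: path_def)
  have C0: "0 \<le> C" using g by (rule lipschitz_on_nonneg)
  obtain m where m: "0 < m" "\<And>t. t \<in> {0..1} \<Longrightarrow> m \<le> cmod (g t - z)"
  proof -
    have "closed (path_image g)" "path_image g \<noteq> {}" using pg by (auto simp: closed_path_image)
    then have "0 < infdist z (path_image g)" using z infdist_pos_not_in_closed by blast
    moreover have "infdist z (path_image g) \<le> cmod (g t - z)" if "t \<in> {0..1}" for t
      using infdist_le[of "g t" "path_image g" z] that by (auto simp: path_image_def dist_norm norm_minus_commute)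
    ultimately show ?thesis by (rule that)
  qed
  obtain d where d: "0 < d" "\<And>x y. x \<in> {0..1} \<Longrightarrow> y \<in> {0..1} \<Longrightarrow> dist x y < d \<Longrightarrow> dist (q x) (q y) < 1"
    using compact_uniformly_continuous[OF cq] unfolding uniformly_continuous_on_def
    by (meson compact_Icc dist_commute zero_less_one)
  \<comment> \<open>Makes the relative increment \<open>w\<close> below smaller than \<open>1 / 2\<close>.\<close>
  define e where "e = min d (m / (2 * C + 1))"
  have e: "0 < e" "e \<le> d" "e \<le> m / (2 * C + 1)" using d(1) m(1) C0 by (auto simp: e_def)
  have "((\<lambda>t. D t / (g t - z)) has_integral q 1 - q 0) {0..1}"
  proof (rule FTC_locally_Lipschitz[OF cq \<open>0 < e\<close> _ _ N])
    show "0 \<le> 2 * C / m" using C0 m(1) by simp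
    show "cmod (q x - q y) \<le> 2 * C / m * \<bar>x - y\<bar>" if xy: "x \<in> {0..1}" "y \<in> {0..1}" "\<bar>x - y\<bar> < e" for x y
    proof -
      define w where "w = (g x - g y) / (g y - z)"
      have gy: "g y - z \<noteq> 0" "g y - z = exp (q y)" "g x - z = exp (q x)" using q(3) xy by auto
      have "cmod w \<le> C * \<bar>x - y\<bar> / m"
        unfolding w_def norm_divide
        using lipschitz_on_normD[OF g xy(1,2)] m(2)[OF xy(2)] m(1) C0
        by (intro frac_le) auto
      moreover have "C * \<bar>x - y\<bar> / m < 1 / 2"
      proof -
        have "\<bar>x - y\<bar> * (2 * C + 1) < m" using xy(3) e(3) C0 by (simp add: pos_le_divide_eq mult_right_mono le_less_trans less_le_trans pos_less_divide_eq[symmetric])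
        then have "C * \<bar>x - y\<bar> * 2 < m" by (simp add: algebra_simps) 
        then show ?thesis using m(1) by (simp add: field_simps)
      qed
      ultimately have w: "cmod w < 1 / 2" "cmod w \<le> C * \<bar>x - y\<bar> / m" by linarith+
      have "1 + w = exp (q x - q y)"
        unfolding w_def exp_diff gy(2,3)[symmetric] using gy(1) by (simp add: field_simps)
      moreover have "Ln (exp (q x - q y)) = q x - q y"
      proof -
        have "\<bar>Im (q x - q y)\<bar> \<le> cmod (q x - q y)" by (rule abs_Im_le_cmod)
        also have "\<dots> < pi" using d(2)[OF xy(1,2)] xy(3) e(2) pi_gt3 by (simp add: dist_norm)
        finally show ?thesis by (intro Ln_exp) auto
      qed
      ultimately have "cmod (q x - q y) \<le> 2 * cmod w"
        using norm_Ln_le[OF w(1)] by simp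
      then show ?thesis using w(2) by simp
    qed
    show "(q has_vector_derivative D t / (g t - z)) (at t within {0..1})" if t: "t \<in> {0..1} - N" for t
      using has_vector_derivative_continuous_log[of "\<lambda>t. g t - z" "D t" t "{0..1}" q]
        has_vector_derivative_diff_const[THEN iffD2, OF D[OF t], of z] t q(3) cq
      by (auto simp: continuous_on_eq_continuous_within)
  qed
  then show ?thesis using q(2) by (simp add: pathfinish_def pathstart_def)
qed

text \<open>
  In the logarithmic variable \<open>u\<close> with \<open>t = exp u\<close> the integrand has a global primitive \<open>P\<close>, so the
  integral depends only on the end values of the logarithm. Since \<open>P \<circ> l\<close> is continuous and has the
  right derivative off a finite set, this is a gauge integral even where \<open>p'\<close> is not absolutely
  integrable.
\<close>

lemma has_integral_holomorphic_primitive_in_log: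
  fixes p l :: "real \<Rightarrow> complex"
  assumes P: "\<And>u. (P has_field_derivative G (exp u) * exp u) (at u)"
    and "a \<le> b" "finite S" and l: "continuous_on {a..b} l"
    and pl: "\<And>s. s \<in> {a..b} \<Longrightarrow> p s = exp (l s)"
    and p: "\<And>s. s \<in> {a<..<b} - S \<Longrightarrow> (p has_vector_derivative p' s) (at s)"
  shows "((\<lambda>s. G (p s) * p' s) has_integral P (l b) - P (l a)) {a..b}"
proof -
  have "((\<lambda>s. G (p s) * p' s) has_integral (P \<circ> l) b - (P \<circ> l) a) {a..b}"
  proof (rule fundamental_theorem_of_calculus_interior_strong[OF \<open>finite S\<close> \<open>a \<le> b\<close>])
    have "continuous_on UNIV P"
      by (rule DERIV_continuous_on[OF P])
    then show "continuous_on {a..b} (P \<circ> l)"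
      by (intro continuous_on_compose l) (auto intro: continuous_on_subset)
    fix s assume s: "s \<in> {a<..<b} - S"
    have ls: "(l has_vector_derivative p' s / p s) (at s within {a<..<b})"
    proof (rule has_vector_derivative_continuous_log)
      show "(p has_vector_derivative p' s) (at s within {a<..<b})"
        using p[OF s] by (rule has_vector_derivative_at_within)
      show "continuous (at s within {a<..<b}) l"
      proof -
        have "continuous_on {a<..<b} l" by (rule continuous_on_subset[OF l]) auto
        then show ?thesis using s unfolding continuous_on_eq_continuous_within by blast
      qed
    qed (use pl s in auto)
    then have ls: "(l has_vector_derivative p' s / p s) (at s)"
      using s at_within_open[of s "{a<..<b}"] by auto
    have "((P \<circ> l) has_vector_derivative (p' s / p s) * (G (exp (l s)) * exp (l s))) (at s)"
      using field_vector_diff_chain_at[OF ls P] .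
    moreover have "(p' s / p s) * (G (exp (l s)) * exp (l s)) = G (p s) * p' s"
      using pl[of s] s by simp
    ultimately show "((P \<circ> l) has_vector_derivative G (p s) * p' s) (at s)" by simp
  qed
  then show ?thesis by simp
qed

section \<open>The model contour\<close>

text \<open>
  The model contour has the same two rays as the contours in question, and in between its argument
  is linear in the parameter. The parameter is the modulus everywhere, and the velocity is bounded.
\<close>

locale model_contour =
  fixes \<sigma> :: complex and a b :: real
  assumes ab: "0 < a" "a < b" and Arg_sigma: "0 < Arg \<sigma>"
begin

definition ang :: "real \<Rightarrow> real" where
  "ang s = Arg \<sigma> * min 1 (max 0 ((b - s) / (b - a)))"

definition pt :: "real \<Rightarrow> complex" where
  "pt s = of_real s * cis (ang s)"

definition vel :: "real \<Rightarrow> complex" where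
  "vel s = cis (ang s) * (1 - \<i> * of_real (if a < s \<and> s < b then s * (Arg \<sigma> / (b - a)) else 0))"

lemma sigma_nz: "\<sigma> \<noteq> 0"
  using Arg_sigma by (auto simp: Arg_zero)

lemma ang_initial: "s \<le> a \<Longrightarrow> ang s = Arg \<sigma>" and ang_final: "b \<le> s \<Longrightarrow> ang s = 0"
  using ab by (auto simp: ang_def min_def max_def divide_simps)

lemma ang_middle: "a \<le> s \<Longrightarrow> s \<le> b \<Longrightarrow> ang s = Arg \<sigma> * ((b - s) / (b - a))"
  using ab by (auto simp: ang_def min_def max_def divide_simps)

lemma pt_nz: "0 < s \<Longrightarrow> pt s \<noteq> 0"
  by (simp add: pt_def)

lemma norm_pt: "0 < s \<Longrightarrow> cmod (pt s) = s"
  by (simp add: pt_def norm_mult)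

lemma continuous_ang: "continuous_on S ang"
  unfolding ang_def using ab by (intro continuous_intros) auto

lemma continuous_pt: "continuous_on S pt"
  unfolding pt_def by (intro continuous_intros continuous_ang continuous_on_cis)

lemma pt_has_vector_derivative:
  assumes "s \<noteq> a" "s \<noteq> b"
  shows "(pt has_vector_derivative vel s) (at s)"
proof -
  define k where "k = (if a < s \<and> s < b then - Arg \<sigma> / (b - a) else 0)"
  have "(ang has_real_derivative k) (at s)"
  proof -
    consider "s < a" | "a < s" "s < b" | "b < s" using assms by linarith
    then show ?thesis
    proof cases
      case 1
      show ?thesis
        by (rule has_field_derivative_transform_within_open[of "\<lambda>s. Arg \<sigma>" _ _ "{..<a}"])
          (use 1 ab in \<open>auto simp: k_def ang_initial\<close>)
    next
      case 2
      show ?thesis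
      proof (rule has_field_derivative_transform_within_open[of "\<lambda>s. Arg \<sigma> * ((b - s) / (b - a))" _ _ "{a<..<b}"])
        show "((\<lambda>s. Arg \<sigma> * ((b - s) / (b - a))) has_real_derivative k) (at s)"
          using 2 ab by (auto intro!: derivative_eq_intros simp: k_def divide_simps)
      qed (use 2 in \<open>auto simp: ang_middle\<close>)
    next
      case 3
      show ?thesis
        by (rule has_field_derivative_transform_within_open[of "\<lambda>s. 0" _ _ "{b<..}"])
          (use 3 ab in \<open>auto simp: k_def ang_final\<close>)
    qed
  qed
  then have "((\<lambda>s. \<i> * of_real (ang s)) has_vector_derivative \<i> * of_real k) (at s)"
    by (auto intro!: derivative_eq_intros has_vector_derivative_mult_right has_vector_derivative_of_real
        simp: has_real_derivative_iff_has_vector_derivative)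
  then have "((exp \<circ> (\<lambda>s. \<i> * of_real (ang s))) has_vector_derivative (\<i> * of_real k) * exp (\<i> * of_real (ang s))) (at s)"
    by (rule field_vector_diff_chain_at) (rule DERIV_exp)
  then have 1: "((\<lambda>s. cis (ang s)) has_vector_derivative (\<i> * of_real k) * cis (ang s)) (at s)"
    by (simp add: comp_def cis_conv_exp)
  have "(pt has_vector_derivative of_real s * ((\<i> * of_real k) * cis (ang s)) + of_real 1 * cis (ang s)) (at s)"
    unfolding pt_def by (rule has_vector_derivative_mult[OF _ 1]) (rule has_vector_derivative_of_real DERIV_ident)+
  moreover have "of_real s * ((\<i> * of_real k) * cis (ang s)) + of_real 1 * cis (ang s) = vel s"
    by (auto simp: vel_def k_def algebra_simps)
  ultimately show ?thesis by simp
qed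

end

text \<open>
  The components of the predicate \<^const>\<open>helmholtz_contour\<close>, with its witnesses named.
\<close>

locale helmholtz_path = model_contour +
  fixes L :: "real \<Rightarrow> complex" and \<theta> :: "real \<Rightarrow> real"
  assumes L: "L piecewise_C1_differentiable_on {a..b}"
    and init: "\<And>s. s \<in> {0<..a} \<Longrightarrow> L s = of_real s * cis (Arg \<sigma>)"
    and final: "\<And>s. s \<in> {b..} \<Longrightarrow> L s = of_real s"
    and polar: "\<And>s. s \<in> {0<..} \<Longrightarrow> L s \<noteq> 0 \<and> L s = of_real (cmod (L s)) * cis (\<theta> s)"
    and \<theta>: "continuous_on {0<..} \<theta>" "\<theta> a = Arg \<sigma>" "\<theta> b = 0"
begin

lemma agrees_with_model_off_middle:
  assumes "0 < s" "s \<notin> {a..b}"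
  shows "L s = pt s" "(L has_vector_derivative vel s) (at s)"
proof -
  have d: "(pt has_vector_derivative vel s) (at s)" using assms(2) ab by (intro pt_has_vector_derivative) auto
  consider "s < a" | "b < s" using assms(2) by force
  then have "L s = pt s \<and> (L has_vector_derivative vel s) (at s)"
  proof cases
    case 1
    have "pt y = L y" if "y \<in> {0<..<a}" for y using that init[of y] by (simp add: pt_def ang_initial)
    then show ?thesis
      using 1 assms(1) has_vector_derivative_transform_within_open[OF d, of "{0<..<a}" L] by auto
  next
    case 2
    have "pt y = L y" if "y \<in> {b<..}" for y using that final[of y] by (simp add: pt_def ang_final)
    then show ?thesis
      using 2 has_vector_derivative_transform_within_open[OF d, of "{b<..}" L] by auto
  qed
  then show "L s = pt s" "(L has_vector_derivative vel s) (at s)" by auto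
qed

lemma differentiable_off_finite:
  obtains S where "finite S" "\<And>s. s \<in> {0<..} - S \<Longrightarrow> (L has_vector_derivative vector_derivative L (at s)) (at s)"
proof -
  obtain S where S: "finite S" "L C1_differentiable_on {a..b} - S"
    using L unfolding piecewise_C1_differentiable_on_def by blast
  show ?thesis
  proof
    show "finite S" by fact
    fix s assume s: "s \<in> {0<..} - S"
    show "(L has_vector_derivative vector_derivative L (at s)) (at s)"
    proof (cases "s \<in> {a..b}")
      case True
      then have "L differentiable (at s)" using S(2) s unfolding C1_differentiable_on_eq by blast
      then show ?thesis by (simp add: vector_derivative_works)
    next
      case False
      then show ?thesis using agrees_with_model_off_middle(2)[of s] s by (auto simp: vector_derivative_at)
    qed
  qed
qed

text \<open>
  On the rays the two integrands agree. In between both integrals are increments of the same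
  function \<open>P\<close> between the same logarithms, \<open>ln a + i Arg \<sigma>\<close> and \<open>ln b\<close>: this is where the
  continuous branch of the argument along the contour enters.
\<close>

lemma has_integral_helmholtz_path:
  assumes G: "G holomorphic_on - {0}"
    and J: "((\<lambda>s. G (pt s) * vel s) has_integral J) {0<..}"
  shows "((\<lambda>s. G (L s) * vector_derivative L (at s)) has_integral J) {0<..}"
proof -
  have "(\<lambda>u. G (exp u) * exp u) holomorphic_on UNIV"
    by (intro holomorphic_intros holomorphic_on_compose_gen[OF _ G, unfolded comp_def]) auto
  then obtain P where P: "\<And>u. (P has_field_derivative G (exp u) * exp u) (at u)"
    using holomorphic_convex_primitive'[of UNIV "\<lambda>u. G (exp u) * exp u"] by auto
  obtain S where S: "finite S" "\<And>s. s \<in> {0<..} - S \<Longrightarrow> (L has_vector_derivative vector_derivative L (at s)) (at s)"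
    by (rule differentiable_off_finite) blast
  have cL: "continuous_on {a..b} L" using L by (simp add: piecewise_C1_differentiable_on_def)
  have dL: "(L has_vector_derivative vector_derivative L (at s)) (at s)" if "s \<in> {a<..<b} - S" for s
    using S(2)[of s] that ab by auto
  define l where "l s = of_real (ln (cmod (L s))) + \<i> * of_real (\<theta> s)" for s
  have nzL: "L s \<noteq> 0" if "s \<in> {a..b}" for s using polar[of s] that ab by auto
  have iL: "((\<lambda>s. G (L s) * vector_derivative L (at s)) has_integral P (l b) - P (l a)) {a..b}"
  proof (rule has_integral_holomorphic_primitive_in_log[OF P _ S(1)])
    show "continuous_on {a..b} l"
      unfolding l_def using nzL ab
      by (intro continuous_intros cL continuous_on_subset[OF \<theta>(1)]) auto
    show "L s = exp (l s)" if "s \<in> {a..b}" for s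
      using nzL[OF that] polar[of s] that ab
      by (simp add: l_def exp_add cis_conv_exp exp_of_real)
  qed (use ab dL in auto)
  have ll: "l a = of_real (ln a) + \<i> * of_real (ang a)" "l b = of_real (ln b) + \<i> * of_real (ang b)"
    using ab init[of a] final[of b] \<theta> by (auto simp: l_def ang_initial ang_final norm_mult)
  have "((\<lambda>s. G (pt s) * vel s) has_integral
      P (of_real (ln b) + \<i> * of_real (ang b)) - P (of_real (ln a) + \<i> * of_real (ang a))) {a..b}"
  proof (rule has_integral_holomorphic_primitive_in_log[OF P, where l="\<lambda>s. of_real (ln s) + \<i> * of_real (ang s)" and S="{}"])
    show "continuous_on {a..b} (\<lambda>s. of_real (ln s) + \<i> * of_real (ang s))"
      using ab by (intro continuous_intros continuous_ang) auto
    show "pt s = exp (of_real (ln s) + \<i> * of_real (ang s))" if "s \<in> {a..b}" for s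
      using that ab by (simp add: pt_def exp_add cis_conv_exp exp_of_real)
  qed (use ab pt_has_vector_derivative in auto)
  from has_integral_diff[OF iL this]
  have "((\<lambda>s. G (L s) * vector_derivative L (at s) - G (pt s) * vel s) has_integral 0) {a..b}"
    by (simp add: ll)
  then have "((\<lambda>s. if s \<in> {a..b} then G (L s) * vector_derivative L (at s) - G (pt s) * vel s else 0) has_integral 0) {0<..}"
    using ab by (subst has_integral_restrict) auto
  from has_integral_add[OF this J]
  have "((\<lambda>s. (if s \<in> {a..b} then G (L s) * vector_derivative L (at s) - G (pt s) * vel s else 0) + G (pt s) * vel s) has_integral J) {0<..}"
    by simp
  then show ?thesis
  proof (rule has_integral_spike[where S="{a, b}", rotated 2])
    fix s assume s: "s \<in> {0<..} - {a, b}"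
    show "G (L s) * vector_derivative L (at s) = (if s \<in> {a..b} then G (L s) * vector_derivative L (at s) - G (pt s) * vel s else 0) + G (pt s) * vel s"
    proof (cases "s \<in> {a..b}")
      case False
      then show ?thesis using agrees_with_model_off_middle[of s] s by (auto simp: vector_derivative_at)
    qed auto
  qed auto
qed

theorem has_integral_rotated_helmholtz_path:
  assumes G: "G holomorphic_on - {0}" and c: "c \<noteq> 0"
    and J: "((\<lambda>s. G (c * pt s) * (c * vel s)) has_integral J) {0<..}"
  shows "((\<lambda>s. G (c * L s) * vector_derivative (\<lambda>s. c * L s) (at s)) has_integral J) {0<..}"
proof -
  obtain S where S: "finite S" "\<And>s. s \<in> {0<..} - S \<Longrightarrow> (L has_vector_derivative vector_derivative L (at s)) (at s)"
    by (rule differentiable_off_finite) blast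
  have "(\<lambda>t. G (c * t) * c) holomorphic_on - {0}"
    using c by (intro holomorphic_intros holomorphic_on_compose_gen[OF _ G, unfolded comp_def]) auto
  moreover have "((\<lambda>s. G (c * pt s) * c * vel s) has_integral J) {0<..}" using J by (simp only: mult.assoc)
  ultimately have "((\<lambda>s. G (c * L s) * c * vector_derivative L (at s)) has_integral J) {0<..}"
    by (rule has_integral_helmholtz_path)
  then show ?thesis
  proof (rule has_integral_spike[OF negligible_finite[OF S(1)], rotated])
    fix s assume "s \<in> {0<..} - S"
    from vector_derivative_at[OF has_vector_derivative_mult_right[OF S(2)[OF this], of c]]
    show "G (c * L s) * vector_derivative (\<lambda>s. c * L s) (at s) = G (c * L s) * c * vector_derivative L (at s)"
      by simp
  qed
qed

end

section \<open>Moments of plane waves along the model contour\<close>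

lemma power_le_exp:
  fixes c y :: real
  assumes "0 \<le> y" "0 < c"
  shows "y ^ n \<le> fact n / c ^ n * exp (c * y)"
proof -
  have "(\<Sum>k\<in>{n}. (c * y) ^ k /\<^sub>R fact k) \<le> (\<Sum>k. (c * y) ^ k /\<^sub>R fact k)"
    using assms by (intro sum_le_suminf summable_exp_generic) auto
  then have "(c * y) ^ n / fact n \<le> exp (c * y)"
    by (simp add: exp_def divide_inverse mult.commute)
  then show ?thesis using assms by (simp add: field_simps power_mult_distrib)
qed

text \<open>
  The exponent decays at both ends: half of the decay at infinity is kept, the rest absorbs positive
  powers of \<open>s\<close>, and the decay at \<open>0\<close> absorbs negative ones.
\<close>

lemma bounded_exponential_moment:
  fixes c d :: real and m :: int
  assumes "0 < c" "0 < d"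
  obtains B where "0 \<le> B" "\<And>s. 0 < s \<Longrightarrow> s powi m * exp (- (c * (s + d / s))) \<le> B * exp (- (c / 2) * s)"
proof (cases "0 \<le> m")
  case True
  then obtain n where m: "m = int n" by (metis nonneg_int_cases)
  show ?thesis
  proof (rule that)
    show "0 \<le> fact n / (c / 2) ^ n" using assms by simp
    fix s :: real assume s: "0 < s"
    have "s powi m * exp (- (c * (s + d / s))) = s ^ n * exp (- (c * s)) * exp (- (c * (d / s)))"
      by (simp add: m ring_distribs flip: exp_add)
    also have "\<dots> \<le> s ^ n * exp (- (c * s)) * 1"
      using assms s by (intro mult_left_mono) auto
    also have "\<dots> \<le> fact n / (c / 2) ^ n * exp (c / 2 * s) * exp (- (c * s))"
      using mult_right_mono[OF power_le_exp[of s "c / 2" n], of "exp (- (c * s))"] assms s by (simp only: mult_1_right) auto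
    also have "\<dots> = fact n / (c / 2) ^ n * exp (- (c / 2) * s)"
      by (simp add: mult.assoc flip: exp_add)
    finally show "s powi m * exp (- (c * (s + d / s))) \<le> fact n / (c / 2) ^ n * exp (- (c / 2) * s)" .
  qed
next
  case False
  then obtain n where m: "m = - int n" by (metis int_cases2 negative_zle_0 nle_le order_trans zle_int of_nat_0_le_iff)
  show ?thesis
  proof (rule that)
    show "0 \<le> fact n / (c * d) ^ n" using assms by simp
    fix s :: real assume s: "0 < s"
    have "s powi m * exp (- (c * (s + d / s))) = (1 / s) ^ n * exp (- (c * s)) * exp (- (c * d) * (1 / s))"
    proof -
      have "s powi m = (1 / s) ^ n" by (simp add: m power_int_minus power_one_over divide_inverse power_inverse)
      moreover have "exp (- (c * (s + d / s))) = exp (- (c * s)) * exp (- (c * d) * (1 / s))"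
        by (simp add: ring_distribs flip: exp_add)
      ultimately show ?thesis by simp
    qed
    also have "\<dots> \<le> (fact n / (c * d) ^ n * exp ((c * d) * (1 / s))) * exp (- (c * s)) * exp (- (c * d) * (1 / s))"
      using power_le_exp[of "1 / s" "c * d" n] assms s by (intro mult_right_mono) auto
    also have "\<dots> = fact n / (c * d) ^ n * exp (- (c * s))"
      by (simp add: exp_minus)
    also have "\<dots> \<le> fact n / (c * d) ^ n * exp (- (c / 2) * s)"
      using assms s by (intro mult_left_mono) auto
    finally show "s powi m * exp (- (c * (s + d / s))) \<le> fact n / (c * d) ^ n * exp (- (c / 2) * s)" .
  qed
qed

lemma integrable_exponential_moment:
  fixes c d :: real and m :: int
  assumes "0 < c" "0 < d"
  shows "integrable (lebesgue_on {0<..}) (\<lambda>s. s powi m * exp (- (c * (s + d / s))))"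
proof -
  obtain B where B: "0 \<le> B" "\<And>s. 0 < s \<Longrightarrow> s powi m * exp (- (c * (s + d / s))) \<le> B * exp (- (c / 2) * s)"
    by (rule bounded_exponential_moment[OF assms]) blast
  have "(\<lambda>s. exp (- (c / 2) * s)) absolutely_integrable_on {0..}"
    using assms integrable_on_exp_minus_to_infinity[of "c / 2" 0]
    by (intro nonnegative_absolutely_integrable_1) auto
  then have "(\<lambda>s. exp (- (c / 2) * s)) absolutely_integrable_on {0<..}"
    by (rule set_integrable_subset) auto
  then have "integrable (lebesgue_on {0<..}) (\<lambda>s. exp (- (c / 2) * s))"
    by (rule absolutely_integrable_imp_integrable) auto
  then have "integrable (lebesgue_on {0<..}) (\<lambda>s. B * exp (- (c / 2) * s))"
    by (rule integrable_mult_right)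
  then show ?thesis
  proof (rule Bochner_Integration.integrable_bound)
    show "(\<lambda>s. s powi m * exp (- (c * (s + d / s)))) \<in> borel_measurable (lebesgue_on {0<..})"
      by (intro continuous_imp_measurable_on_sets_lebesgue continuous_intros) auto
    show "AE s in lebesgue_on {0<..}. norm (s powi m * exp (- (c * (s + d / s)))) \<le> norm (B * exp (- (c / 2) * s))"
      using B by (intro AE_I2) (auto simp: abs_mult power_int_abs)
  qed
qed

context model_contour
begin

text \<open>
  The plane wave \<open>E(t, w)\<close>, as a function of the point \<open>t\<close> of the contour.
\<close>

definition kern :: "complex \<Rightarrow> complex \<Rightarrow> complex" where
  "kern w t = exp (\<i> * t * w - \<i> * \<sigma> * cnj w / t)"

text \<open>
  The moment of order \<open>0\<close> is the integral of the plane wave against \<open>dt / t\<close>, hence up to a factor the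
  fundamental solution on the half-plane \<open>Im w > 0\<close>; the moment of order \<open>- 1\<close> is up to a factor its
  derivative with respect to \<open>cnj w\<close>. Differentiation shifts the order by one in either direction, so
  all integer orders occur.
\<close>

definition moment_integrand :: "int \<Rightarrow> complex \<Rightarrow> real \<Rightarrow> complex" where
  "moment_integrand k w s = pt s powi (k - 1) * kern w (pt s) * vel s"

definition moment :: "int \<Rightarrow> complex \<Rightarrow> complex" where
  "moment k w = (\<integral>s. moment_integrand k w s \<partial>lebesgue_on {0<..})"

definition \<kappa> :: real where "\<kappa> = 2 * (b + cmod \<sigma> / a)"

definition vmax :: real where "vmax = 1 + b * (Arg \<sigma> / (b - a))"

lemma vmax_ge_1: "1 \<le> vmax"
  using ab Arg_sigma by (simp add: vmax_def)

lemma norm_vel_le: "cmod (vel s) \<le> vmax"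
proof -
  have "cmod (vel s) \<le> 1 + \<bar>if a < s \<and> s < b then s * (Arg \<sigma> / (b - a)) else 0\<bar>"
    unfolding vel_def norm_mult norm_cis mult_1_left
    by (rule order_trans[OF norm_triangle_ineq4]) (simp add: norm_mult)
  also have "\<dots> \<le> vmax"
    using ab Arg_sigma by (auto simp: vmax_def abs_mult intro!: divide_right_mono mult_right_mono)
  finally show ?thesis .
qed

text \<open>
  The exponent has two terms. On the final ray the real part of the first is exactly \<open>- Im w s\<close>; on
  the initial ray \<open>\<sigma> / t\<close> is a positive number, so the real part of the second is exactly
  \<open>- Im w \<bar>\<sigma>\<bar> / s\<close>. Elsewhere \<open>s\<close> is at most \<open>b\<close>, respectively at least \<open>a\<close>, and estimating both the term
  and its ideal value by their moduli costs no more than \<open>\<kappa> \<bar>w\<bar>\<close>.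
\<close>

lemma norm_kern_le:
  assumes s: "0 < s"
  shows "cmod (kern w (pt s)) \<le> exp (\<kappa> * cmod w) * exp (- (Im w * (s + cmod \<sigma> / s)))"
proof -
  have 1: "- Im (pt s * w) \<le> 2 * b * cmod w - Im w * s"
  proof (cases "b \<le> s")
    case True
    then show ?thesis using ab by (simp add: pt_def ang_final)
  next
    case False
    have "- Im (pt s * w) \<le> s * cmod w" using abs_Im_le_cmod[of "pt s * w"] s by (simp add: norm_mult norm_pt)
    moreover have "Im w * s \<le> cmod w * s" using abs_Im_le_cmod[of w] s by (intro mult_right_mono) auto
    moreover have "s * cmod w \<le> b * cmod w" using False by (intro mult_right_mono) auto
    ultimately show ?thesis using mult.commute[of "cmod w" s] mult.assoc[of 2 b "cmod w"] by linarith
  qed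
  have 2: "Im (\<sigma> * cnj w / pt s) \<le> 2 * (cmod \<sigma> / a) * cmod w - Im w * (cmod \<sigma> / s)"
  proof (cases "s \<le> a")
    case True
    have "\<sigma> = of_real (cmod \<sigma>) * cis (Arg \<sigma>)"
      by (metis rcis_cmod_Arg rcis_def)
    then have "\<sigma> / pt s = of_real (cmod \<sigma> / s)"
      using True by (simp add: pt_def ang_initial) (metis cis_neq_zero nonzero_mult_divide_mult_cancel_right)
    then have "\<sigma> * cnj w / pt s = of_real (cmod \<sigma> / s) * cnj w"
      by (metis times_divide_eq_left)
    then have "Im (\<sigma> * cnj w / pt s) = - Im w * (cmod \<sigma> / s)"
      by simp
    then show ?thesis using ab by simp
  next
    case False
    have "Im (\<sigma> * cnj w / pt s) \<le> cmod \<sigma> / s * cmod w"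
      using abs_Im_le_cmod[of "\<sigma> * cnj w / pt s"] s by (simp add: norm_mult norm_divide norm_pt)
    moreover have "Im w * (cmod \<sigma> / s) \<le> cmod w * (cmod \<sigma> / s)"
      using abs_Im_le_cmod[of w] s by (intro mult_right_mono) auto
    moreover have "cmod \<sigma> / s * cmod w \<le> cmod \<sigma> / a * cmod w"
      using False ab by (intro mult_right_mono divide_left_mono) auto
    ultimately show ?thesis
      using mult.commute[of "cmod w" "cmod \<sigma> / s"] mult.assoc[of 2 "cmod \<sigma> / a" "cmod w"] by linarith
  qed
  have "Re (\<i> * pt s * w - \<i> * \<sigma> * cnj w / pt s) = - Im (pt s * w) + Im (\<sigma> * cnj w / pt s)"
    by (metis (no_types, lifting) Re_i_times diff_conv_add_uminus minus_complex.simps(1) minus_minus mult.assoc times_divide_eq_right)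
  also have "\<dots> \<le> \<kappa> * cmod w - Im w * (s + cmod \<sigma> / s)"
    using 1 2 by (simp add: \<kappa>_def algebra_simps)
  finally show ?thesis
    unfolding kern_def norm_exp_eq_Re exp_add[symmetric] by simp
qed

lemma norm_moment_integrand_le:
  assumes s: "0 < s"
  shows "cmod (moment_integrand k w s)
    \<le> vmax * exp (\<kappa> * cmod w) * (s powi (k - 1) * exp (- (Im w * (s + cmod \<sigma> / s))))"
proof -
  have "cmod (moment_integrand k w s) = s powi (k - 1) * cmod (kern w (pt s)) * cmod (vel s)"
    using s by (simp add: moment_integrand_def norm_mult norm_power_int norm_pt)
  also have "\<dots> \<le> s powi (k - 1) * (exp (\<kappa> * cmod w) * exp (- (Im w * (s + cmod \<sigma> / s)))) * vmax"
    using s norm_kern_le[OF s, of w] norm_vel_le[of s] by (intro mult_mono) auto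
  finally show ?thesis by (simp add: mult_ac)
qed

lemma continuous_kern_pt: "continuous_on {0<..} (\<lambda>s. kern w (pt s))"
  unfolding kern_def by (intro continuous_intros continuous_pt) (auto simp: pt_nz)

lemma measurable_pt [measurable]: "pt \<in> borel_measurable (lebesgue_on {0<..})"
  by (intro continuous_imp_measurable_on_sets_lebesgue continuous_pt) auto

lemma measurable_vel [measurable]: "vel \<in> borel_measurable (lebesgue_on {0<..})"
proof -
  have [measurable]: "(\<lambda>s. cis (ang s)) \<in> borel_measurable (lebesgue_on {0<..})"
    by (intro continuous_imp_measurable_on_sets_lebesgue continuous_on_cis continuous_ang) auto
  have [measurable]: "(\<lambda>s::real. s) \<in> borel_measurable (lebesgue_on {0<..})"
    by (intro continuous_imp_measurable_on_sets_lebesgue continuous_intros) auto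
  show ?thesis unfolding vel_def by measurable
qed

lemma measurable_moment_integrand [measurable]:
  "moment_integrand k w \<in> borel_measurable (lebesgue_on {0<..})"
proof -
  have [measurable]: "(\<lambda>s. pt s powi (k - 1) * kern w (pt s)) \<in> borel_measurable (lebesgue_on {0<..})"
    by (intro continuous_imp_measurable_on_sets_lebesgue continuous_intros continuous_pt continuous_kern_pt) (auto simp: pt_nz)
  show ?thesis unfolding moment_integrand_def by measurable
qed

lemma integrable_moment_integrand:
  assumes "0 < Im w"
  shows "integrable (lebesgue_on {0<..}) (moment_integrand k w)"
proof (rule Bochner_Integration.integrable_bound)
  show "integrable (lebesgue_on {0<..}) (\<lambda>s. vmax * exp (\<kappa> * cmod w) * (s powi (k - 1) * exp (- (Im w * (s + cmod \<sigma> / s)))))"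
    using assms sigma_nz by (intro integrable_mult_right integrable_exponential_moment) auto
  show "AE s in lebesgue_on {0<..}. cmod (moment_integrand k w s)
      \<le> norm (vmax * exp (\<kappa> * cmod w) * (s powi (k - 1) * exp (- (Im w * (s + cmod \<sigma> / s)))))"
    using norm_moment_integrand_le by (intro AE_I2) (auto intro: order_trans[OF _ abs_ge_self])
qed measurable

lemma powi_succ_pred:
  "0 < s \<Longrightarrow> pt s powi k = pt s * pt s powi (k - 1)" "0 < s \<Longrightarrow> pt s powi (k - 2) = pt s powi (k - 1) / pt s"
  using power_int_add_1'[of "pt s" "k - 1"] power_int_add_1'[of "pt s" "k - 2"] pt_nz[of s] by auto

text \<open>
  Differentiating the plane wave in the direction \<open>h\<close> multiplies it by
  \<open>i t h - i \<sigma> cnj h / t\<close>. On the disc of radius \<open>Im w / 2\<close> around \<open>w\<close> the imaginary part stays at least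
  \<open>Im w / 2\<close>, which gives an integrable majorant.
\<close>

theorem has_derivative_moment:
  assumes w: "0 < Im w"
  shows "(moment k has_derivative (\<lambda>h. \<i> * h * moment (k + 1) w - \<i> * \<sigma> * cnj h * moment (k - 1) w)) (at w)"
proof -
  define c where "c = Im w / 2"
  have c: "0 < c" using w by (simp add: c_def)
  define F' where "F' x s h = \<i> * h * moment_integrand (k + 1) x s - \<i> * \<sigma> * cnj h * moment_integrand (k - 1) x s" for x and s :: real and h
  define K where "K = vmax * exp (\<kappa> * (cmod w + c))"
  define B where "B s = K * (s powi k * exp (- (c * (s + cmod \<sigma> / s))))
     + cmod \<sigma> * (K * (s powi (k - 2) * exp (- (c * (s + cmod \<sigma> / s)))))" for s :: real
  have near: "c \<le> Im x" "cmod x \<le> cmod w + c" if "x \<in> ball w c" for x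
    using that abs_Im_le_cmod[of "x - w"] norm_triangle_sub[of x w]
    by (auto simp: dist_norm norm_minus_commute c_def)
  have "((\<lambda>x. \<integral>s. moment_integrand k x s \<partial>lebesgue_on {0<..}) has_derivative (\<lambda>h. \<integral>s. F' w s h \<partial>lebesgue_on {0<..})) (at w)"
  proof (rule has_derivative_lebesgue_integral[where S="ball w c" and B=B])
    show "w \<in> ball w c" using c by simp
    show "integrable (lebesgue_on {0<..}) (moment_integrand k x)" if "x \<in> ball w c" for x
      using near[OF that] c by (intro integrable_moment_integrand) auto
    show "integrable (lebesgue_on {0<..}) B"
      unfolding B_def using c sigma_nz
      by (intro Bochner_Integration.integrable_add integrable_mult_right integrable_exponential_moment) auto
    show "(\<lambda>s. F' w s h) \<in> borel_measurable (lebesgue_on {0<..})" for h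
      unfolding F'_def by measurable
    fix x and s :: real assume x: "x \<in> ball w c" and "s \<in> space (lebesgue_on {0<..})"
    then have s: "0 < s" by simp
    have "((\<lambda>x. kern x (pt s)) has_derivative (\<lambda>h. kern x (pt s) * (\<i> * pt s * h - \<i> * \<sigma> * cnj h / pt s))) (at x)"
    proof -
      have "((\<lambda>x. \<i> * pt s * x - \<i> * \<sigma> * cnj x / pt s) has_derivative (\<lambda>h. \<i> * pt s * h - \<i> * \<sigma> * cnj h / pt s)) (at x)"
        unfolding divide_inverse by (auto intro!: derivative_eq_intros)
      from has_derivative_compose[OF this DERIV_exp[unfolded has_field_derivative_def]] show ?thesis
        unfolding kern_def .
    qed
    from has_derivative_mult_right[OF has_derivative_mult_left[OF this, of "vel s"], of "pt s powi (k - 1)"]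
    have "((\<lambda>x. moment_integrand k x s) has_derivative
        (\<lambda>h. pt s powi (k - 1) * (kern x (pt s) * (\<i> * pt s * h - \<i> * \<sigma> * cnj h / pt s) * vel s))) (at x)"
      unfolding moment_integrand_def by (simp only: mult.assoc)
    moreover have "(\<lambda>h. pt s powi (k - 1) * (kern x (pt s) * (\<i> * pt s * h - \<i> * \<sigma> * cnj h / pt s) * vel s)) = F' x s"
      unfolding F'_def moment_integrand_def
      by (simp add: powi_succ_pred(1)[OF s, of k] powi_succ_pred(2)[OF s, of k] fun_eq_iff algebra_simps)
    ultimately show "((\<lambda>x. moment_integrand k x s) has_derivative F' x s) (at x)" by simp
    fix h
    have bnd: "cmod (moment_integrand j x s) \<le> K * (s powi (j - 1) * exp (- (c * (s + cmod \<sigma> / s))))" for j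
    proof -
      have "exp (- (Im x * (s + cmod \<sigma> / s))) \<le> exp (- (c * (s + cmod \<sigma> / s)))"
        using near(1)[OF x] s by (auto intro!: mult_right_mono add_nonneg_nonneg)
      moreover have "vmax * exp (\<kappa> * cmod x) \<le> K"
        unfolding K_def using near(2)[OF x] vmax_ge_1 ab
        by (intro mult_left_mono) (auto simp: \<kappa>_def intro!: mult_left_mono)
      ultimately show ?thesis
        using s vmax_ge_1
        by (intro order_trans[OF norm_moment_integrand_le[OF s]] mult_mono) (auto simp: K_def)
    qed
    have "cmod (F' x s h) \<le> cmod h * cmod (moment_integrand (k + 1) x s) + cmod \<sigma> * cmod h * cmod (moment_integrand (k - 1) x s)"
      unfolding F'_def by (rule order_trans[OF norm_triangle_ineq4]) (simp add: norm_mult)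
    also have "\<dots> \<le> cmod h * (K * (s powi k * exp (- (c * (s + cmod \<sigma> / s))))) + cmod \<sigma> * cmod h * (K * (s powi (k - 2) * exp (- (c * (s + cmod \<sigma> / s)))))"
      using bnd[of "k + 1"] bnd[of "k - 1"] by (intro add_mono mult_left_mono) auto
    also have "\<dots> = B s * cmod h" by (simp add: B_def algebra_simps)
    finally show "cmod (F' x s h) \<le> B s * cmod h" .
  qed auto
  moreover have "(\<integral>s. F' w s h \<partial>lebesgue_on {0<..}) = \<i> * h * moment (k + 1) w - \<i> * \<sigma> * cnj h * moment (k - 1) w" for h
    unfolding F'_def moment_def by (simp add: integrable_moment_integrand[OF w])
  ultimately show ?thesis unfolding moment_def[abs_def] by simp
qed

lemma integral_lebesgue_on_indicator:
  fixes f :: "real \<Rightarrow> complex"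
  assumes "I \<subseteq> S" "I \<in> sets lebesgue" "S \<in> sets lebesgue"
  shows "(\<integral>s. indicator I s *\<^sub>R f s \<partial>lebesgue_on S) = (\<integral>s. f s \<partial>lebesgue_on I)"
proof -
  have "indicator S s *\<^sub>R (indicator I s *\<^sub>R f s) = indicator I s *\<^sub>R f s" for s
    using assms(1) by (auto simp: indicator_def)
  then have eq: "(\<lambda>s. indicator S s *\<^sub>R (indicator I s *\<^sub>R f s)) = (\<lambda>s. indicator I s *\<^sub>R f s)" by (rule ext)
  have "(\<integral>s. indicator I s *\<^sub>R f s \<partial>lebesgue_on S) = (\<integral>s. indicator S s *\<^sub>R (indicator I s *\<^sub>R f s) \<partial>lebesgue)"
    by (rule integral_restrict_space) (use assms in auto)
  also have "\<dots> = (\<integral>s. indicator I s *\<^sub>R f s \<partial>lebesgue)" by (simp only: eq)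
  also have "\<dots> = (\<integral>s. f s \<partial>lebesgue_on I)"
    by (rule integral_restrict_space[symmetric]) (use assms in auto)
  finally show ?thesis .
qed

text \<open>
  The left-hand side is the integral of the derivative of \<open>t\<^sup>k E(t, w)\<close>, a function that tends to
  \<open>0\<close> at both ends of the contour.
\<close>

theorem moment_recurrence:
  assumes w: "0 < Im w"
  shows "of_int k * moment k w + \<i> * w * moment (k + 1) w + \<i> * \<sigma> * cnj w * moment (k - 1) w = 0"
proof -
  let ?M = "lebesgue_on {0::real<..}"
  define Q where "Q s = pt s powi k * kern w (pt s)" for s
  define Q' where "Q' s = of_int k * moment_integrand k w s + \<i> * w * moment_integrand (k + 1) w s
     + \<i> * \<sigma> * cnj w * moment_integrand (k - 1) w s" for s
  have intQ': "integrable ?M Q'"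
    unfolding Q'_def by (intro Bochner_Integration.integrable_add integrable_mult_right integrable_moment_integrand w)
  have dQ: "(Q has_vector_derivative Q' s) (at s)" if s: "0 < s" "s \<noteq> a" "s \<noteq> b" for s
  proof -
    have "((\<lambda>t. t powi k * kern w t) has_field_derivative
       of_int k * pt s powi (k - 1) * kern w (pt s) + pt s powi k * (kern w (pt s) * (\<i> * w + \<i> * \<sigma> * cnj w / (pt s)\<^sup>2))) (at (pt s))"
      unfolding kern_def using pt_nz[OF s(1)]
      by (auto intro!: derivative_eq_intros simp: field_simps power2_eq_square)
    from field_vector_diff_chain_at[OF pt_has_vector_derivative[OF s(2,3)] this]
    have "(Q has_vector_derivative vel s * (of_int k * pt s powi (k - 1) * kern w (pt s) + pt s powi k * (kern w (pt s) * (\<i> * w + \<i> * \<sigma> * cnj w / (pt s)\<^sup>2)))) (at s)"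
      by (simp add: Q_def[abs_def] comp_def)
    moreover have "vel s * (of_int k * pt s powi (k - 1) * kern w (pt s) + pt s powi k * (kern w (pt s) * (\<i> * w + \<i> * \<sigma> * cnj w / (pt s)\<^sup>2))) = Q' s"
    proof -
      have "V * (K * X * E + t * X * (E * (\<i> * w + c / t\<^sup>2)))
          = K * (X * E * V) + \<i> * w * (t * X * E * V) + c * (X / t * E * V)"
        if "t \<noteq> 0" for V K X E t c :: complex
        using that by (simp add: field_simps power2_eq_square)
      from this[OF pt_nz[OF s(1)], of "vel s" "of_int k" "pt s powi (k - 1)" "kern w (pt s)" "\<i> * \<sigma> * cnj w"]
      show ?thesis
        unfolding Q'_def moment_integrand_def
        by (simp add: powi_succ_pred(1)[OF s(1), of k] powi_succ_pred(2)[OF s(1), of k])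
    qed
    ultimately show ?thesis by simp
  qed
  have cQ: "continuous_on {0<..} Q"
    unfolding Q_def by (intro continuous_intros continuous_pt continuous_kern_pt) (auto simp: pt_nz)
  define K where "K = exp (\<kappa> * cmod w)"
  have nQ: "cmod (Q s) \<le> K * (s powi k * exp (- (Im w * (s + cmod \<sigma> / s))))" if "0 < s" for s
  proof -
    have "cmod (Q s) = s powi k * cmod (kern w (pt s))" using that by (simp add: Q_def norm_mult norm_power_int norm_pt)
    also have "\<dots> \<le> s powi k * (K * exp (- (Im w * (s + cmod \<sigma> / s))))"
      unfolding K_def using that by (intro mult_left_mono norm_kern_le) auto
    finally show ?thesis by (simp add: mult_ac)
  qed
  have s0: "0 < cmod \<sigma>" using sigma_nz by simp
  have Q0: "(\<lambda>n. Q (1 / real (Suc n))) \<longlonglongrightarrow> 0"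
  proof -
    obtain B where B: "0 \<le> B" "\<And>s. 0 < s \<Longrightarrow> s powi (k - 1) * exp (- (Im w * (s + cmod \<sigma> / s))) \<le> B * exp (- (Im w / 2) * s)"
      by (rule bounded_exponential_moment[OF w s0]) blast
    have Qb: "cmod (Q s) \<le> K * B * s" if s: "0 < s" for s
    proof -
      have "s powi k = s * s powi (k - 1)" using s power_int_add_1'[of s "k - 1"] by simp
      then have "s powi k * exp (- (Im w * (s + cmod \<sigma> / s))) \<le> s * (B * exp (- (Im w / 2) * s))"
        using B(2)[OF s] s by (simp add: mult.assoc)
      also have "\<dots> \<le> s * (B * 1)" using s B(1) w by (intro mult_left_mono) auto
      finally show ?thesis using order_trans[OF nQ[OF s]] by (simp add: K_def mult_ac)
    qed
    have "cmod (Q (1 / real (Suc n))) \<le> K * B * (1 / real (Suc n))" for n by (rule Qb) simp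
    moreover have "(\<lambda>n. K * B * (1 / real (Suc n))) \<longlonglongrightarrow> 0" by real_asymp
    ultimately show ?thesis by (rule Lim_null_comparison[OF always_eventually[OF allI]])
  qed
  have Qinf: "(\<lambda>n. Q (real (Suc n))) \<longlonglongrightarrow> 0"
  proof -
    obtain B where B: "0 \<le> B" "\<And>s. 0 < s \<Longrightarrow> s powi k * exp (- (Im w * (s + cmod \<sigma> / s))) \<le> B * exp (- (Im w / 2) * s)"
      by (rule bounded_exponential_moment[OF w s0]) blast
    have "cmod (Q (real (Suc n))) \<le> K * (B * exp (- (Im w / 2) * real (Suc n)))" for n
      using order_trans[OF nQ[of "real (Suc n)"] mult_left_mono[OF B(2)[of "real (Suc n)"], of K]] by (simp add: K_def)
    moreover have "(\<lambda>n. K * (B * exp (- (Im w / 2) * real (Suc n)))) \<longlonglongrightarrow> 0" using w by real_asymp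
    ultimately show ?thesis by (rule Lim_null_comparison[OF always_eventually[OF allI]])
  qed
  \<comment> \<open>Compact intervals exhausting the half-line, on which the fundamental theorem applies.\<close>
  define J where "J n = {1 / real (Suc n)..real (Suc n)}" for n
  have J: "J n \<subseteq> {0<..}" for n unfolding J_def by (auto intro: less_le_trans[rotated])
  have J1: "1 / real (Suc n) \<le> real (Suc n)" for n by (simp add: divide_le_eq algebra_simps)
  have intJ: "(\<integral>s. indicator (J n) s *\<^sub>R Q' s \<partial>?M) = Q (real (Suc n)) - Q (1 / real (Suc n))" for n
  proof -
    have "(Q' has_integral Q (real (Suc n)) - Q (1 / real (Suc n))) (J n)"
      unfolding J_def
    proof (rule fundamental_theorem_of_calculus_interior_strong[of "{a, b}"])
      show "continuous_on {1 / real (Suc n)..real (Suc n)} Q"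
        using J[of n] by (intro continuous_on_subset[OF cQ]) (simp add: J_def)
      fix s assume "s \<in> {1 / real (Suc n)<..<real (Suc n)} - {a, b}"
      moreover from this have "0 < s" by (auto intro: less_trans[rotated])
      ultimately show "(Q has_vector_derivative Q' s) (at s)" by (intro dQ) auto
    qed (use J1 in auto)
    moreover have "integrable (lebesgue_on (J n)) Q'"
    proof -
      have "Q' absolutely_integrable_on {0<..}"
        using intQ' by (simp add: integrable_restrict_space set_integrable_def)
      then have "Q' absolutely_integrable_on (J n)"
        by (rule set_integrable_subset[OF _ _ J]) (auto simp: J_def)
      then show ?thesis by (rule absolutely_integrable_imp_integrable) (auto simp: J_def)
    qed
    ultimately have "(\<integral>s. Q' s \<partial>lebesgue_on (J n)) = Q (real (Suc n)) - Q (1 / real (Suc n))"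
      by (subst lebesgue_integral_eq_integral) (auto simp: J_def integral_unique)
    then show ?thesis using J by (subst integral_lebesgue_on_indicator) (auto simp: J_def)
  qed
  have "(\<lambda>n. \<integral>s. indicator (J n) s *\<^sub>R Q' s \<partial>?M) \<longlonglongrightarrow> (\<integral>s. Q' s \<partial>?M)"
  proof (rule integral_dominated_convergence[where w="\<lambda>s. cmod (Q' s)"])
    show "Q' \<in> borel_measurable ?M" using intQ' by simp
    have Jm: "J n \<in> sets ?M" for n
      using J[of n] by (subst sets_restrict_space_iff) (auto simp: J_def)
    show "(\<lambda>s. indicator (J n) s *\<^sub>R Q' s) \<in> borel_measurable ?M" for n
      using intQ' by (intro borel_measurable_scaleR borel_measurable_indicator Jm) auto
    show "integrable ?M (\<lambda>s. cmod (Q' s))" using intQ' by (rule integrable_norm)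
    show "AE s in ?M. (\<lambda>n. indicator (J n) s *\<^sub>R Q' s) \<longlonglongrightarrow> Q' s"
    proof (rule AE_I2)
      fix s assume "s \<in> space ?M"
      then have s: "0 < s" by simp
      have "(\<lambda>n. 1 / real (Suc n)) \<longlonglongrightarrow> 0" by real_asymp
      then have "eventually (\<lambda>n. 1 / real (Suc n) < s) sequentially" using s by (rule order_tendstoD)
      moreover have "filterlim (\<lambda>n. real (Suc n)) at_top sequentially" by real_asymp
      then have "eventually (\<lambda>n. s < real (Suc n)) sequentially" by (simp only: filterlim_at_top_dense)
      ultimately have "eventually (\<lambda>n. Q' s = indicator (J n) s *\<^sub>R Q' s) sequentially"
        by eventually_elim (auto simp: J_def)
      then show "(\<lambda>n. indicator (J n) s *\<^sub>R Q' s) \<longlonglongrightarrow> Q' s"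
        by (rule Lim_transform_eventually[OF tendsto_const])
    qed
    show "AE s in ?M. norm (indicator (J n) s *\<^sub>R Q' s) \<le> cmod (Q' s)" for n
      by (auto simp: indicator_def)
  qed
  then have "(\<lambda>n. Q (real (Suc n)) - Q (1 / real (Suc n))) \<longlonglongrightarrow> (\<integral>s. Q' s \<partial>?M)"
    unfolding intJ .
  moreover have "(\<lambda>n. Q (real (Suc n)) - Q (1 / real (Suc n))) \<longlonglongrightarrow> 0 - 0"
    by (intro tendsto_diff Q0 Qinf)
  ultimately have "(\<integral>s. Q' s \<partial>?M) = 0" using LIMSEQ_unique by fastforce
  then show ?thesis
    unfolding Q'_def moment_def
    by (simp add: integrable_moment_integrand[OF w])
qed

end

lemma norm_exp_minus_one_le:
  fixes z :: complex
  shows "cmod (exp z - 1) \<le> cmod z * exp (cmod z)"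
proof -
  have "cmod (exp z - exp 0) \<le> exp (cmod z) * cmod (z - 0)"
  proof (rule field_differentiable_bound[of "cball 0 (cmod z)" exp exp])
    show "cmod (exp w) \<le> exp (cmod z)" if "w \<in> cball 0 (cmod z)" for w
      using that norm_exp[of w] by (auto intro: order_trans)
  qed (auto intro: DERIV_exp[THEN has_field_derivative_at_within])
  then show ?thesis by (simp add: mult.commute)
qed

lemma mult_exp_minus_le_1: "x * exp (- x) \<le> 1" for x :: real
proof -
  have "x \<le> exp x" using exp_ge_add_one_self[of x] by linarith
  then show ?thesis by (simp add: exp_minus field_simps)
qed

context model_contour
begin

section \<open>The radial fundamental solution\<close>

text \<open>
  By the recurrence, the derivative of \<open>moment k (r cis \<psi>)\<close> with respect to \<open>\<psi>\<close> is \<open>- i k\<close> times the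
  moment itself. This is what makes the integrals over differently rotated contours represent the same
  function.
\<close>

theorem moment_rotation:
  assumes w: "0 < Im w"
  shows "cis (of_int k * Arg w) * moment k w = cis (of_int k * (pi / 2)) * moment k (\<i> * cmod w)"
proof -
  define r where "r = cmod w"
  have r: "0 < r" using w by (auto simp: r_def)
  define g where "g \<psi> = cis (of_int k * \<psi>) * moment k (r * cis \<psi>)" for \<psi>
  have "(g has_vector_derivative 0) (at \<psi> within {0<..<pi})" if \<psi>: "\<psi> \<in> {0<..<pi}" for \<psi>
  proof -
    define u where "u = r * cis \<psi>"
    have u: "0 < Im u" using \<psi> r by (simp add: u_def sin_gt_zero)
    have dcis: "((\<lambda>x. cis (c * x)) has_vector_derivative (\<i> * c) * cis (c * \<psi>)) (at \<psi>)" for c :: real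
    proof -
      have "((\<lambda>x. \<i> * of_real (c * x)) has_vector_derivative \<i> * of_real c) (at \<psi>)"
        by (rule has_vector_derivative_mult_right, rule has_vector_derivative_of_real)
          (auto intro!: derivative_eq_intros)
      from field_vector_diff_chain_at[OF this DERIV_exp] show ?thesis
        by (simp add: cis_conv_exp comp_def)
    qed
    have "((\<lambda>x. r * cis x) has_vector_derivative \<i> * u) (at \<psi>)"
      using has_vector_derivative_mult_right[OF dcis[of 1], of "of_real r"] by (simp add: u_def mult_ac)
    from vector_derivative_diff_chain_within[OF this has_derivative_at_withinI[OF has_derivative_moment]]
    have dm: "((\<lambda>x. moment k (r * cis x)) has_vector_derivative
       \<i> * (\<i> * u) * moment (k + 1) u - \<i> * \<sigma> * cnj (\<i> * u) * moment (k - 1) u) (at \<psi>)"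
      using u by (simp add: comp_def u_def)
    have "\<i> * (\<i> * u) * moment (k + 1) u - \<i> * \<sigma> * cnj (\<i> * u) * moment (k - 1) u
      = \<i> * (\<i> * u * moment (k + 1) u + \<i> * \<sigma> * cnj u * moment (k - 1) u)"
      by (simp add: algebra_simps)
    also have "\<i> * u * moment (k + 1) u + \<i> * \<sigma> * cnj u * moment (k - 1) u = - of_int k * moment k u"
      using moment_recurrence[OF u, of k] by (simp add: add_eq_0_iff add.assoc)
    finally have "\<i> * (\<i> * u) * moment (k + 1) u - \<i> * \<sigma> * cnj (\<i> * u) * moment (k - 1) u = - (\<i> * of_int k * moment k u)"
      by simp
    with dm have dm': "((\<lambda>x. moment k (r * cis x)) has_vector_derivative - (\<i> * of_int k * moment k u)) (at \<psi>)"
      by (simp only:)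
    have "(g has_vector_derivative cis (of_int k * \<psi>) * - (\<i> * of_int k * moment k u)
        + (\<i> * of_real (of_int k)) * cis (of_int k * \<psi>) * moment k (r * cis \<psi>)) (at \<psi>)"
      unfolding g_def by (rule has_vector_derivative_mult[OF dcis dm'])
    then have "(g has_vector_derivative 0) (at \<psi>)" by (simp add: u_def)
    then show ?thesis by (rule has_vector_derivative_at_within)
  qed
  then obtain c where c: "\<And>\<psi>. \<psi> \<in> {0<..<pi} \<Longrightarrow> g \<psi> = c"
    using has_vector_derivative_zero_constant[of "{0<..<pi}" g] by auto
  have "0 < Arg w" "Arg w < pi" using w Arg_lt_pi by auto
  then have "g (Arg w) = g (pi / 2)" using c by auto
  moreover have "of_real r * cis (Arg w) = w" unfolding r_def by (metis rcis_cmod_Arg rcis_def)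
  ultimately show ?thesis by (simp add: g_def r_def mult.commute)
qed

corollary moment_0_radial: "0 < Im w \<Longrightarrow> moment 0 w = moment 0 (\<i> * cmod w)"
  using moment_rotation[of w 0] by simp

corollary moment_minus_1_radial:
  assumes "0 < Im w"
  shows "moment (- 1) w = - \<i> * w / cmod w * moment (- 1) (\<i> * cmod w)"
proof -
  have nz: "w \<noteq> 0" using assms by auto
  have "w = cmod w * cis (Arg w)" by (metis rcis_cmod_Arg rcis_def)
  then have cw: "cis (Arg w) = w / cmod w" using nz by (metis nonzero_mult_div_cancel_left norm_eq_zero of_real_eq_0_iff)
  have "cis (Arg w) * (cis (- Arg w) * moment (- 1) w) = cis (Arg w) * (cis (- (pi / 2)) * moment (- 1) (\<i> * cmod w))"
    using moment_rotation[OF assms, of "- 1"] by simp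
  moreover have "cis (Arg w) * (cis (- Arg w) * x) = x" for x by (simp add: cis_mult flip: mult.assoc)
  moreover have "cis (- (pi / 2)) = - \<i>" by (simp add: cis.ctr complex_eq_iff)
  ultimately show ?thesis by (simp add: cw)
qed

text \<open>
  \<open>radial r\<close> is the common value \<open>F(w)\<close> of the moment of order \<open>0\<close> on the circle of radius \<open>r\<close>; in terms of
  the Bessel function it is \<open>2 K\<^sub>0(2 r \<surd>\<sigma>)\<close>.
\<close>

definition radial :: "real \<Rightarrow> complex" where
  "radial r = moment 0 (\<i> * r)"

text \<open>
  The value of \<open>cnj w \<partial>F/\<partial>cnj w\<close> on that circle, which is half of \<open>r F'(r)\<close>. The derivatives of the
  two functions, found from the recurrences of orders \<open>0\<close> and \<open>- 1\<close>, form the first-order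
  system for the radial Helmholtz equation \<open>(r F')' = 4 \<sigma> r F\<close>.
\<close>

definition radial_flux :: "real \<Rightarrow> complex" where
  "radial_flux r = - \<sigma> * r * moment (- 1) (\<i> * r)"

lemma moment_imaginary_axis_has_vector_derivative:
  assumes "0 < r"
  shows "((\<lambda>r. moment k (\<i> * of_real r)) has_vector_derivative
    - (moment (k + 1) (\<i> * r) + \<sigma> * moment (k - 1) (\<i> * r))) (at r)"
proof -
  have "((\<lambda>r. \<i> * of_real r) has_vector_derivative \<i> * of_real 1) (at r)"
    by (rule has_vector_derivative_mult_right, rule has_vector_derivative_of_real) (rule DERIV_ident)
  from vector_derivative_diff_chain_within[OF this has_derivative_at_withinI[OF has_derivative_moment[of _ k]]]
  have "((\<lambda>r. moment k (\<i> * of_real r)) has_vector_derivative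
     \<i> * (\<i> * of_real 1) * moment (k + 1) (\<i> * r) - \<i> * \<sigma> * cnj (\<i> * of_real 1) * moment (k - 1) (\<i> * r)) (at r)"
    using assms by (simp add: comp_def)
  moreover have "\<i> * (\<i> * of_real 1) * x - \<i> * \<sigma> * cnj (\<i> * of_real 1) * y = - (x + \<sigma> * y)" for x y
    by (simp add: mult_ac)
  ultimately show ?thesis by (simp only:)
qed

lemma radial_has_vector_derivative:
  assumes "0 < r"
  shows "(radial has_vector_derivative 2 * radial_flux r / r) (at r)"
proof -
  have "of_real r * moment 1 (\<i> * r) = of_real r * (\<sigma> * moment (- 1) (\<i> * r))"
    using moment_recurrence[of "\<i> * r" 0] assms by (simp add: algebra_simps)
  then have "moment 1 (\<i> * r) = \<sigma> * moment (- 1) (\<i> * r)" using assms by simp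
  with moment_imaginary_axis_has_vector_derivative[OF assms, of 0] assms show ?thesis
    by (simp add: radial_def[abs_def] radial_flux_def)
qed

lemma radial_flux_has_vector_derivative:
  assumes "0 < r"
  shows "(radial_flux has_vector_derivative 2 * \<sigma> * r * radial r) (at r)"
proof -
  have 1: "((\<lambda>r. - \<sigma> * of_real r) has_vector_derivative - \<sigma> * of_real 1) (at r)"
    by (rule has_vector_derivative_mult_right, rule has_vector_derivative_of_real) (rule DERIV_ident)
  have "(radial_flux has_vector_derivative (- \<sigma> * r) * - (moment 0 (\<i> * r) + \<sigma> * moment (- 2) (\<i> * r))
     + (- \<sigma> * of_real 1) * moment (- 1) (\<i> * r)) (at r)"
    unfolding radial_flux_def[abs_def]
    using has_vector_derivative_mult[OF 1 moment_imaginary_axis_has_vector_derivative[OF assms, of "- 1"]] by simp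
  moreover have m: "moment (- 1) (\<i> * r) = \<sigma> * r * moment (- 2) (\<i> * r) - r * moment 0 (\<i> * r)"
    using moment_recurrence[of "\<i> * r" "- 1"] assms by (simp add: algebra_simps)
  have "(- \<sigma> * r) * - (moment 0 (\<i> * r) + \<sigma> * moment (- 2) (\<i> * r)) + (- \<sigma> * of_real 1) * moment (- 1) (\<i> * r)
      = 2 * \<sigma> * r * radial r"
    unfolding m radial_def by (simp add: algebra_simps)
  ultimately show ?thesis by simp
qed

text \<open>
  Dominates the integrands below, up to constant factors, uniformly for \<open>0 < r \<le> 1\<close>, where the exponential decay degenerates.
\<close>

definition majorant :: "real \<Rightarrow> real" where
  "majorant s = (if s < a then 1 else 1 / s\<^sup>2)"

lemma integrable_majorant: "integrable (lebesgue_on {0<..}) majorant"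
proof -
  have "(\<lambda>s. 1 / s\<^sup>2) absolutely_integrable_on {a..}"
    using has_integral_inverse_power_to_inf[of 2 a] ab
    by (intro nonnegative_absolutely_integrable_1) (auto simp: integrable_on_def)
  then have 1: "majorant absolutely_integrable_on {a..}"
    by (rule set_integrable_cong[THEN iffD1, rotated 3]) (auto simp: majorant_def)
  have "(\<lambda>s. 1 :: real) absolutely_integrable_on {0<..<a}"
    using ab by (intro absolutely_integrable_on_const) auto
  then have "majorant absolutely_integrable_on {0<..<a}"
    by (rule set_integrable_cong[THEN iffD1, rotated 3]) (auto simp: majorant_def)
  then have "majorant absolutely_integrable_on ({0<..<a} \<union> {a..})"
    using 1 by (intro set_integrable_Un) auto
  also have "{0<..<a} \<union> {a..} = {0<..}" using ab by auto
  finally show ?thesis by (rule absolutely_integrable_imp_integrable) auto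
qed

text \<open>
  A primitive is \<open>exp (- c / s)\<close>, extended continuously by \<open>0\<close> to \<open>s = 0\<close>.
\<close>

lemma integrable_radial_flux_profile:
  assumes "0 < c"
  shows "has_bochner_integral (lebesgue_on {0<..}) (\<lambda>s. if s < a then c / s\<^sup>2 * exp (- c / s) else 0) (exp (- c / a))"
proof -
  define u where "u s = (if s \<le> 0 then 0 else exp (- c / s))" for s :: real
  let ?f = "\<lambda>s. if s < a then c / s\<^sup>2 * exp (- c / s) else 0"
  have "((\<lambda>s. c / s\<^sup>2 * exp (- c / s)) has_integral u a - u 0) {0..a}"
  proof (rule fundamental_theorem_of_calculus_interior)
    show "continuous_on {0..a} u"
    proof (rule continuous_on_subset[of UNIV])
      show "continuous_on UNIV u"
        unfolding continuous_on_eq_continuous_within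
      proof (intro ballI)
        fix x :: real
        consider "x < 0" | "x = 0" | "0 < x" by linarith
        then show "continuous (at x) u"
        proof cases
          case 1
          have "eventually (\<lambda>y. u y = 0) (nhds x)"
            using eventually_nhds_in_open[of "{..<0}" x] 1 by (auto elim!: eventually_mono simp: u_def)
          then show ?thesis by (simp add: isCont_cong)
        next
          case 2
          have "(u \<longlongrightarrow> 0) (at_left 0)"
            by (rule Lim_transform_eventually[OF tendsto_const]) (auto simp: u_def eventually_at_filter)
          moreover have "((\<lambda>s. exp (- c / s)) \<longlongrightarrow> 0) (at_right 0)" using assms by real_asymp
          then have "(u \<longlongrightarrow> 0) (at_right 0)"
            by (rule Lim_transform_eventually) (auto simp: u_def eventually_at_filter)
          ultimately have "(u \<longlongrightarrow> 0) (at 0)" by (simp add: filterlim_split_at)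
          then show ?thesis using 2 by (simp add: isCont_def u_def)
        next
          case 3
          have "eventually (\<lambda>y. u y = exp (- c / y)) (nhds x)"
            using eventually_nhds_in_open[of "{0<..}" x] 3 by (auto elim!: eventually_mono simp: u_def)
          moreover have "isCont (\<lambda>y. exp (- c / y)) x" using 3 by (intro continuous_intros) auto
          ultimately show ?thesis by (simp add: isCont_cong)
        qed
      qed
    qed auto
    fix s assume s: "s \<in> {0<..<a}"
    have "(u has_real_derivative (c / s\<^sup>2 * exp (- c / s))) (at s)"
    proof (rule has_field_derivative_transform_within_open)
      show "((\<lambda>s. exp (- c / s)) has_real_derivative (c / s\<^sup>2 * exp (- c / s))) (at s)"
        using s by (auto intro!: derivative_eq_intros simp: power2_eq_square divide_simps)
      show "open {0::real<..}" "s \<in> {0<..}" using s by auto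
    qed (auto simp: u_def)
    then show "(u has_vector_derivative (c / s\<^sup>2 * exp (- c / s))) (at s)"
      by (simp add: has_real_derivative_iff_has_vector_derivative)
  qed (use ab in auto)
  then have "((\<lambda>s. c / s\<^sup>2 * exp (- c / s)) has_integral exp (- c / a)) {0..a}"
    using ab by (simp add: u_def)
  then have "((\<lambda>s. if s \<in> {0..a} then c / s\<^sup>2 * exp (- c / s) else 0) has_integral exp (- c / a)) {0..}"
    by (subst has_integral_restrict) auto
  then have hi: "(?f has_integral exp (- c / a)) {0..}"
    by (rule has_integral_spike[of "{a}", rotated 2]) auto
  then have hi': "(?f has_integral exp (- c / a)) {0<..}"
    by (rule has_integral_spike_set_eq[THEN iffD1, rotated 2]) (auto intro: negligible_subset[of "{0}"])
  have "?f absolutely_integrable_on {0<..}"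
    using assms hi' by (intro nonnegative_absolutely_integrable_1) (auto simp: integrable_on_def)
  then have "integrable (lebesgue_on {0<..}) ?f" by (rule absolutely_integrable_imp_integrable) auto
  moreover from this have "(\<integral>s. ?f s \<partial>lebesgue_on {0<..}) = exp (- c / a)"
    using integral_unique[OF hi'] by (simp add: lebesgue_integral_eq_integral)
  ultimately show ?thesis by (simp add: has_bochner_integral_iff)
qed

text \<open>
  For small \<open>r\<close> the mass of the integrand sits at \<open>s\<close> of order \<open>r\<close>, hence on the initial ray. There it is
  the derivative of \<open>exp (- r \<bar>\<sigma>\<bar> / s)\<close> up to the factor \<open>exp (- r t)\<close>, which is close to \<open>1\<close>; the
  integral of that derivative over the ray tends to \<open>1\<close>, and what is neglected is of order \<open>r\<close>.
\<close>

theorem radial_flux_tendsto: "(radial_flux \<longlongrightarrow> - 1) (at_right 0)"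
proof -
  define C where "C = exp a + cmod \<sigma> * vmax * exp \<kappa>"
  define G where "G = (\<integral>s. majorant s \<partial>lebesgue_on {0<..})"
  have s0: "0 < cmod \<sigma>" using sigma_nz by simp
  have \<sigma>: "\<sigma> = of_real (cmod \<sigma>) * cis (Arg \<sigma>)" by (metis rcis_cmod_Arg rcis_def)
  have \<kappa>0: "0 \<le> \<kappa>" using ab by (simp add: \<kappa>_def)
  have main: "cmod (radial_flux r + exp (- (r * cmod \<sigma>) / a)) \<le> r * C * G" if r: "0 < r" "r \<le> 1" for r :: real
  proof -
    define c where "c = r * cmod \<sigma>"
    have c: "0 < c" using r s0 by (simp add: c_def)
    define u where "u s = (if s < a then c / s\<^sup>2 * exp (- c / s) else 0)" for s :: real
    define h where "h s = \<sigma> * r * moment_integrand (- 1) (\<i> * r) s" for s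
    have u: "integrable (lebesgue_on {0<..}) u" "(\<integral>s. u s \<partial>lebesgue_on {0<..}) = exp (- c / a)"
      using integrable_radial_flux_profile[OF c] unfolding u_def[abs_def] by (auto simp: has_bochner_integral_iff)
    have h: "integrable (lebesgue_on {0<..}) h"
      unfolding h_def using r by (intro integrable_mult_right integrable_moment_integrand) auto
    have int_h: "(\<integral>s. h s \<partial>lebesgue_on {0<..}) = - radial_flux r"
      unfolding h_def radial_flux_def moment_def by simp
    have bnd: "cmod (h s - of_real (u s)) \<le> r * C * majorant s" if s: "0 < s" for s
    proof (cases "s < a")
      case True
      have p: "pt s = of_real s * cis (Arg \<sigma>)" "vel s = cis (Arg \<sigma>)"
        using True by (auto simp: pt_def vel_def ang_initial)
      have "\<sigma> / pt s = of_real (cmod \<sigma> / s)"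
        using s by (subst \<sigma>) (simp add: p)
      then have k: "kern (\<i> * r) (pt s) = exp (- (r * pt s)) * of_real (exp (- c / s))"
        unfolding kern_def
        by (simp add: exp_of_real[symmetric] c_def exp_add[symmetric] algebra_simps)
           (metis (no_types, lifting) mult.commute times_divide_eq_right)
      have "h s = of_real (c / s\<^sup>2) * kern (\<i> * r) (pt s)"
      proof -
        have "h s = (\<sigma> * vel s / (pt s)\<^sup>2) * r * kern (\<i> * r) (pt s)"
          by (simp add: h_def moment_integrand_def power_int_minus divide_inverse mult_ac)
        also have "\<sigma> * vel s / (pt s)\<^sup>2 = of_real (cmod \<sigma> / s\<^sup>2)"
          using s by (subst \<sigma>) (simp add: p power2_eq_square)
        finally show ?thesis by (simp add: c_def mult_ac)
      qed
      then have "h s - of_real (u s) = of_real (c / s\<^sup>2 * exp (- c / s)) * (exp (- (r * pt s)) - 1)"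
        using True by (simp only: u_def k if_True of_real_mult right_diff_distrib mult_ac mult_1_left mult_1_right)
      also have "cmod \<dots> = c / s\<^sup>2 * exp (- c / s) * cmod (exp (- (r * pt s)) - 1)"
        using c by (simp add: norm_mult norm_divide norm_power)
      also have "\<dots> \<le> c / s\<^sup>2 * exp (- c / s) * (r * s * exp a)"
      proof (rule mult_left_mono)
        have n: "cmod (- (of_real r * pt s)) = r * s" using r s by (simp add: norm_mult norm_pt)
        have "cmod (exp (- (r * pt s)) - 1) \<le> r * s * exp (r * s)"
          using norm_exp_minus_one_le[of "- (of_real r * pt s)"] unfolding n .
        also have "\<dots> \<le> r * s * exp a"
          using r s True mult_mono[of r 1 s a] by (intro mult_left_mono) auto
        finally show "cmod (exp (- (r * pt s)) - 1) \<le> r * s * exp a" .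
      qed (use c in auto)
      also have "\<dots> = r * exp a * (c / s * exp (- (c / s)))"
        using s by (simp add: power2_eq_square)
      also have "\<dots> \<le> r * exp a * 1" using r by (intro mult_left_mono mult_exp_minus_le_1) auto
      also have "\<dots> \<le> r * C" using r s0 vmax_ge_1 by (simp add: C_def)
      finally show ?thesis using True by (simp add: majorant_def)
    next
      case False
      have "cmod (h s - of_real (u s)) = cmod \<sigma> * r * cmod (moment_integrand (- 1) (\<i> * r) s)"
        using False r by (simp add: u_def h_def norm_mult)
      also have "\<dots> \<le> cmod \<sigma> * r * (vmax * exp \<kappa> * (1 / s\<^sup>2))"
      proof (intro mult_left_mono order_trans[OF norm_moment_integrand_le[OF s]])
        have "exp (\<kappa> * cmod (\<i> * complex_of_real r)) \<le> exp \<kappa>"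
          using r \<kappa>0 by (simp add: norm_mult mult_left_le)
        moreover have "s powi (- 1 - 1) * exp (- (Im (\<i> * r) * (s + cmod \<sigma> / s))) \<le> 1 / s\<^sup>2 * 1"
          using r s by (intro mult_mono) (auto simp: power_int_minus divide_inverse)
        ultimately show "vmax * exp (\<kappa> * cmod (\<i> * r)) * (s powi (- 1 - 1) * exp (- (Im (\<i> * r) * (s + cmod \<sigma> / s))))
          \<le> vmax * exp \<kappa> * (1 / s\<^sup>2)"
          using s vmax_ge_1 by (intro mult_mono) auto
      qed (use r in auto)
      also have "\<dots> \<le> r * C * (1 / s\<^sup>2)"
        unfolding C_def using r s by (simp add: algebra_simps add_divide_distrib)
      finally show ?thesis using False by (simp add: majorant_def)
    qed
    have "radial_flux r + exp (- c / a) = - (\<integral>s. h s - of_real (u s) \<partial>lebesgue_on {0<..})"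
      using h u by (simp add: int_h)
    also have "cmod \<dots> \<le> (\<integral>s. r * C * majorant s \<partial>lebesgue_on {0<..})"
      unfolding norm_minus_cancel
      using bnd by (intro Bochner_Integration.integral_norm_bound_integral) (auto intro!: h u integrable_majorant Bochner_Integration.integrable_diff)
    finally show ?thesis by (simp add: G_def c_def)
  qed
  have "((\<lambda>r. radial_flux r + exp (- (r * cmod \<sigma>) / a)) \<longlongrightarrow> 0) (at_right 0)"
  proof (rule Lim_null_comparison)
    show "\<forall>\<^sub>F r in at_right 0. cmod (radial_flux r + exp (- (r * cmod \<sigma>) / a)) \<le> r * C * G"
      using eventually_at_right_real[OF zero_less_one]
    proof eventually_elim
      case (elim r)
      then show ?case by (intro main) auto
    qed
    show "((\<lambda>r. r * C * G) \<longlongrightarrow> 0) (at_right 0)" by (auto intro!: tendsto_eq_intros)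
  qed
  moreover have "((\<lambda>r. complex_of_real (exp (- (r * cmod \<sigma>) / a))) \<longlongrightarrow> 1) (at_right 0)"
    using ab by (auto intro!: tendsto_eq_intros)
  ultimately have "((\<lambda>r. (radial_flux r + exp (- (r * cmod \<sigma>) / a)) - exp (- (r * cmod \<sigma>) / a)) \<longlongrightarrow> 0 - 1) (at_right 0)"
    by (rule tendsto_diff)
  then show ?thesis by simp
qed

text \<open>
  The singularity at \<open>0\<close> is only logarithmic. Because \<open>x exp (- x) \<le> 1\<close>, the factor \<open>r\<close> gives
  the integrands a majorant that does not depend on \<open>r\<close>, while they tend to \<open>0\<close> pointwise.
\<close>

theorem radial_mult_tendsto: "((\<lambda>r. r * radial r) \<longlongrightarrow> 0) (at_right 0)"
  unfolding tendsto_at_iff_sequentially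
proof (intro allI impI)
  fix X :: "nat \<Rightarrow> real" assume X: "\<forall>i. X i \<in> {0<..} - {0}" "X \<longlonglongrightarrow> 0"
  then have "eventually (\<lambda>n. X n < 1) sequentially" by (simp add: order_tendstoD)
  then obtain k where k: "\<And>n. n \<ge> k \<Longrightarrow> X n < 1" by (auto simp: eventually_sequentially)
  define Y where "Y n = X (n + k)" for n
  have Y: "0 < Y n" "Y n \<le> 1" for n using X(1) k[of "n + k"] by (auto simp: Y_def less_imp_le)
  have Y0: "Y \<longlonglongrightarrow> 0" unfolding Y_def using X(2) by (rule LIMSEQ_ignore_initial_segment)
  have s0: "0 < cmod \<sigma>" using sigma_nz by simp
  have \<kappa>0: "0 \<le> \<kappa>" using ab by (simp add: \<kappa>_def)
  define D where "D = vmax * exp \<kappa> * (1 + 1 / cmod \<sigma>)"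
  have ve: "0 \<le> vmax * exp \<kappa>" using vmax_ge_1 by simp
  have bnd: "cmod (Y n * moment_integrand 0 (\<i> * Y n) s) \<le> vmax * exp \<kappa> * (Y n / s * exp (- (Y n * (s + cmod \<sigma> / s))))"
    if s: "0 < s" for s n
  proof -
    have "exp (\<kappa> * cmod (\<i> * Y n)) \<le> exp \<kappa>" using Y[of n] \<kappa>0 by (simp add: norm_mult mult_left_le)
    then have "cmod (moment_integrand 0 (\<i> * Y n) s) \<le> vmax * exp \<kappa> * (1 / s * exp (- (Y n * (s + cmod \<sigma> / s))))"
      using s vmax_ge_1 
      by (intro order_trans[OF norm_moment_integrand_le[OF s]] mult_mono) (auto simp: power_int_minus divide_inverse)
    then have "Y n * cmod (moment_integrand 0 (\<i> * Y n) s) \<le> Y n * (vmax * exp \<kappa> * (1 / s * exp (- (Y n * (s + cmod \<sigma> / s)))))"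
      using Y[of n] by (intro mult_left_mono) auto
    then show ?thesis using Y[of n] by (simp add: norm_mult mult_ac)
  qed
  have "(\<lambda>n. \<integral>s. Y n * moment_integrand 0 (\<i> * Y n) s \<partial>lebesgue_on {0<..}) \<longlonglongrightarrow> (\<integral>s. 0 \<partial>lebesgue_on {0::real<..})"
  proof (rule integral_dominated_convergence[where w="\<lambda>s. D * majorant s"])
    show "integrable (lebesgue_on {0<..}) (\<lambda>s. D * majorant s)"
      by (intro integrable_mult_right integrable_majorant)
    show "AE s in lebesgue_on {0<..}. cmod (Y n * moment_integrand 0 (\<i> * Y n) s) \<le> D * majorant s" for n
    proof (rule AE_I2)
      fix s assume "s \<in> space (lebesgue_on {0::real<..})"
      then have s: "0 < s" by simp
      have le: "Y n / s * exp (- (Y n * (s + cmod \<sigma> / s))) \<le> (1 + 1 / cmod \<sigma>) * majorant s"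
      proof (cases "s < a")
        case True
        have "Y n / s * exp (- (Y n * (s + cmod \<sigma> / s))) \<le> Y n / s * exp (- (Y n * cmod \<sigma> / s))"
          using Y[of n] s by (intro mult_left_mono) (auto simp: algebra_simps)
        also have "\<dots> = 1 / cmod \<sigma> * (Y n * cmod \<sigma> / s * exp (- (Y n * cmod \<sigma> / s)))"
          using s0 by simp
        also have "\<dots> \<le> 1 / cmod \<sigma> * 1" by (intro mult_left_mono mult_exp_minus_le_1) auto
        finally show ?thesis using True by (simp add: majorant_def)
      next
        case False
        have "Y n / s * exp (- (Y n * (s + cmod \<sigma> / s))) \<le> Y n / s * exp (- (Y n * s))"
          using Y[of n] s by (intro mult_left_mono) (auto simp: algebra_simps)
        also have "\<dots> = 1 / s\<^sup>2 * (Y n * s * exp (- (Y n * s)))"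
          using s by (simp add: power2_eq_square)
        also have "\<dots> \<le> 1 / s\<^sup>2 * 1" by (intro mult_left_mono mult_exp_minus_le_1) auto
        also have "\<dots> \<le> (1 + 1 / cmod \<sigma>) * (1 / s\<^sup>2)" using s0 by (simp add: divide_right_mono)
        finally show ?thesis using False by (simp add: majorant_def)
      qed
      have "vmax * exp \<kappa> * (Y n / s * exp (- (Y n * (s + cmod \<sigma> / s)))) \<le> D * majorant s"
        using mult_left_mono[OF le ve] by (simp only: D_def mult.assoc)
      then show "cmod (Y n * moment_integrand 0 (\<i> * Y n) s) \<le> D * majorant s"
        using bnd[OF s, of n] by linarith
    qed
    show "AE s in lebesgue_on {0<..}. (\<lambda>n. Y n * moment_integrand 0 (\<i> * Y n) s) \<longlonglongrightarrow> 0"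
    proof (rule AE_I2)
      fix s assume "s \<in> space (lebesgue_on {0::real<..})"
      then have s: "0 < s" by simp
      show "(\<lambda>n. Y n * moment_integrand 0 (\<i> * Y n) s) \<longlonglongrightarrow> 0"
      proof (rule Lim_null_comparison[OF always_eventually[OF allI]])
        fix n
        have "Y n / s * exp (- (Y n * (s + cmod \<sigma> / s))) \<le> Y n / s * 1"
          using Y[of n] s by (intro mult_left_mono) auto
        then show "cmod (Y n * moment_integrand 0 (\<i> * Y n) s) \<le> vmax * exp \<kappa> * (Y n / s * 1)"
          using bnd[OF s, of n] mult_left_mono[OF _ ve] by (meson order_trans)
        show "(\<lambda>n. vmax * exp \<kappa> * (Y n / s * 1)) \<longlonglongrightarrow> 0"
          using s by (auto intro!: tendsto_eq_intros Y0)
      qed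
    qed
  qed auto
  then have "(\<lambda>n. Y n * radial (Y n)) \<longlonglongrightarrow> 0"
    by (simp add: radial_def moment_def)
  then show "((\<lambda>r. of_real r * radial r) \<circ> X) \<longlonglongrightarrow> 0"
    unfolding Y_def comp_def by (rule LIMSEQ_offset)
qed

end

section \<open>Shrinking a closed chain of Lipschitz curves\<close>

text \<open>
  Provides the local Lipschitz bound that the fundamental theorem asks for, by the mean value
  inequality on discs of a fixed radius around the points of the curve.
\<close>

lemma continuous_derivative_imp_Lipschitz_along_path:
  fixes \<Psi> :: "complex \<Rightarrow> complex" and p :: "real \<Rightarrow> complex"
  assumes V: "open V" and p: "C-lipschitz_on {0..1} p" "p ` {0..1} \<subseteq> V"
    and d\<Psi>: "\<And>x. x \<in> V \<Longrightarrow> (\<Psi> has_derivative \<Psi>' x) (at x)"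
    and bd: "\<And>x h. x \<in> V \<Longrightarrow> cmod (\<Psi>' x h) \<le> B x * cmod h"
    and B: "continuous_on V B"
  obtains \<delta> K where "0 < \<delta>" "0 \<le> K"
    "\<And>x y. x \<in> {0..1} \<Longrightarrow> y \<in> {0..1} \<Longrightarrow> \<bar>x - y\<bar> < \<delta> \<Longrightarrow> cmod (\<Psi> (p x) - \<Psi> (p y)) \<le> K * \<bar>x - y\<bar>"
proof -
  have C0: "0 \<le> C" using p(1) by (rule lipschitz_on_nonneg)
  have cp: "compact (p ` {0..1})"
    by (intro compact_continuous_image lipschitz_on_continuous_on[OF p(1)]) auto
  obtain e where e: "0 < e" "(\<Union>x\<in>p ` {0..1}. cball x e) \<subseteq> V"
    using compact_subset_open_imp_cball_epsilon_subset[OF cp V p(2)] by blast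
  define P where "P = (\<Union>x\<in>p ` {0..1}. cball x e)"
  have P_eq: "P = {x + y | x y. x \<in> p ` {0..1} \<and> y \<in> cball 0 e}"
  proof (intro set_eqI iffI)
    fix u assume "u \<in> P"
    then obtain x where "x \<in> p ` {0..1}" "dist x u \<le> e" by (auto simp: P_def)
    then show "u \<in> {x + y | x y. x \<in> p ` {0..1} \<and> y \<in> cball 0 e}"
      by (intro CollectI exI[of _ x] exI[of _ "u - x"]) (auto simp: dist_norm norm_minus_commute)
  next
    fix u assume "u \<in> {x + y | x y. x \<in> p ` {0..1} \<and> y \<in> cball 0 e}"
    then obtain x y where "u = x + y" "x \<in> p ` {0..1}" "y \<in> cball 0 e" by blast
    then show "u \<in> P" unfolding P_def by (intro UN_I[of x]) (auto simp: dist_norm)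
  qed
  have "compact P" unfolding P_eq by (rule compact_sums[OF cp compact_cball])
  then have "bounded (B ` P)"
    using e(2) by (intro compact_imp_bounded compact_continuous_image continuous_on_subset[OF B]) (auto simp: P_def)
  then obtain M where M: "0 < M" "\<And>x. x \<in> P \<Longrightarrow> \<bar>B x\<bar> \<le> M"
    by (auto simp: bounded_pos)
  show ?thesis
  proof
    show "0 < e / (C + 1)" "0 \<le> M * C" using e(1) M(1) C0 by auto
    fix x y :: real assume xy: "x \<in> {0..1}" "y \<in> {0..1}" "\<bar>x - y\<bar> < e / (C + 1)"
    have l: "cmod (p x - p y) \<le> C * \<bar>x - y\<bar>" using lipschitz_on_normD[OF p(1) xy(1,2)] by (simp only: real_norm_def)
    have "C * \<bar>x - y\<bar> \<le> (C + 1) * \<bar>x - y\<bar>" by (simp add: algebra_simps)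
    also have "\<dots> < e"
    proof -
      have "0 < C + 1" using C0 by linarith
      from pos_less_divide_eq[OF this] show ?thesis using xy(3) by (simp only: mult.commute)
    qed
    finally have "cmod (p y - p x) \<le> e" using l unfolding norm_minus_commute[of "p y"] by linarith
    then have near: "p x \<in> cball (p y) e" by (simp add: dist_norm)
    have sub: "cball (p y) e \<subseteq> P" "cball (p y) e \<subseteq> V" using xy(2) e(2) unfolding P_def by blast+
    have "cmod (\<Psi> (p x) - \<Psi> (p y)) \<le> M * cmod (p x - p y)"
    proof (rule differentiable_bound[of "cball (p y) e" \<Psi> \<Psi>'])
      show "(\<Psi> has_derivative \<Psi>' u) (at u within cball (p y) e)" if "u \<in> cball (p y) e" for u
        by (rule has_derivative_at_withinI[OF d\<Psi>]) (use that sub(2) in blast)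
      show "onorm (\<Psi>' u) \<le> M" if u: "u \<in> cball (p y) e" for u
      proof (rule onorm_le)
        fix h
        have "cmod (\<Psi>' u h) \<le> B u * cmod h" using u sub(2) by (intro bd) blast
        also have "\<dots> \<le> M * cmod h" using M(2)[of u] u sub(1) by (intro mult_right_mono) (blast intro: order_trans[OF abs_ge_self], simp)
        finally show "cmod (\<Psi>' u h) \<le> M * cmod h" .
      qed
      show "convex (cball (p y) e)" by (rule convex_cball)
      show "p x \<in> cball (p y) e" by (rule near)
      show "p y \<in> cball (p y) e" using e(1) by simp
    qed
    also have "\<dots> \<le> M * (C * \<bar>x - y\<bar>)" using l M(1) by (intro mult_left_mono) linarith+
    finally show "cmod (\<Psi> (p x) - \<Psi> (p y)) \<le> M * C * \<bar>x - y\<bar>" by (simp add: mult.assoc)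
  qed
qed

text \<open>
  \<open>D\<close> is a version of the derivative of \<open>p\<close> that is measurable and bounded everywhere, and correct
  outside \<open>N\<close>.
\<close>

locale lipschitz_curve =
  fixes p D :: "real \<Rightarrow> complex" and C :: real and N :: "real set"
  assumes lip: "C-lipschitz_on {0..1} p" and N: "negligible N"
    and D_meas: "D \<in> borel_measurable (lebesgue_on {0..1})" and D_le: "\<And>t. cmod (D t) \<le> C"
    and p_der: "\<And>t. t \<in> {0..1} - N \<Longrightarrow> (p has_vector_derivative D t) (at t within {0..1})"
begin

abbreviation M where "M \<equiv> lebesgue_on {0..1::real}"

lemma C_nonneg: "0 \<le> C"
  using lip by (rule lipschitz_on_nonneg)

lemma cont_p: "continuous_on {0..1} p"
  using lip by (rule lipschitz_on_continuous_on)

lemma measurable_cont: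
  "continuous_on {0..1} f \<Longrightarrow> f \<in> borel_measurable M" for f :: "real \<Rightarrow> complex"
  by (rule continuous_imp_measurable_on_sets_lebesgue) auto

lemma cnj_D_meas: "(\<lambda>t. cnj (D t)) \<in> borel_measurable M"
  using D_meas by (intro measurable_compose[OF D_meas] borel_measurable_continuous_onI continuous_intros)

lemma measurable_linear_in_D:
  assumes "continuous_on {0..1} u" "continuous_on {0..1} v"
  shows "(\<lambda>t. u t * cnj (D t) + v t * D t) \<in> borel_measurable M"
proof -
  have "u \<in> borel_measurable M" "v \<in> borel_measurable M" using assms by (auto intro: measurable_cont)
  then show ?thesis using D_meas cnj_D_meas by measurable
qed

lemma finite_M: "finite_measure M"
  by (rule finite_measure_lebesgue_on) auto

lemma integrable_M_bounded:
  fixes f :: "real \<Rightarrow> complex"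
  assumes "f \<in> borel_measurable M" "\<And>t. t \<in> {0..1} \<Longrightarrow> cmod (f t) \<le> K"
  shows "integrable M f"
  using assms by (intro finite_measure.integrable_const_bound[OF finite_M, of _ K] AE_I2) auto

lemma norm_linear_in_D:
  assumes "cmod x \<le> A" "cmod y \<le> B" "0 \<le> A" "0 \<le> B"
  shows "cmod (x * cnj (D t) + y * D t) \<le> (A + B) * C"
proof -
  have "cmod (x * cnj (D t) + y * D t) \<le> cmod x * cmod (D t) + cmod y * cmod (D t)"
    by (rule order_trans[OF norm_triangle_ineq]) (simp add: norm_mult)
  also have "\<dots> \<le> A * C + B * C"
    using assms D_le C_nonneg by (intro add_mono mult_mono) auto
  finally show ?thesis by (simp add: algebra_simps)
qed

lemma lipschitz_curve_diff_const: "lipschitz_curve (\<lambda>t. p t - z) D C N"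
  using lip N D_meas D_le p_der
  by unfold_locales (auto simp: lipschitz_on_def dist_norm has_vector_derivative_diff_const)

end

text \<open>
  The differential form \<open>(a(q) / cnj q) d(cnj q) + b(q) dq\<close> on a punctured neighbourhood of \<open>0\<close>. The
  functions \<open>a1\<close>, \<open>a2\<close> are the derivatives of \<open>a\<close> with respect to \<open>q\<close> and \<open>cnj q\<close>, similarly for \<open>b\<close>, and
  \<open>closed_form\<close> says that the form is closed on \<open>\<Omega>0\<close>. Splitting off the factor \<open>1 / cnj q\<close> leaves
  a function \<open>a\<close> with a limit at the singularity.
\<close>

locale punctured_form =
  fixes V \<Omega>0 :: "complex set" and a a1 a2 b b1 b2 :: "complex \<Rightarrow> complex" and a0 :: complex
  assumes open_V: "open V" and \<Omega>0: "\<Omega>0 \<subseteq> V"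
    and da: "\<And>q. q \<in> V - {0} \<Longrightarrow> (a has_derivative (\<lambda>h. h * a1 q + cnj h * a2 q)) (at q)"
    and db: "\<And>q. q \<in> V - {0} \<Longrightarrow> (b has_derivative (\<lambda>h. h * b1 q + cnj h * b2 q)) (at q)"
    and cont: "continuous_on (V - {0}) a1" "continuous_on (V - {0}) a2"
      "continuous_on (V - {0}) b1" "continuous_on (V - {0}) b2"
    and closed_form: "\<And>q. q \<in> \<Omega>0 - {0} \<Longrightarrow> a1 q = cnj q * b2 q"
    and a_lim: "(a \<longlongrightarrow> a0) (at 0)" and b_lim: "((\<lambda>q. q * b q) \<longlongrightarrow> 0) (at 0)"
begin

lemma cont_a: "continuous_on (V - {0}) a" and cont_b: "continuous_on (V - {0}) b"
  using da db by (auto intro!: continuous_at_imp_continuous_on has_derivative_continuous)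

end

text \<open>
  The dilates of the curve by \<open>s < 1\<close> stay where the form is closed; the curve itself may lie on the
  boundary of that region, but still where the coefficients are continuous.
\<close>

locale punctured_form_path = punctured_form V \<Omega>0 a a1 a2 b b1 b2 a0 + lipschitz_curve p D C N
  for V \<Omega>0 a a1 a2 b b1 b2 a0 p D C N +
  assumes p_nz: "\<And>t. t \<in> {0..1} \<Longrightarrow> p t \<noteq> 0"
    and p_V: "\<And>t. t \<in> {0..1} \<Longrightarrow> p t \<in> V"
    and p_star: "\<And>s t. 0 < s \<Longrightarrow> s < 1 \<Longrightarrow> t \<in> {0..1} \<Longrightarrow> of_real s * p t \<in> \<Omega>0"
begin

text \<open>
  The form pulled back to the curve \<open>s p\<close>. The dilation cancels in \<open>d(cnj q) / cnj q\<close>.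
\<close>

definition scaled_integrand :: "real \<Rightarrow> real \<Rightarrow> complex" where
  "scaled_integrand s t = a (s * p t) / cnj (p t) * cnj (D t) + s * b (s * p t) * D t"

definition scaled_integrand_deriv :: "real \<Rightarrow> real \<Rightarrow> complex" where
  "scaled_integrand_deriv s t = (p t * a1 (s * p t) + cnj (p t) * a2 (s * p t)) / cnj (p t) * cnj (D t)
     + (b (s * p t) + s * (p t * b1 (s * p t) + cnj (p t) * b2 (s * p t))) * D t"

lemma sp_V: "0 < s \<Longrightarrow> s \<le> 1 \<Longrightarrow> t \<in> {0..1} \<Longrightarrow> of_real s * p t \<in> V - {0}"
  using p_star[of s t] p_V[of t] p_nz[of t] \<Omega>0 by (cases "s = 1") auto

lemma cont_sp:
  assumes "continuous_on (V - {0}) f" "0 < s" "s \<le> 1"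
  shows "continuous_on {0..1} (\<lambda>t. f (of_real s * p t))"
  using sp_V assms(2,3)
  by (intro continuous_on_compose2[OF assms(1)] continuous_intros cont_p) auto

lemma cont_sp2:
  assumes "continuous_on (V - {0}) f" "S \<subseteq> {0<..1}"
  shows "continuous_on (S \<times> {0..1}) (\<lambda>x. f (of_real (fst x) * p (snd x)))"
  using sp_V assms(2)
  by (intro continuous_on_compose2[OF assms(1)] continuous_intros continuous_on_compose2[OF cont_p]) force+

lemma scaled_integrand_meas: "0 < s \<Longrightarrow> s \<le> 1 \<Longrightarrow> scaled_integrand s \<in> borel_measurable M"
  unfolding scaled_integrand_def using p_nz
  by (intro measurable_linear_in_D continuous_intros cont_sp cont_a cont_b cont_p) auto

lemma scaled_integrand_deriv_meas: "0 < s \<Longrightarrow> s \<le> 1 \<Longrightarrow> scaled_integrand_deriv s \<in> borel_measurable M"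
  unfolding scaled_integrand_deriv_def using p_nz
  by (intro measurable_linear_in_D continuous_intros cont_sp cont_a cont_b cont_p cont) auto

lemma linear_in_D_bounded:
  fixes x y :: "real \<times> real \<Rightarrow> complex"
  assumes "continuous_on ({l..1} \<times> {0..1}) x" "continuous_on ({l..1} \<times> {0..1}) y"
  obtains B where "\<And>s t. s \<in> {l..1} \<Longrightarrow> t \<in> {0..1} \<Longrightarrow> cmod (x (s, t) * cnj (D t) + y (s, t) * D t) \<le> B"
proof -
  have "bounded (f ` ({l..1} \<times> {0..1}))" if "continuous_on ({l..1} \<times> {0..1}) f" for f :: "real \<times> real \<Rightarrow> complex"
    by (intro compact_imp_bounded compact_continuous_image that compact_Times compact_Icc)
  from this[OF assms(1)] this[OF assms(2)] obtain A B
    where A: "0 < A" "\<And>z. z \<in> {l..1} \<times> {0..1} \<Longrightarrow> cmod (x z) \<le> A"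
      and B: "0 < B" "\<And>z. z \<in> {l..1} \<times> {0..1} \<Longrightarrow> cmod (y z) \<le> B"
    unfolding bounded_pos by blast
  show ?thesis
    by (rule that[of "(A + B) * C"], intro norm_linear_in_D A B less_imp_le) auto
qed

lemma cont_p_snd: "continuous_on ({l..1::real} \<times> {0..1}) (\<lambda>x. p (snd x))"
  by (intro continuous_on_compose2[OF cont_p] continuous_intros) auto

lemma scaled_integrand_bounded:
  assumes l: "0 < l"
  obtains B where "\<And>s t. s \<in> {l..1} \<Longrightarrow> t \<in> {0..1} \<Longrightarrow> cmod (scaled_integrand s t) \<le> B"
proof -
  have S: "{l..1} \<subseteq> {0<..1}" using l by auto
  show ?thesis
    by (rule linear_in_D_bounded[of l "\<lambda>x. a (of_real (fst x) * p (snd x)) / cnj (p (snd x))"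
          "\<lambda>x. of_real (fst x) * b (of_real (fst x) * p (snd x))"])
      (use that p_nz in \<open>auto simp: scaled_integrand_def intro!: continuous_intros cont_sp2[OF _ S] cont_a cont_b cont_p_snd\<close>)
qed

lemma scaled_integrand_deriv_bounded:
  assumes l: "0 < l"
  obtains B where "\<And>s t. s \<in> {l..1} \<Longrightarrow> t \<in> {0..1} \<Longrightarrow> cmod (scaled_integrand_deriv s t) \<le> B"
proof -
  have S: "{l..1} \<subseteq> {0<..1}" using l by auto
  let ?f = "\<lambda>f x. f (of_real (fst x) * p (snd x))"
  show ?thesis
    by (rule linear_in_D_bounded[of l "\<lambda>x. (p (snd x) * ?f a1 x + cnj (p (snd x)) * ?f a2 x) / cnj (p (snd x))"
          "\<lambda>x. ?f b x + of_real (fst x) * (p (snd x) * ?f b1 x + cnj (p (snd x)) * ?f b2 x)"])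
      (use that p_nz in \<open>auto simp: scaled_integrand_deriv_def intro!: continuous_intros cont_sp2[OF _ S] cont_b cont cont_p_snd\<close>)
qed

lemma scaled_integrand_has_vector_derivative:
  assumes s: "0 < s" "s \<le> 1" and t: "t \<in> {0..1}"
  shows "((\<lambda>s. scaled_integrand s t) has_vector_derivative scaled_integrand_deriv s t) (at s)"
proof -
  have dsp: "((\<lambda>s. of_real s * p t) has_vector_derivative p t) (at s)"
    using has_vector_derivative_mult_left[OF has_vector_derivative_of_real[OF DERIV_ident], where a="p t"] by simp
  have a': "((\<lambda>s. a (of_real s * p t)) has_vector_derivative p t * a1 (s * p t) + cnj (p t) * a2 (s * p t)) (at s)"
    using vector_derivative_diff_chain_within[OF dsp has_derivative_at_withinI[OF da[OF sp_V[OF s t]]]] by (simp add: comp_def)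
  have b': "((\<lambda>s. b (of_real s * p t)) has_vector_derivative p t * b1 (s * p t) + cnj (p t) * b2 (s * p t)) (at s)"
    using vector_derivative_diff_chain_within[OF dsp has_derivative_at_withinI[OF db[OF sp_V[OF s t]]]] by (simp add: comp_def)
  have sb: "((\<lambda>s. of_real s * b (of_real s * p t)) has_vector_derivative
     of_real s * (p t * b1 (s * p t) + cnj (p t) * b2 (s * p t)) + of_real 1 * b (s * p t)) (at s)"
    by (rule has_vector_derivative_mult[OF has_vector_derivative_of_real[OF DERIV_ident] b'])
  have hv: "((\<lambda>s. a (of_real s * p t) * (cnj (D t) / cnj (p t)) + of_real s * b (of_real s * p t) * D t) has_vector_derivative
     (p t * a1 (s * p t) + cnj (p t) * a2 (s * p t)) * (cnj (D t) / cnj (p t))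
     + (of_real s * (p t * b1 (s * p t) + cnj (p t) * b2 (s * p t)) + of_real 1 * b (s * p t)) * D t) (at s)"
    by (intro has_vector_derivative_add has_vector_derivative_mult_left a' sb)
  have e1: "(p t * a1 (s * p t) + cnj (p t) * a2 (s * p t)) * (cnj (D t) / cnj (p t))
     + (of_real s * (p t * b1 (s * p t) + cnj (p t) * b2 (s * p t)) + of_real 1 * b (s * p t)) * D t = scaled_integrand_deriv s t"
    by (simp add: scaled_integrand_deriv_def add.commute)
  have e2: "(\<lambda>s. a (of_real s * p t) * (cnj (D t) / cnj (p t)) + of_real s * b (of_real s * p t) * D t) = (\<lambda>s. scaled_integrand s t)"
    by (simp add: scaled_integrand_def fun_eq_iff)
  from hv show ?thesis unfolding e1 e2 .
qed

text \<open>
  The value of the form on the tangent vector \<open>q\<close> of the dilation, at the point \<open>s q\<close>.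
\<close>

definition primitive :: "real \<Rightarrow> complex \<Rightarrow> complex" where
  "primitive s q = a (s * q) / s + b (s * q) * q"

text \<open>
  For a closed form, the derivative in \<open>s\<close> of its pull-back to the curve \<open>s p\<close> is the derivative in
  \<open>t\<close> of its value on the dilation field. So the integral over the curve is a boundary term.
\<close>

lemma scaled_integrand_deriv_has_integral:
  assumes s: "0 < s" "s < 1"
  shows "(scaled_integrand_deriv s has_integral (primitive s (p 1) - primitive s (p 0))) {0..1}"
proof -
  define W where "W = {q :: complex. of_real s * q \<in> V - {0}}"
  have W: "open W"
    unfolding W_def using open_V
    by (intro open_vimage[of "V - {0}" "\<lambda>q. of_real s * q", unfolded vimage_def]) (auto intro!: continuous_intros)
  define primitive' where "primitive' q h = h * a1 (s * q) + cnj h * a2 (s * q) + ((s * h * b1 (s * q) + s * cnj h * b2 (s * q)) * q + b (s * q) * h)" for q h :: complex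
  have dw: "(primitive s has_derivative primitive' q) (at q)" if "q \<in> W" for q
  proof -
    have q: "of_real s * q \<in> V - {0}" using that by (simp add: W_def)
    have m: "((\<lambda>q. complex_of_real s * q) has_derivative (\<lambda>h. complex_of_real s * h)) (at q)"
      by (auto intro!: derivative_eq_intros)
    have 1: "((\<lambda>q. a (of_real s * q)) has_derivative (\<lambda>h. s * h * a1 (s * q) + s * cnj h * a2 (s * q))) (at q)"
      using has_derivative_compose[OF m da[OF q]] by simp
    have 2: "((\<lambda>q. b (of_real s * q)) has_derivative (\<lambda>h. s * h * b1 (s * q) + s * cnj h * b2 (s * q))) (at q)"
      using has_derivative_compose[OF m db[OF q]] by simp
    have "((\<lambda>q. a (of_real s * q) * (1 / s) + b (of_real s * q) * q) has_derivative
       (\<lambda>h. (s * h * a1 (s * q) + s * cnj h * a2 (s * q)) * (1 / s)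
          + (b (of_real s * q) * h + (s * h * b1 (s * q) + s * cnj h * b2 (s * q)) * q))) (at q)"
      by (intro has_derivative_add has_derivative_mult_left 1 has_derivative_mult[OF 2] has_derivative_ident)
    then show ?thesis
      using s(1) by (simp add: primitive_def[abs_def] primitive'_def[abs_def] algebra_simps)
  qed
  define B where "B q = cmod (a1 (s * q)) + cmod (a2 (s * q)) + ((s * cmod (b1 (s * q)) + s * cmod (b2 (s * q))) * cmod q + cmod (b (s * q)))" for q :: complex
  have B: "continuous_on W B"
    unfolding B_def
    by (intro continuous_intros continuous_on_compose2[OF cont_b] continuous_on_compose2[OF cont(1)]
        continuous_on_compose2[OF cont(2)] continuous_on_compose2[OF cont(3)] continuous_on_compose2[OF cont(4)])
      (auto simp: W_def)
  have bd: "cmod (primitive' q h) \<le> B q * cmod h" for q h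
  proof -
    have "cmod (primitive' q h) \<le> (cmod (h * a1 (s * q)) + cmod (cnj h * a2 (s * q))) + ((cmod (s * h * b1 (s * q)) + cmod (s * cnj h * b2 (s * q))) * cmod q + cmod (b (s * q) * h))"
      unfolding primitive'_def
      by (intro order_trans[OF norm_triangle_ineq] add_mono order_refl norm_triangle_ineq)
         (subst norm_mult, intro mult_right_mono norm_triangle_ineq norm_ge_zero)
    also have "\<dots> = B q * cmod h"
      using s by (simp add: B_def norm_mult algebra_simps)
    finally show ?thesis .
  qed
  have pW: "p ` {0..1} \<subseteq> W" using sp_V[of s] s by (auto simp: W_def)
  obtain \<delta> K where \<delta>: "0 < \<delta>" "0 \<le> K"
    "\<And>x y. x \<in> {0..1} \<Longrightarrow> y \<in> {0..1} \<Longrightarrow> \<bar>x - y\<bar> < \<delta> \<Longrightarrow> cmod (primitive s (p x) - primitive s (p y)) \<le> K * \<bar>x - y\<bar>"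
    using continuous_derivative_imp_Lipschitz_along_path[OF W lip pW dw bd B] by blast
  have "(scaled_integrand_deriv s has_integral (\<lambda>t. primitive s (p t)) 1 - (\<lambda>t. primitive s (p t)) 0) {0..1}"
  proof (rule FTC_locally_Lipschitz[OF _ \<delta> N])
    have "continuous_on W (primitive s)"
      using dw by (auto intro!: continuous_at_imp_continuous_on has_derivative_continuous)
    then show "continuous_on {0..1} (\<lambda>t. primitive s (p t))"
      using pW by (intro continuous_on_compose2[OF _ cont_p])
    fix t assume t: "t \<in> {0..1} - N"
    have "((\<lambda>t. primitive s (p t)) has_vector_derivative primitive' (p t) (D t)) (at t within {0..1})"
    proof -
      have "p t \<in> W" using pW t by blast
      from vector_derivative_diff_chain_within[OF p_der[OF t] has_derivative_at_withinI[OF dw[OF this]]]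
      show ?thesis by (simp add: comp_def)
    qed
    moreover have "primitive' (p t) (D t) = scaled_integrand_deriv s t"
    proof -
      have st: "of_real s * p t \<in> \<Omega>0 - {0}" using p_star[of s t] p_nz[of t] s t by auto
      have nz: "p t \<noteq> 0" using p_nz t by auto
      \<comment> \<open>The two derivatives differ by a multiple of the failure of closedness.\<close>
      have "scaled_integrand_deriv s t - primitive' (p t) (D t) = (p t / cnj (p t) * cnj (D t) - D t) * (a1 (s * p t) - s * cnj (p t) * b2 (s * p t))"
        unfolding scaled_integrand_deriv_def primitive'_def using nz by (simp add: field_simps)
      also have "a1 (s * p t) - s * cnj (p t) * b2 (s * p t) = 0"
        using closed_form[OF st] by simp
      finally show ?thesis by simp
    qed
    ultimately show "((\<lambda>t. primitive s (p t)) has_vector_derivative scaled_integrand_deriv s t) (at t within {0..1})" by simp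
  qed
  then show ?thesis by simp
qed

lemma integral_scaled_integrand_has_vector_derivative:
  assumes s: "0 < s" "s < 1"
  shows "((\<lambda>s. \<integral>t. scaled_integrand s t \<partial>M) has_vector_derivative primitive s (p 1) - primitive s (p 0)) (at s)"
proof -
  obtain B where B: "\<And>s' t. s' \<in> {s / 2..1} \<Longrightarrow> t \<in> {0..1} \<Longrightarrow> cmod (scaled_integrand_deriv s' t) \<le> B"
    using scaled_integrand_deriv_bounded[of "s / 2"] s by auto
  obtain K where K: "\<And>s' t. s' \<in> {s / 2..1} \<Longrightarrow> t \<in> {0..1} \<Longrightarrow> cmod (scaled_integrand s' t) \<le> K"
    using scaled_integrand_bounded[of "s / 2"] s by auto
  have "((\<lambda>s. \<integral>t. scaled_integrand s t \<partial>M) has_derivative (\<lambda>h. \<integral>t. h *\<^sub>R scaled_integrand_deriv s t \<partial>M)) (at s)"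
  proof (rule has_derivative_lebesgue_integral[where S="{s/2<..<1}" and B="\<lambda>_. B" and F'="\<lambda>s t h. h *\<^sub>R scaled_integrand_deriv s t"])
    show "integrable M (scaled_integrand x)" if "x \<in> {s/2<..<1}" for x
      using that s K by (intro integrable_M_bounded[where K=K] scaled_integrand_meas) auto
    show "((\<lambda>x. scaled_integrand x t) has_derivative (\<lambda>h. h *\<^sub>R scaled_integrand_deriv x t)) (at x)" if "x \<in> {s/2<..<1}" "t \<in> space M" for x t
      using scaled_integrand_has_vector_derivative[of x t] that s by (auto simp: has_vector_derivative_def)
    show "norm (h *\<^sub>R scaled_integrand_deriv x t) \<le> B * norm h" if "x \<in> {s/2<..<1}" "t \<in> space M" for x t h
      using mult_right_mono[OF B[of x t], of "norm h"] that by (simp add: mult.commute)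
    show "integrable M (\<lambda>_. B)" by (simp add: finite_measure.integrable_const[OF finite_M])
    show "(\<lambda>t. h *\<^sub>R scaled_integrand_deriv s t) \<in> borel_measurable M" for h
      using scaled_integrand_deriv_meas[of s] s by (intro borel_measurable_scaleR) auto
  qed (use s in auto)
  moreover have "integrable M (scaled_integrand_deriv s)"
    using s B by (intro integrable_M_bounded[where K=B] scaled_integrand_deriv_meas) auto
  then have "(\<integral>t. scaled_integrand_deriv s t \<partial>M) = primitive s (p 1) - primitive s (p 0)"
    by (subst lebesgue_integral_eq_integral) (auto intro: integral_unique scaled_integrand_deriv_has_integral s)
  ultimately show ?thesis by (simp add: has_vector_derivative_def)
qed

lemma integral_scaled_integrand_LIMSEQ_1:
  "(\<lambda>n. \<integral>t. scaled_integrand (1 - 1 / (real n + 2)) t \<partial>M) \<longlonglongrightarrow> (\<integral>t. scaled_integrand 1 t \<partial>M)"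
proof -
  define S where "S n = 1 - 1 / (real n + 2)" for n
  have S: "S n \<in> {1/2..1}" "0 < S n" "S n \<le> 1" for n by (auto simp: S_def field_simps)
  have S1: "S \<longlonglongrightarrow> 1" unfolding S_def by real_asymp
  obtain K where K: "\<And>s' t. s' \<in> {1 / 2..1} \<Longrightarrow> t \<in> {0..1} \<Longrightarrow> cmod (scaled_integrand s' t) \<le> K"
    using scaled_integrand_bounded[of "1 / 2"] by auto
  have "(\<lambda>n. \<integral>t. scaled_integrand (S n) t \<partial>M) \<longlonglongrightarrow> (\<integral>t. scaled_integrand 1 t \<partial>M)"
  proof (rule integral_dominated_convergence[where w="\<lambda>_. K"])
    show "scaled_integrand 1 \<in> borel_measurable M" "scaled_integrand (S n) \<in> borel_measurable M" for n
      using S by (auto intro!: scaled_integrand_meas)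
    show "integrable M (\<lambda>_. K)" by (simp add: finite_measure.integrable_const[OF finite_M])
    show "AE t in M. cmod (scaled_integrand (S n) t) \<le> K" for n using K S by auto
    show "AE t in M. (\<lambda>n. scaled_integrand (S n) t) \<longlonglongrightarrow> scaled_integrand 1 t"
    proof (rule AE_I2)
      fix t assume "t \<in> space M"
      then have "continuous (at 1) (\<lambda>s. scaled_integrand s t)"
        using scaled_integrand_has_vector_derivative[of 1 t] by (auto intro: has_vector_derivative_continuous)
      then show "(\<lambda>n. scaled_integrand (S n) t) \<longlonglongrightarrow> scaled_integrand 1 t"
        using S1 by (auto simp: continuous_within_tendsto_compose' isCont_def intro: isCont_tendsto_compose)
    qed
  qed
  then show ?thesis by (simp add: S_def)
qed

text \<open>
  On the whole curve \<open>a(s p)\<close> tends to \<open>a0\<close> and \<open>s b(s p)\<close> to \<open>0\<close>, and both are bounded once \<open>s p\<close> is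
  close to \<open>0\<close>.
\<close>

lemma integral_scaled_integrand_LIMSEQ_0:
  "(\<lambda>n. \<integral>t. scaled_integrand (1 / (real n + 2)) t \<partial>M) \<longlonglongrightarrow> (\<integral>t. a0 / cnj (p t) * cnj (D t) \<partial>M)"
proof -
  have "compact (p ` {0..1})" by (intro compact_continuous_image cont_p) auto
  then obtain P where P: "0 < P" "\<And>t. t \<in> {0..1} \<Longrightarrow> cmod (p t) \<le> P"
    using compact_imp_bounded by (force simp: bounded_pos)
  have "bounded ((\<lambda>t. 1 / p t) ` {0..1})"
    using p_nz by (intro compact_imp_bounded compact_continuous_image continuous_intros cont_p) auto
  then obtain Q where Q: "0 < Q" "\<And>t. t \<in> {0..1} \<Longrightarrow> cmod (1 / p t) \<le> Q"
    by (auto simp: bounded_pos)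
  have "eventually (\<lambda>q. dist (a q) a0 < 1) (at 0)" using a_lim by (rule tendstoD) simp
  moreover have "eventually (\<lambda>q. dist (q * b q) 0 < 1) (at 0)" using b_lim by (rule tendstoD) simp
  ultimately have "eventually (\<lambda>q. dist (a q) a0 < 1 \<and> dist (q * b q) 0 < 1) (at 0)" by (rule eventually_conj)
  then obtain d where d: "0 < d" "\<And>q. q \<noteq> 0 \<Longrightarrow> cmod q < d \<Longrightarrow> dist (a q) a0 < 1 \<and> cmod (q * b q) < 1"
    unfolding eventually_at by auto
  \<comment> \<open>Beyond \<open>m\<close> the dilated curves lie in the disc of radius \<open>d\<close>.\<close>
  obtain m where m: "P / d < real m" using reals_Archimedean2 by blast
  define S where "S n = 1 / (real (n + m) + 2)" for n
  have S: "0 < S n" "S n \<le> 1" "S n < 1" for n by (auto simp: S_def field_simps)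
  have S0: "S \<longlonglongrightarrow> 0" unfolding S_def by real_asymp
  have Sd: "S n * P < d" for n
  proof -
    have "P < real m * d" using m d(1) by (simp add: field_simps)
    also have "\<dots> \<le> (real (n + m) + 2) * d" using d(1) by (intro mult_right_mono) auto
    finally show ?thesis by (simp add: S_def divide_less_eq mult.commute)
  qed
  have small: "dist (a (S n * p t)) a0 < 1" "cmod (S n * b (S n * p t)) \<le> Q" if t: "t \<in> {0..1}" for n t
  proof -
    have "cmod (S n * p t) \<le> S n * P" using S(1)[of n] P(2)[OF t] by (simp add: norm_mult)
    then have "cmod (S n * p t) < d" using Sd[of n] by simp
    with d(2)[of "S n * p t"] p_nz[OF t] S(1)[of n]
    have *: "dist (a (S n * p t)) a0 < 1" "cmod (S n * p t * b (S n * p t)) < 1" by auto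
    show "dist (a (S n * p t)) a0 < 1" by fact
    have "S n * b (S n * p t) = (S n * p t * b (S n * p t)) * (1 / p t)" using p_nz[OF t] by simp
    also have "cmod \<dots> \<le> 1 * Q" unfolding norm_mult[of _ "1 / p t"] using * Q(2)[OF t] by (intro mult_mono) auto
    finally show "cmod (S n * b (S n * p t)) \<le> Q" by simp
  qed
  have "(\<lambda>n. \<integral>t. scaled_integrand (S n) t \<partial>M) \<longlonglongrightarrow> (\<integral>t. a0 / cnj (p t) * cnj (D t) \<partial>M)"
  proof (rule integral_dominated_convergence[where w="\<lambda>_. ((cmod a0 + 1) * Q + Q) * C"])
    show "scaled_integrand (S n) \<in> borel_measurable M" for n
      using S by (auto intro!: scaled_integrand_meas)
    show "(\<lambda>t. a0 / cnj (p t) * cnj (D t)) \<in> borel_measurable M"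
      using p_nz by (intro borel_measurable_times cnj_D_meas measurable_cont continuous_intros cont_p) auto
    show "integrable M (\<lambda>_. ((cmod a0 + 1) * Q + Q) * C)" by (simp add: finite_measure.integrable_const[OF finite_M])
    show "AE t in M. cmod (scaled_integrand (S n) t) \<le> ((cmod a0 + 1) * Q + Q) * C" for n
    proof (rule AE_I2)
      fix t assume "t \<in> space M"
      then have t: "t \<in> {0..1}" by simp
      have "cmod (a (S n * p t)) \<le> cmod a0 + 1"
        using small(1)[OF t, of n] norm_triangle_sub[of "a (S n * p t)" a0] by (simp add: dist_norm)
      then have "cmod (a (S n * p t)) * cmod (1 / p t) \<le> (cmod a0 + 1) * Q"
        using Q(2)[OF t] by (intro mult_mono) auto
      then have "cmod (a (S n * p t) / cnj (p t)) \<le> (cmod a0 + 1) * Q"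
        by (simp add: norm_divide)
      then show "cmod (scaled_integrand (S n) t) \<le> ((cmod a0 + 1) * Q + Q) * C"
        unfolding scaled_integrand_def using small(2)[OF t, of n] Q(1) by (intro norm_linear_in_D) auto
    qed
    show "AE t in M. (\<lambda>n. scaled_integrand (S n) t) \<longlonglongrightarrow> a0 / cnj (p t) * cnj (D t)"
    proof (rule AE_I2)
      fix t assume "t \<in> space M"
      then have t: "t \<in> {0..1}" by simp
      have f: "filterlim (\<lambda>n. of_real (S n) * p t) (at 0) sequentially"
        unfolding filterlim_at using S p_nz[OF t] tendsto_mult[OF tendsto_of_real[OF S0] tendsto_const[of "p t"]]
        by (auto intro!: always_eventually simp: less_imp_neq[THEN not_sym])
      have 1: "(\<lambda>n. a (S n * p t)) \<longlonglongrightarrow> a0" using filterlim_compose[OF a_lim f] .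
      have 2: "(\<lambda>n. (S n * p t) * b (S n * p t)) \<longlonglongrightarrow> 0" using filterlim_compose[OF b_lim f] .
      have "(\<lambda>n. a (S n * p t) / cnj (p t) * cnj (D t) + (S n * p t) * b (S n * p t) * (D t / p t)) \<longlonglongrightarrow> a0 / cnj (p t) * cnj (D t) + 0 * (D t / p t)"
        using p_nz[OF t] by (intro tendsto_intros 1 2) auto
      moreover have "(S n * p t) * b (S n * p t) * (D t / p t) = S n * b (S n * p t) * D t" for n
        using p_nz[OF t] by simp
      ultimately show "(\<lambda>n. scaled_integrand (S n) t) \<longlonglongrightarrow> a0 / cnj (p t) * cnj (D t)"
        unfolding scaled_integrand_def by simp
    qed
  qed
  then have "(\<lambda>n. \<integral>t. scaled_integrand (1 / (real (n + m) + 2)) t \<partial>M) \<longlonglongrightarrow> (\<integral>t. a0 / cnj (p t) * cnj (D t) \<partial>M)"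
    by (simp only: S_def)
  then show ?thesis by (rule LIMSEQ_offset)
qed

lemma limit_integral_eq_winding_number:
  "(\<integral>t. a0 / cnj (p t) * cnj (D t) \<partial>M) = - (2 * pi * \<i> * a0 * cnj (winding_number p 0))"
proof -
  have z: "0 \<notin> path_image p" using p_nz by (auto simp: path_image_def)
  have "((\<lambda>t. D t / (p t - 0)) has_integral 2 * pi * \<i> * winding_number p 0) {0..1}"
    by (rule winding_number_lipschitz_path[OF lip z N p_der])
  from has_integral_linear[OF this bounded_linear_cnj]
  have "((\<lambda>t. cnj (D t / p t)) has_integral cnj (2 * pi * \<i> * winding_number p 0)) {0..1}"
    by (simp add: comp_def)
  from has_integral_mult_right[OF this, of a0]
  have hi: "((\<lambda>t. a0 / cnj (p t) * cnj (D t)) has_integral - (2 * pi * \<i> * a0 * cnj (winding_number p 0))) {0..1}"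
    by (simp add: mult_ac)
  have "bounded ((\<lambda>t. a0 / cnj (p t)) ` {0..1})"
    using p_nz by (intro compact_imp_bounded compact_continuous_image continuous_intros cont_p) auto
  then obtain Q where Q: "0 < Q" "\<And>t. t \<in> {0..1} \<Longrightarrow> cmod (a0 / cnj (p t)) \<le> Q"
    by (auto simp: bounded_pos)
  have "integrable M (\<lambda>t. a0 / cnj (p t) * cnj (D t))"
  proof (rule integrable_M_bounded[where K="Q * C"])
    show "(\<lambda>t. a0 / cnj (p t) * cnj (D t)) \<in> borel_measurable M"
      using p_nz by (intro borel_measurable_times cnj_D_meas measurable_cont continuous_intros cont_p) auto
    show "cmod (a0 / cnj (p t) * cnj (D t)) \<le> Q * C" if "t \<in> {0..1}" for t
      unfolding norm_mult using Q(1) Q(2)[OF that] D_le[of t] by (intro mult_mono) auto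
  qed
  then show ?thesis using integral_unique[OF hi] by (simp add: lebesgue_integral_eq_integral)
qed

end

text \<open>
  Let \<open>Y s\<close> be the integral of the form over the chain dilated by \<open>s\<close>. Its derivative is a sum of
  boundary terms that telescopes around the closed chain, so \<open>Y\<close> is constant on \<open>(0, 1)\<close>. The limit at
  \<open>1\<close> is the integral over the chain; the limit at \<open>0\<close> is \<open>a0\<close> times the conjugate of a logarithmic
  integral, known from the winding number.
\<close>

theorem closed_form_integral_chain:
  assumes path: "\<And>j. j \<in> {1..4::nat} \<Longrightarrow> punctured_form_path V \<Omega>0 a a1 a2 b b1 b2 a0 (p j) (D j) (C j) (N j)"
    and chain: "\<And>j. j \<in> {1..4} \<Longrightarrow> p j 1 = p (j mod 4 + 1) 0"
    and winding: "(\<Sum>j=1..4. winding_number (p j) 0) = 1"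
  shows "(\<Sum>j=1..4. \<integral>t. a (p j t) / cnj (p j t) * cnj (D j t) + b (p j t) * D j t \<partial>lebesgue_on {0..1})
     = - (2 * pi * \<i> * a0)"
proof -
  define K where "K j s t = a (of_real s * p j t) / cnj (p j t) * cnj (D j t) + of_real s * b (of_real s * p j t) * D j t" for j and s :: real and t
  have K: "punctured_form_path.scaled_integrand a b (p j) (D j) s t = K j s t" if "j \<in> {1..4}" for j s t
    using punctured_form_path.scaled_integrand_def[OF path[OF that]] by (simp add: K_def)
  define Y where "Y s = (\<Sum>j=1..4. \<integral>t. K j s t \<partial>lebesgue_on {0..1})" for s
  define primitive where "primitive s q = a (of_real s * q) / of_real s + b (of_real s * q) * q" for s :: real and q
  have dY: "(Y has_vector_derivative 0) (at s within {0<..<1})" if s: "s \<in> {0<..<1}" for s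
  proof -
    have "((\<lambda>s. \<integral>t. K j s t \<partial>lebesgue_on {0..1}) has_vector_derivative primitive s (p j 1) - primitive s (p j 0)) (at s)"
      if j: "j \<in> {1..4}" for j
      using punctured_form_path.integral_scaled_integrand_has_vector_derivative[OF path[OF j], of s] s
      by (simp add: K[OF j] punctured_form_path.primitive_def[OF path[OF j]] primitive_def)
    then have "(Y has_vector_derivative (\<Sum>j=1..4. primitive s (p j 1) - primitive s (p j 0))) (at s)"
      unfolding Y_def by (intro has_vector_derivative_sum) auto
    also have "(\<Sum>j=1..4. primitive s (p j 1) - primitive s (p j 0)) = (\<Sum>j=1..4. primitive s (p (j mod 4 + 1) 0) - primitive s (p j 0))"
      using chain by (intro sum.cong) auto
    also have "\<dots> = 0"
    proof -
      define m where "m j = j mod 4 + 1" for j :: nat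
      have m: "m 1 = 2" "m 2 = 3" "m 3 = 4" "m 4 = 1" by (simp_all add: m_def)
      have "{1..4::nat} = {1, 2, 3, 4}" by auto
      then show ?thesis unfolding m_def[symmetric] by (simp add: m m(1)[unfolded One_nat_def])
    qed
    finally show ?thesis by (rule has_vector_derivative_at_within)
  qed
  have "\<exists>c. \<forall>s\<in>{0<..<1}. Y s = c"
  proof (rule has_vector_derivative_zero_constant[of "{0<..<1}" Y])
    show "convex {0<..<1::real}" by simp
    show "(Y has_vector_derivative 0) (at s within {0<..<1})" if "s \<in> {0<..<1}" for s
      using that by (rule dY)
    fix c assume "\<And>s. s \<in> {0<..<1} \<Longrightarrow> Y s = c"
    then show ?thesis by blast
  qed
  then obtain c where c: "\<And>s. s \<in> {0<..<1} \<Longrightarrow> Y s = c" by blast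
  have "(\<lambda>n. Y (1 - 1 / (real n + 2))) \<longlonglongrightarrow> Y 1"
    unfolding Y_def
    by (intro tendsto_sum, use punctured_form_path.integral_scaled_integrand_LIMSEQ_1[OF path] in \<open>simp add: K\<close>)
  moreover have "(\<lambda>n. Y (1 - 1 / (real n + 2))) = (\<lambda>n. c)"
    by (rule ext, rule c) (auto simp: field_simps)
  ultimately have Y1: "Y 1 = c" by (simp add: LIMSEQ_const_iff)
  have "(\<lambda>n. Y (1 / (real n + 2))) \<longlonglongrightarrow> (\<Sum>j=1..4. - (2 * pi * \<i> * a0 * cnj (winding_number (p j) 0)))"
    unfolding Y_def
    by (intro tendsto_sum, use punctured_form_path.integral_scaled_integrand_LIMSEQ_0[OF path] punctured_form_path.limit_integral_eq_winding_number[OF path] in \<open>simp add: K\<close>)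
  moreover have "(\<lambda>n. Y (1 / (real n + 2))) = (\<lambda>n. c)"
    by (rule ext, rule c) (auto simp: field_simps)
  ultimately have "c = (\<Sum>j=1..4. - (2 * pi * \<i> * a0 * cnj (winding_number (p j) 0)))" by (simp add: LIMSEQ_const_iff)
  also have "\<dots> = - (2 * pi * \<i> * a0 * cnj (\<Sum>j=1..4. winding_number (p j) 0))"
    by (simp add: sum_distrib_left sum_negf)
  also have "\<dots> = - (2 * pi * \<i> * a0)"
    by (simp only: winding complex_cnj_one mult_1_right)
  finally have "Y 1 = - (2 * pi * \<i> * a0)" using Y1 by simp
  then show ?thesis by (simp add: Y_def K_def)
qed

section \<open>Real differentiability and Wirtinger derivatives\<close>

lemma real_C1_directional:
  assumes "real_C1_on f U" "\<zeta> \<in> U" "u \<in> {1, \<i>}"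
  shows "((\<lambda>s::real. f (\<zeta> + s *\<^sub>R u)) has_vector_derivative dir_deriv u f \<zeta>) (at 0)"
  using assms unfolding real_C1_on_def dir_deriv_def by (auto simp: vector_derivative_works)

lemma real_C1_continuous_dir_deriv:
  "real_C1_on f U \<Longrightarrow> continuous_on U (dir_deriv 1 f)" "real_C1_on f U \<Longrightarrow> continuous_on U (dir_deriv \<i> f)"
  unfolding real_C1_on_def by auto

lemma directional_derivative_shift:
  fixes f :: "complex \<Rightarrow> complex" and t :: real
  assumes "((\<lambda>s::real. f ((\<eta> + t *\<^sub>R u) + s *\<^sub>R u)) has_vector_derivative d) (at 0)"
  shows "((\<lambda>s::real. f (\<eta> + s *\<^sub>R u)) has_vector_derivative d) (at t)"
proof -
  have 1: "((\<lambda>s. s - t) has_vector_derivative 1) (at t)"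
    by (auto intro!: derivative_eq_intros simp: has_real_derivative_iff_has_vector_derivative[symmetric])
  have "((\<lambda>s::real. f ((\<eta> + t *\<^sub>R u) + s *\<^sub>R u)) \<circ> (\<lambda>s. s - t) has_vector_derivative 1 *\<^sub>R d) (at t)"
    by (rule vector_diff_chain_at[OF 1]) (use assms in simp)
  moreover have "(\<lambda>s::real. f ((\<eta> + t *\<^sub>R u) + s *\<^sub>R u)) \<circ> (\<lambda>s. s - t) = (\<lambda>s. f (\<eta> + s *\<^sub>R u))"
    by (simp add: fun_eq_iff algebra_simps)
  ultimately show ?thesis by simp
qed

text \<open>
  Continuous partial derivatives imply differentiability; the classical statement on a product of two
  intervals is transported along the identification of the plane with pairs of reals.
\<close>

theorem real_C1_has_derivative:
  assumes U: "open U" and f: "real_C1_on f U" and \<zeta>: "\<zeta> \<in> U"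
  shows "(f has_derivative (\<lambda>h. of_real (Re h) * dir_deriv 1 f \<zeta> + of_real (Im h) * dir_deriv \<i> f \<zeta>)) (at \<zeta>)"
proof -
  obtain e where e: "0 < e" "ball \<zeta> e \<subseteq> U" using U \<zeta> open_contains_ball by blast
  define X where "X = ball (Re \<zeta>) (e / 2)"
  define Y where "Y = ball (Im \<zeta>) (e / 2)"
  have XY: "Complex x y \<in> U" if "x \<in> X" "y \<in> Y" for x y
  proof -
    have "cmod (Complex x y - \<zeta>) \<le> \<bar>Re (Complex x y - \<zeta>)\<bar> + \<bar>Im (Complex x y - \<zeta>)\<bar>" by (rule cmod_le)
    also have "\<dots> < e" using that by (simp add: X_def Y_def dist_real_def abs_minus_commute)
    finally show ?thesis using e(2) by (auto simp: dist_norm norm_minus_commute)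
  qed
  define F where "F x y = f (Complex x y)" for x y
  define fy where "fy x y = blinfun_scaleR_left (dir_deriv \<i> f (Complex x y))" for x y
  have m: "Re \<zeta> \<in> X" "Im \<zeta> \<in> Y" using e by (auto simp: X_def Y_def)
  have "((\<lambda>(x, y). F x y) has_derivative (\<lambda>(tx, ty). tx *\<^sub>R dir_deriv 1 f \<zeta> + blinfun_apply (fy (Re \<zeta>) (Im \<zeta>)) ty)) (at (Re \<zeta>, Im \<zeta>) within X \<times> Y)"
  proof (rule has_derivative_partialsI)
    have "((\<lambda>s::real. f (Complex 0 (Im \<zeta>) + s *\<^sub>R 1)) has_vector_derivative dir_deriv 1 f \<zeta>) (at (Re \<zeta>))"
    proof (rule directional_derivative_shift)
      have "Complex 0 (Im \<zeta>) + Re \<zeta> *\<^sub>R 1 = \<zeta>" by (simp add: complex_eq_iff)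
      then show "((\<lambda>s::real. f ((Complex 0 (Im \<zeta>) + Re \<zeta> *\<^sub>R 1) + s *\<^sub>R 1)) has_vector_derivative dir_deriv 1 f \<zeta>) (at 0)"
        using real_C1_directional[OF f \<zeta>, of 1] by simp
    qed
    moreover have "Complex 0 (Im \<zeta>) + s *\<^sub>R 1 = Complex s (Im \<zeta>)" for s by (simp add: complex_eq_iff)
    ultimately have "((\<lambda>x. F x (Im \<zeta>)) has_vector_derivative dir_deriv 1 f \<zeta>) (at (Re \<zeta>))"
      by (simp add: F_def)
    then show "((\<lambda>x. F x (Im \<zeta>)) has_derivative (\<lambda>tx. tx *\<^sub>R dir_deriv 1 f \<zeta>)) (at (Re \<zeta>) within X)"
      unfolding has_vector_derivative_def by (rule has_derivative_at_withinI)
  next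
    fix x y assume xy: "x \<in> X" "y \<in> Y"
    have "Complex x 0 + s *\<^sub>R \<i> = Complex x s" for s by (simp add: complex_eq_iff)
    then have "((\<lambda>y. F x y) has_vector_derivative dir_deriv \<i> f (Complex x y)) (at y)"
      using real_C1_directional[OF f XY[OF xy], of \<i>] directional_derivative_shift[of f "Complex x 0" y \<i>]
      by (simp add: F_def)
    then show "((\<lambda>y. F x y) has_derivative blinfun_apply (fy x y)) (at y within Y)"
      unfolding has_vector_derivative_def fy_def by (simp add: has_derivative_at_withinI)
  next
    have "continuous_on (X \<times> Y) (\<lambda>p. dir_deriv \<i> f (Complex (fst p) (snd p)))"
      by (rule continuous_on_compose2[OF real_C1_continuous_dir_deriv(2)[OF f]])
        (use XY in \<open>auto intro!: continuous_intros\<close>)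
    then have "continuous_on (X \<times> Y) (\<lambda>p. fy (fst p) (snd p))"
      unfolding fy_def by (rule bounded_linear.continuous_on[OF bounded_linear_blinfun_scaleR_left])
    then show "continuous (at (Re \<zeta>, Im \<zeta>) within X \<times> Y) (\<lambda>(x, y). fy x y)"
      using m unfolding continuous_on_eq_continuous_within case_prod_beta' by blast
  qed (use m in \<open>auto simp: Y_def\<close>)
  then have 1: "((\<lambda>(x, y). F x y) has_derivative (\<lambda>(tx, ty). tx *\<^sub>R dir_deriv 1 f \<zeta> + ty *\<^sub>R dir_deriv \<i> f \<zeta>)) (at (Re \<zeta>, Im \<zeta>))"
    using m at_within_open[of "(Re \<zeta>, Im \<zeta>)" "X \<times> Y"] by (auto simp: fy_def X_def Y_def open_Times)
  have 2: "((\<lambda>z. (Re z, Im z)) has_derivative (\<lambda>h. (Re h, Im h))) (at \<zeta>)"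
    by (auto intro!: derivative_eq_intros)
  from has_derivative_compose[OF 2 1] show ?thesis
    by (simp add: F_def scaleR_conv_of_real)
qed

text \<open>
  The second difference is the increment over \<open>[0, h]\<close> of the function
  \<open>t \<mapsto> F(\<zeta> + h v + t u) - F(\<zeta> + t u)\<close>. Its derivative is \<open>h L v\<close> up to an error of smaller order, because
  \<open>Fu\<close> is differentiable at \<open>\<zeta>\<close>, and the mean value inequality integrates this.
\<close>

lemma second_difference_tendsto:
  fixes F :: "complex \<Rightarrow> complex"
  assumes U: "open U" "\<zeta> \<in> U" and uv: "cmod u = 1" "cmod v = 1"
    and dF: "\<And>\<eta>. \<eta> \<in> U \<Longrightarrow> ((\<lambda>s::real. F (\<eta> + s *\<^sub>R u)) has_vector_derivative Fu \<eta>) (at 0)"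
    and dFu: "(Fu has_derivative L) (at \<zeta>)"
  shows "((\<lambda>h. (F (\<zeta> + h *\<^sub>R u + h *\<^sub>R v) - F (\<zeta> + h *\<^sub>R u) - F (\<zeta> + h *\<^sub>R v) + F \<zeta>) /\<^sub>R h\<^sup>2) \<longlongrightarrow> L v) (at_right 0)"
    (is "((\<lambda>h. ?\<Delta> h /\<^sub>R h\<^sup>2) \<longlongrightarrow> _) _")
proof (rule tendstoI)
  fix \<epsilon> :: real assume \<epsilon>: "0 < \<epsilon>"
  have lin: "linear L" using dFu by (rule has_derivative_linear)
  obtain r where r: "0 < r" "ball \<zeta> r \<subseteq> U" using U open_contains_ball by blast
  obtain d where d: "0 < d" "\<And>y. cmod (y - \<zeta>) < d \<Longrightarrow> cmod (Fu y - Fu \<zeta> - L (y - \<zeta>)) \<le> \<epsilon> / 4 * cmod (y - \<zeta>)"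
    using dFu \<epsilon> unfolding has_derivative_at_alt by (metis zero_less_divide_iff zero_less_numeral)
  define h0 where "h0 = min d r / 2"
  have h0: "0 < h0" "2 * h0 \<le> d" "2 * h0 \<le> r" using d r by (auto simp: h0_def)
  have "dist (?\<Delta> h /\<^sub>R h\<^sup>2) (L v) < \<epsilon>"
    if h: "0 < h" "h < h0" for h
  proof -
    define G where "G t = F ((\<zeta> + h *\<^sub>R v) + t *\<^sub>R u) - F (\<zeta> + t *\<^sub>R u) - t *\<^sub>R (h *\<^sub>R L v)" for t :: real
    define G' where "G' t = Fu ((\<zeta> + h *\<^sub>R v) + t *\<^sub>R u) - Fu (\<zeta> + t *\<^sub>R u) - h *\<^sub>R L v" for t :: real
    have small: "cmod (h *\<^sub>R v + t *\<^sub>R u) \<le> 2 * h" "cmod (t *\<^sub>R u) \<le> h" if "t \<in> {0..h}" for t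
      using that h uv norm_triangle_ineq[of "h *\<^sub>R v" "t *\<^sub>R u"] by auto
    have inU: "(\<zeta> + h *\<^sub>R v) + t *\<^sub>R u \<in> U" "\<zeta> + t *\<^sub>R u \<in> U" if "t \<in> {0..h}" for t
    proof -
      have "dist \<zeta> ((\<zeta> + h *\<^sub>R v) + t *\<^sub>R u) = cmod (h *\<^sub>R v + t *\<^sub>R u)"
        unfolding dist_norm by (subst norm_minus_commute) (simp add: algebra_simps)
      moreover have "dist \<zeta> (\<zeta> + t *\<^sub>R u) = cmod (t *\<^sub>R u)" by (simp add: dist_norm)
      ultimately show "(\<zeta> + h *\<^sub>R v) + t *\<^sub>R u \<in> U" "\<zeta> + t *\<^sub>R u \<in> U"
        using small[OF that] h h0 r(2) by (auto simp: subset_eq)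
    qed
    have dG: "(G has_vector_derivative G' t) (at t)" if "t \<in> {0..h}" for t
    proof -
      have 1: "((\<lambda>t::real. F ((\<zeta> + h *\<^sub>R v) + t *\<^sub>R u)) has_vector_derivative Fu ((\<zeta> + h *\<^sub>R v) + t *\<^sub>R u)) (at t)"
        by (rule directional_derivative_shift[OF dF[OF inU(1)[OF that]]])
      have 2: "((\<lambda>t::real. F (\<zeta> + t *\<^sub>R u)) has_vector_derivative Fu (\<zeta> + t *\<^sub>R u)) (at t)"
        by (rule directional_derivative_shift[OF dF[OF inU(2)[OF that]]])
      have 3: "((\<lambda>t::real. t *\<^sub>R (h *\<^sub>R L v)) has_vector_derivative h *\<^sub>R L v) (at t)"
        by (auto intro!: derivative_eq_intros)
      show ?thesis unfolding G_def G'_def by (intro has_vector_derivative_diff 1 2 3)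
    qed
    have "cmod (G h - G 0) \<le> 3 / 4 * \<epsilon> * h * norm (h - 0)"
    proof (rule differentiable_bound[of "{0..h}" G "\<lambda>t x. x *\<^sub>R G' t"])
      show "(G has_derivative (\<lambda>x. x *\<^sub>R G' t)) (at t within {0..h})" if "t \<in> {0..h}" for t
        using dG[OF that] unfolding has_vector_derivative_def by (rule has_derivative_at_withinI)
      show "onorm (\<lambda>x. x *\<^sub>R G' t) \<le> 3 / 4 * \<epsilon> * h" if t: "t \<in> {0..h}" for t
      proof (rule onorm_le)
        fix x :: real
        have e1: "(\<zeta> + h *\<^sub>R v) + t *\<^sub>R u - \<zeta> = h *\<^sub>R v + t *\<^sub>R u" by simp
        have "G' t = (Fu ((\<zeta> + h *\<^sub>R v) + t *\<^sub>R u) - Fu \<zeta> - L (h *\<^sub>R v + t *\<^sub>R u)) - (Fu (\<zeta> + t *\<^sub>R u) - Fu \<zeta> - L (t *\<^sub>R u))"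
          unfolding G'_def by (simp add: linear_add[OF lin] linear_cmul[OF lin])
        then have "cmod (G' t) \<le> cmod (Fu ((\<zeta> + h *\<^sub>R v) + t *\<^sub>R u) - Fu \<zeta> - L (h *\<^sub>R v + t *\<^sub>R u)) + cmod (Fu (\<zeta> + t *\<^sub>R u) - Fu \<zeta> - L (t *\<^sub>R u))"
          by (simp only: norm_triangle_ineq4)
        also have "\<dots> \<le> \<epsilon> / 4 * cmod (h *\<^sub>R v + t *\<^sub>R u) + \<epsilon> / 4 * cmod (t *\<^sub>R u)"
          using d(2)[of "(\<zeta> + h *\<^sub>R v) + t *\<^sub>R u"] d(2)[of "\<zeta> + t *\<^sub>R u"] small[OF t] h h0
          unfolding e1 by (intro add_mono) auto
        also have "\<dots> \<le> \<epsilon> / 4 * (2 * h) + \<epsilon> / 4 * h"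
          using small[OF t] \<epsilon> by (intro add_mono mult_left_mono) auto
        also have "\<dots> = 3 / 4 * \<epsilon> * h" by simp
        finally have "cmod (G' t) \<le> 3 / 4 * \<epsilon> * h" .
        then show "norm (x *\<^sub>R G' t) \<le> 3 / 4 * \<epsilon> * h * norm x"
          using mult_left_mono[of "cmod (G' t)" "3 / 4 * \<epsilon> * h" "\<bar>x\<bar>"] by (simp add: mult.commute)
      qed
    qed (use h in auto)
    moreover have "G h - G 0 = ?\<Delta> h - h\<^sup>2 *\<^sub>R L v"
      by (simp add: G_def power2_eq_square add_ac)
    ultimately have *: "cmod (?\<Delta> h - h\<^sup>2 *\<^sub>R L v) \<le> 3 / 4 * \<epsilon> * h\<^sup>2"
      using h by (simp add: power2_eq_square mult.assoc)
    have "cmod (X /\<^sub>R h\<^sup>2 - L v) = cmod (X - h\<^sup>2 *\<^sub>R L v) / h\<^sup>2" for X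
    proof -
      have "X /\<^sub>R h\<^sup>2 - L v = (X - h\<^sup>2 *\<^sub>R L v) /\<^sub>R h\<^sup>2" using h by (simp add: scaleR_diff_right)
      then show ?thesis by (simp add: divide_inverse mult.commute)
    qed
    then have "dist (?\<Delta> h /\<^sub>R h\<^sup>2) (L v) \<le> 3 / 4 * \<epsilon> * h\<^sup>2 / h\<^sup>2"
      unfolding dist_norm using * by (simp only: divide_right_mono zero_le_power2)
    also have "\<dots> < \<epsilon>" using h \<epsilon> by simp
    finally show ?thesis .
  qed
  then show "eventually (\<lambda>h. dist (?\<Delta> h /\<^sub>R h\<^sup>2) (L v) < \<epsilon>) (at_right 0)"
    using h0(1) by (intro eventually_at_rightI[of 0 h0]) auto
qed

text \<open>
  The second difference is symmetric in its two directions, so its two limits coincide.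
\<close>

theorem mixed_partials_commute:
  assumes U: "open U" and f: "real_C2_on f U" and \<zeta>: "\<zeta> \<in> U"
  shows "partial_y (partial_x f) \<zeta> = partial_x (partial_y f) \<zeta>"
proof -
  have C1: "real_C1_on f U" "real_C1_on (partial_x f) U" "real_C1_on (partial_y f) U"
    using f by (auto simp: real_C2_on_def)
  have 1: "((\<lambda>h. (f (\<zeta> + h *\<^sub>R 1 + h *\<^sub>R \<i>) - f (\<zeta> + h *\<^sub>R 1) - f (\<zeta> + h *\<^sub>R \<i>) + f \<zeta>) /\<^sub>R h\<^sup>2) \<longlongrightarrow> partial_y (partial_x f) \<zeta>) (at_right 0)"
    using second_difference_tendsto[where u=1 and v="\<i>", OF U \<zeta> _ _ real_C1_directional[OF C1(1)] real_C1_has_derivative[OF U C1(2) \<zeta>]] by simp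
  have "((\<lambda>h. (f (\<zeta> + h *\<^sub>R \<i> + h *\<^sub>R 1) - f (\<zeta> + h *\<^sub>R \<i>) - f (\<zeta> + h *\<^sub>R 1) + f \<zeta>) /\<^sub>R h\<^sup>2) \<longlongrightarrow> partial_x (partial_y f) \<zeta>) (at_right 0)"
    using second_difference_tendsto[where u="\<i>" and v=1, OF U \<zeta> _ _ real_C1_directional[OF C1(1)] real_C1_has_derivative[OF U C1(3) \<zeta>]] by simp
  moreover have "(\<lambda>h. (f (\<zeta> + h *\<^sub>R \<i> + h *\<^sub>R 1) - f (\<zeta> + h *\<^sub>R \<i>) - f (\<zeta> + h *\<^sub>R 1) + f \<zeta>) /\<^sub>R h\<^sup>2)
     = (\<lambda>h. (f (\<zeta> + h *\<^sub>R 1 + h *\<^sub>R \<i>) - f (\<zeta> + h *\<^sub>R 1) - f (\<zeta> + h *\<^sub>R \<i>) + f \<zeta>) /\<^sub>R h\<^sup>2)"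
    by (simp add: fun_eq_iff add_ac diff_diff_eq)
  ultimately show ?thesis using 1 by (auto intro: tendsto_unique[OF trivial_limit_at_right_real])
qed

definition cnj_wirtinger_deriv :: "(complex \<Rightarrow> complex) \<Rightarrow> complex \<Rightarrow> complex" where
  "cnj_wirtinger_deriv f \<zeta> = (partial_x f \<zeta> + \<i> * partial_y f \<zeta>) / 2"

lemma real_C1_has_derivative_wirtinger:
  assumes "open U" "real_C1_on f U" "\<zeta> \<in> U"
  shows "(f has_derivative (\<lambda>h. h * wirtinger_deriv f \<zeta> + cnj h * cnj_wirtinger_deriv f \<zeta>)) (at \<zeta>)"
proof -
  have "of_real (Re h) * dir_deriv 1 f \<zeta> + of_real (Im h) * dir_deriv \<i> f \<zeta>
      = h * wirtinger_deriv f \<zeta> + cnj h * cnj_wirtinger_deriv f \<zeta>" for h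
    by (simp add: wirtinger_deriv_def cnj_wirtinger_deriv_def complex_eq_iff field_simps)
  then show ?thesis using real_C1_has_derivative[OF assms] by (simp only:)
qed

text \<open>
  \<open>m\<close> and \<open>n\<close> are the derivatives of \<open>\<partial>f\<close> with respect to \<open>\<zeta>\<close> and \<open>cnj \<zeta>\<close>. That the latter is a quarter
  of the Laplacian rests on the symmetry of the mixed partial derivatives.
\<close>

lemma real_C2_wirtinger:
  assumes U: "open U" and f: "real_C2_on f U"
  obtains m n where "continuous_on U m" "continuous_on U n"
    "\<And>\<zeta>. \<zeta> \<in> U \<Longrightarrow> (wirtinger_deriv f has_derivative (\<lambda>h. h * m \<zeta> + cnj h * n \<zeta>)) (at \<zeta>)"
    "\<And>\<zeta>. \<zeta> \<in> U \<Longrightarrow> n \<zeta> = laplacian f \<zeta> / 4"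
proof -
  have C1: "real_C1_on (partial_x f) U" "real_C1_on (partial_y f) U"
    using f by (auto simp: real_C2_on_def)
  define m where "m \<zeta> = (wirtinger_deriv (partial_x f) \<zeta> - \<i> * wirtinger_deriv (partial_y f) \<zeta>) / 2" for \<zeta>
  define n where "n \<zeta> = (cnj_wirtinger_deriv (partial_x f) \<zeta> - \<i> * cnj_wirtinger_deriv (partial_y f) \<zeta>) / 2" for \<zeta>
  note cont = real_C1_continuous_dir_deriv[OF C1(1)] real_C1_continuous_dir_deriv[OF C1(2)]
  show ?thesis
  proof
    show "continuous_on U m" "continuous_on U n"
      unfolding m_def n_def wirtinger_deriv_def cnj_wirtinger_deriv_def by (intro continuous_intros cont; simp)+
    fix \<zeta> assume \<zeta>: "\<zeta> \<in> U"
    note d = real_C1_has_derivative_wirtinger[OF U C1(1) \<zeta>] real_C1_has_derivative_wirtinger[OF U C1(2) \<zeta>]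
    have "((\<lambda>\<zeta>. (partial_x f \<zeta> - \<i> * partial_y f \<zeta>) * (1 / 2)) has_derivative
       (\<lambda>h. ((h * wirtinger_deriv (partial_x f) \<zeta> + cnj h * cnj_wirtinger_deriv (partial_x f) \<zeta>)
          - \<i> * (h * wirtinger_deriv (partial_y f) \<zeta> + cnj h * cnj_wirtinger_deriv (partial_y f) \<zeta>)) * (1 / 2))) (at \<zeta>)"
      by (intro has_derivative_mult_left has_derivative_diff has_derivative_mult_right d)
    moreover have "(\<lambda>\<zeta>. (partial_x f \<zeta> - \<i> * partial_y f \<zeta>) * (1 / 2)) = wirtinger_deriv f"
      by (simp add: wirtinger_deriv_def fun_eq_iff)
    moreover have "((h * wirtinger_deriv (partial_x f) \<zeta> + cnj h * cnj_wirtinger_deriv (partial_x f) \<zeta>)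
          - \<i> * (h * wirtinger_deriv (partial_y f) \<zeta> + cnj h * cnj_wirtinger_deriv (partial_y f) \<zeta>)) * (1 / 2)
        = h * m \<zeta> + cnj h * n \<zeta>" for h
      by (simp add: m_def n_def algebra_simps add_divide_distrib diff_divide_distrib)
    ultimately show "(wirtinger_deriv f has_derivative (\<lambda>h. h * m \<zeta> + cnj h * n \<zeta>)) (at \<zeta>)" by (simp only:)
    show "n \<zeta> = laplacian f \<zeta> / 4"
      using mixed_partials_commute[OF U f \<zeta>]
      by (simp add: n_def cnj_wirtinger_deriv_def laplacian_def field_simps)
  qed
qed

section \<open>Green's representation formula\<close>

lemma radial_has_derivative:
  fixes F :: "real \<Rightarrow> complex" and q :: complex
  assumes "(F has_vector_derivative d) (at (cmod q))" "q \<noteq> 0"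
  shows "((\<lambda>q. F (cmod q)) has_derivative (\<lambda>h. (h * cnj q + cnj h * q) * (d / (2 * cmod q)))) (at q)"
proof -
  have "(norm has_derivative (\<lambda>h. inner h (sgn q))) (at q)"
    by (rule has_derivative_norm[OF assms(2)])
  from has_derivative_compose[OF this assms(1)[unfolded has_vector_derivative_def]]
  have "((\<lambda>q. F (cmod q)) has_derivative (\<lambda>h. inner h (sgn q) *\<^sub>R d)) (at q)" .
  moreover have "inner h (sgn q) *\<^sub>R d = (h * cnj q + cnj h * q) * (d / (2 * cmod q))" for h
  proof -
    have "h * cnj q + cnj h * q = of_real (2 * inner h q)"
      by (simp add: complex_eq_iff inner_complex_def)
    moreover have "inner h (sgn q) = inner h q / cmod q"
      by (simp add: sgn_div_norm divide_inverse)
    ultimately show ?thesis by (simp add: scaleR_conv_of_real)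
  qed
  ultimately show ?thesis by (simp only:)
qed

text \<open>
  The Green form of \<open>\<phi>\<close> and a radial solution \<open>f\<close> with pole \<open>z\<close> has the coefficients
  \<open>a(q) = \<phi>(z + q) A(\<bar>q\<bar>)\<close> and \<open>b(q) = f(\<bar>q\<bar>) \<partial>\<phi>(z + q)\<close>. The first-order system for \<open>f\<close> and \<open>A\<close>
  together with the Helmholtz equation for \<open>\<phi>\<close> makes it closed, and the normalization of \<open>A\<close> at \<open>0\<close> gives
  \<open>a0 = - \<phi>(z)\<close>.
\<close>

theorem green_representation:
  fixes f A :: "real \<Rightarrow> complex" and \<sigma> z :: complex
  assumes f': "\<And>r. 0 < r \<Longrightarrow> (f has_vector_derivative 2 * A r / r) (at r)"
    and A': "\<And>r. 0 < r \<Longrightarrow> (A has_vector_derivative 2 * \<sigma> * r * f r) (at r)"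
    and A_lim: "(A \<longlongrightarrow> - 1) (at_right 0)" and f_lim: "((\<lambda>r. of_real r * f r) \<longlongrightarrow> 0) (at_right 0)"
    and \<Omega>: "open \<Omega>" "convex \<Omega>" and z: "z \<in> \<Omega>"
    and U: "open U" "closure \<Omega> \<subseteq> U" and \<phi>: "real_C2_on \<phi> U"
    and helmholtz: "\<And>\<zeta>. \<zeta> \<in> \<Omega> \<Longrightarrow> laplacian \<phi> \<zeta> = 4 * \<sigma> * \<phi> \<zeta>"
    and g: "\<And>j. j \<in> {1..4::nat} \<Longrightarrow> lipschitz_curve (g j) (D j) (C j) (N j)"
    and g_frontier: "\<And>j. j \<in> {1..4} \<Longrightarrow> path_image (g j) \<subseteq> frontier \<Omega>"
    and chain: "\<And>j. j \<in> {1..4} \<Longrightarrow> g j 1 = g (j mod 4 + 1) 0"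
    and winding: "(\<Sum>j=1..4. winding_number (g j) z) = 1"
  shows "(\<Sum>j=1..4. \<integral>t. \<phi> (g j t) * A (cmod (g j t - z)) / cnj (g j t - z) * cnj (D j t)
      + f (cmod (g j t - z)) * wirtinger_deriv \<phi> (g j t) * D j t \<partial>lebesgue_on {0..1}) = 2 * pi * \<i> * \<phi> z"
proof -
  have C1: "real_C1_on \<phi> U" using \<phi> by (simp add: real_C2_on_def)
  obtain m n where mn: "continuous_on U m" "continuous_on U n"
    "\<And>\<zeta>. \<zeta> \<in> U \<Longrightarrow> (wirtinger_deriv \<phi> has_derivative (\<lambda>h. h * m \<zeta> + cnj h * n \<zeta>)) (at \<zeta>)"
    "\<And>\<zeta>. \<zeta> \<in> U \<Longrightarrow> n \<zeta> = laplacian \<phi> \<zeta> / 4"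
    by (rule real_C2_wirtinger[OF U(1) \<phi>]) blast
  note d\<phi> = real_C1_has_derivative_wirtinger[OF U(1) C1]
  have cont_\<phi>: "continuous_on U \<phi>"
    using d\<phi> by (intro continuous_at_imp_continuous_on ballI has_derivative_continuous)
  have cont_w: "continuous_on U (wirtinger_deriv \<phi>)"
    using mn(3) by (intro continuous_at_imp_continuous_on ballI has_derivative_continuous)
  have cont_cw: "continuous_on U (cnj_wirtinger_deriv \<phi>)"
    unfolding cnj_wirtinger_deriv_def by (intro continuous_intros real_C1_continuous_dir_deriv[OF C1]; simp)
  define V where "V = {q. z + q \<in> U}"
  define \<Omega>0 where "\<Omega>0 = {q. z + q \<in> \<Omega>}"
  have \<Omega>U: "\<Omega> \<subseteq> U" using U(2) closure_subset by blast
  have zU: "z \<in> U" using z \<Omega>U by blast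
  define a where "a q = \<phi> (z + q) * A (cmod q)" for q
  define b where "b q = f (cmod q) * wirtinger_deriv \<phi> (z + q)" for q
  define a1 where "a1 q = wirtinger_deriv \<phi> (z + q) * A (cmod q) + \<phi> (z + q) * (\<sigma> * f (cmod q) * cnj q)" for q
  define a2 where "a2 q = cnj_wirtinger_deriv \<phi> (z + q) * A (cmod q) + \<phi> (z + q) * (\<sigma> * f (cmod q) * q)" for q
  define b1 where "b1 q = A (cmod q) / q * wirtinger_deriv \<phi> (z + q) + f (cmod q) * m (z + q)" for q
  define b2 where "b2 q = A (cmod q) / cnj q * wirtinger_deriv \<phi> (z + q) + f (cmod q) * n (z + q)" for q
  have shift: "((\<lambda>q. F (z + q)) has_derivative F') (at q)" if "(F has_derivative F') (at (z + q))" for F F' :: "complex \<Rightarrow> complex" and q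
  proof -
    have "((\<lambda>q. z + q) has_derivative (\<lambda>h. h)) (at q)" by (auto intro!: derivative_eq_intros)
    from has_derivative_compose[OF this that] show ?thesis .
  qed
  have form: "punctured_form V \<Omega>0 a a1 a2 b b1 b2 (- \<phi> z)"
  proof
    show "open V" unfolding V_def using U(1)
      by (intro open_vimage[of U "\<lambda>q. z + q", unfolded vimage_def]) (auto intro!: continuous_intros)
    show "\<Omega>0 \<subseteq> V" using \<Omega>U by (auto simp: V_def \<Omega>0_def)
    have cA: "continuous_on (V - {0}) (\<lambda>q. A (cmod q))" "continuous_on (V - {0}) (\<lambda>q. f (cmod q))"
    proof -
      have "continuous_on {0<..} A" "continuous_on {0<..} f"
        using has_vector_derivative_continuous[OF A'] has_vector_derivative_continuous[OF f']
        by (auto intro: continuous_at_imp_continuous_on)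
      then show "continuous_on (V - {0}) (\<lambda>q. A (cmod q))" "continuous_on (V - {0}) (\<lambda>q. f (cmod q))"
        by (auto intro!: continuous_on_compose2[of "{0<..}" _ "V - {0}" cmod] continuous_intros)
    qed
    have cs: "continuous_on (V - {0}) (\<lambda>q. F (z + q))" if "continuous_on U F" for F :: "complex \<Rightarrow> complex"
      by (rule continuous_on_compose2[OF that]) (auto simp: V_def intro!: continuous_intros)
    show "continuous_on (V - {0}) a1" "continuous_on (V - {0}) a2" "continuous_on (V - {0}) b1" "continuous_on (V - {0}) b2"
      unfolding a1_def a2_def b1_def b2_def
      by (intro continuous_intros cA cs cont_w cont_cw cont_\<phi> mn(1,2); simp)+
    fix q assume q: "q \<in> V - {0}"
    then have qU: "z + q \<in> U" and q0: "q \<noteq> 0" "0 < cmod q" by (auto simp: V_def)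
    have "((\<lambda>q. A (cmod q)) has_derivative (\<lambda>h. (h * cnj q + cnj h * q) * (2 * \<sigma> * cmod q * f (cmod q) / (2 * cmod q)))) (at q)"
      by (rule radial_has_derivative[OF A'[OF q0(2)] q0(1)])
    moreover have "2 * \<sigma> * cmod q * f (cmod q) / (2 * cmod q) = \<sigma> * f (cmod q)" using q0 by simp
    ultimately have dA: "((\<lambda>q. A (cmod q)) has_derivative (\<lambda>h. (h * cnj q + cnj h * q) * (\<sigma> * f (cmod q)))) (at q)"
      by simp
    have "(a has_derivative (\<lambda>h. \<phi> (z + q) * ((h * cnj q + cnj h * q) * (\<sigma> * f (cmod q)))
        + (h * wirtinger_deriv \<phi> (z + q) + cnj h * cnj_wirtinger_deriv \<phi> (z + q)) * A (cmod q))) (at q)"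
      unfolding a_def by (rule has_derivative_mult[OF shift[OF d\<phi>[OF qU]] dA])
    moreover have "\<phi> (z + q) * ((h * cnj q + cnj h * q) * (\<sigma> * f (cmod q)))
        + (h * wirtinger_deriv \<phi> (z + q) + cnj h * cnj_wirtinger_deriv \<phi> (z + q)) * A (cmod q) = h * a1 q + cnj h * a2 q" for h
      by (simp add: a1_def a2_def algebra_simps)
    ultimately show "(a has_derivative (\<lambda>h. h * a1 q + cnj h * a2 q)) (at q)" by (simp only:)
    have "((\<lambda>q. f (cmod q)) has_derivative (\<lambda>h. (h * cnj q + cnj h * q) * (2 * A (cmod q) / cmod q / (2 * cmod q)))) (at q)"
      by (rule radial_has_derivative[OF f'[OF q0(2)] q0(1)])
    moreover have "(h * cnj q + cnj h * q) * (2 * A (cmod q) / cmod q / (2 * cmod q)) = A (cmod q) * (h / q + cnj h / cnj q)" for h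
    proof -
      have sq: "complex_of_real (cmod q) * complex_of_real (cmod q) = q * cnj q"
        by (simp add: complex_norm_square[symmetric] power2_eq_square[symmetric])
      have "2 * A (cmod q) / cmod q / (2 * cmod q) = A (cmod q) / (complex_of_real (cmod q) * complex_of_real (cmod q))"
        by simp
      then have "2 * A (cmod q) / cmod q / (2 * cmod q) = A (cmod q) / (q * cnj q)" by (simp only: sq)
      moreover have "(h * cnj q + cnj h * q) * (A (cmod q) / (q * cnj q)) = A (cmod q) * (h / q + cnj h / cnj q)"
        using q0 by (simp add: field_simps)
      ultimately show ?thesis by (simp only:)
    qed
    ultimately have df: "((\<lambda>q. f (cmod q)) has_derivative (\<lambda>h. A (cmod q) * (h / q + cnj h / cnj q))) (at q)"
      by (simp only:)
    have "(b has_derivative (\<lambda>h. f (cmod q) * (h * m (z + q) + cnj h * n (z + q))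
        + A (cmod q) * (h / q + cnj h / cnj q) * wirtinger_deriv \<phi> (z + q))) (at q)"
      unfolding b_def by (rule has_derivative_mult[OF df shift[OF mn(3)[OF qU]]])
    moreover have "f (cmod q) * (h * m (z + q) + cnj h * n (z + q))
        + A (cmod q) * (h / q + cnj h / cnj q) * wirtinger_deriv \<phi> (z + q) = h * b1 q + cnj h * b2 q" for h
      by (simp add: b1_def b2_def algebra_simps)
    ultimately show "(b has_derivative (\<lambda>h. h * b1 q + cnj h * b2 q)) (at q)" by (simp only:)
  next
    fix q assume q: "q \<in> \<Omega>0 - {0}"
    then have "n (z + q) = \<sigma> * \<phi> (z + q)"
      using mn(4)[of "z + q"] helmholtz[of "z + q"] \<Omega>U by (auto simp: \<Omega>0_def)
    then show "a1 q = cnj q * b2 q" using q by (simp add: a1_def b2_def algebra_simps)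
  next
    have nr: "filterlim cmod (at_right 0) (at 0)"
      unfolding filterlim_at by (auto simp: eventually_at_filter intro!: tendsto_eq_intros)
    have "((\<lambda>q. \<phi> (z + q)) \<longlongrightarrow> \<phi> (z + 0)) (at 0)"
    proof -
      have "isCont (\<lambda>q. \<phi> (z + q)) 0"
        using has_derivative_continuous[OF shift[of \<phi> _ 0]] d\<phi>[of z] zU by simp
      then show ?thesis by (simp add: isCont_def)
    qed
    from tendsto_mult[OF this filterlim_compose[OF A_lim nr]]
    show "(a \<longlongrightarrow> - \<phi> z) (at 0)" by (simp add: a_def[abs_def])
    have w0: "((\<lambda>q. wirtinger_deriv \<phi> (z + q)) \<longlongrightarrow> wirtinger_deriv \<phi> (z + 0)) (at 0)"
    proof -
      have "isCont (\<lambda>q. wirtinger_deriv \<phi> (z + q)) 0"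
        using has_derivative_continuous[OF shift[of "wirtinger_deriv \<phi>" _ 0]] mn(3)[of z] zU by simp
      then show ?thesis by (simp add: isCont_def)
    qed
    have "((\<lambda>q. of_real (cmod q) * f (cmod q) * wirtinger_deriv \<phi> (z + q)) \<longlongrightarrow> 0 * wirtinger_deriv \<phi> (z + 0)) (at 0)"
      by (rule tendsto_mult[OF filterlim_compose[OF f_lim nr] w0])
    then have "((\<lambda>q. cmod (of_real (cmod q) * f (cmod q) * wirtinger_deriv \<phi> (z + q))) \<longlongrightarrow> 0) (at 0)"
      by (simp add: tendsto_norm_zero_iff)
    then have "((\<lambda>q. cmod (q * b q)) \<longlongrightarrow> 0) (at 0)" by (simp add: b_def norm_mult mult.assoc)
    then show "((\<lambda>q. q * b q) \<longlongrightarrow> 0) (at 0)" by (simp add: tendsto_norm_zero_iff)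
  qed
  define p where "p j t = g j t - z" for j t
  have path: "punctured_form_path V \<Omega>0 a a1 a2 b b1 b2 (- \<phi> z) (p j) (D j) (C j) (N j)" if j: "j \<in> {1..4}" for j
  proof -
    have fr: "g j t \<in> frontier \<Omega>" if "t \<in> {0..1}" for t
      using g_frontier[OF j] that by (auto simp: path_image_def)
    have curve: "lipschitz_curve (p j) (D j) (C j) (N j)"
      unfolding p_def by (rule lipschitz_curve.lipschitz_curve_diff_const[OF g[OF j]])
    show ?thesis
    proof (rule punctured_form_path.intro[OF form curve], unfold_locales)
      show "p j t \<noteq> 0" if "t \<in> {0..1}" for t
        using fr[OF that] z \<Omega>(1) by (auto simp: p_def frontier_def interior_open)
      show "p j t \<in> V" if "t \<in> {0..1}" for t
        using fr[OF that] U(2) by (auto simp: p_def V_def frontier_def)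
      show "of_real s * p j t \<in> \<Omega>0" if "0 < s" "s < 1" "t \<in> {0..1}" for s t
      proof -
        have "g j t - (1 - s) *\<^sub>R (g j t - z) \<in> interior \<Omega>"
          using fr[OF that(3)] z \<Omega> that by (intro mem_interior_closure_convex_shrink) (auto simp: frontier_def interior_open)
        moreover have "g j t - (1 - s) *\<^sub>R (g j t - z) = z + of_real s * p j t"
          by (simp add: p_def scaleR_conv_of_real algebra_simps)
        ultimately show ?thesis using \<Omega>(1) by (simp add: \<Omega>0_def interior_open)
      qed
    qed
  qed
  have "(\<Sum>j=1..4. \<integral>t. a (p j t) / cnj (p j t) * cnj (D j t) + b (p j t) * D j t \<partial>lebesgue_on {0..1})
     = - (2 * pi * \<i> * - \<phi> z)"
  proof (rule closed_form_integral_chain[OF path])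
    show "p j 1 = p (j mod 4 + 1) 0" if "j \<in> {1..4}" for j
      using chain[OF that] by (simp add: p_def)
    have "winding_number (p j) 0 = winding_number (g j) z" for j
      unfolding p_def by (subst winding_number_offset[of "g j" z]) simp
    then show "(\<Sum>j=1..4. winding_number (p j) 0) = 1" using winding by simp
  qed
  then show ?thesis by (simp add: a_def b_def p_def)
qed

section \<open>Exchanging the contour integral and the arc integral\<close>

text \<open>
  The integral \<^const>\<open>rho\<close> as a Lebesgue integral, with \<open>u\<close>, \<open>v\<close> for the values of \<open>\<phi>\<close> and of its derivative
  along the arc and \<open>D\<close> for the velocity of the arc.
\<close>

definition arc_transform ::
  "complex \<Rightarrow> (real \<Rightarrow> complex) \<Rightarrow> (real \<Rightarrow> complex) \<Rightarrow> (real \<Rightarrow> complex) \<Rightarrow> (real \<Rightarrow> complex) \<Rightarrow> complex \<Rightarrow> complex" where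
  "arc_transform \<sigma> p D u v t = (\<integral>\<tau>. exp (- \<i> * t * p \<tau> + \<i> * \<sigma> * cnj (p \<tau>) / t) *
     (u \<tau> * (\<i> * \<sigma> / t) * cnj (D \<tau>) + v \<tau> * D \<tau>) \<partial>lebesgue_on {0..1})"

lemma sigma_finite_lebesgue_on:
  assumes "S \<in> sets lebesgue"
  shows "sigma_finite_measure (lebesgue_on S :: 'a::euclidean_space measure)"
proof (rule sigma_finite_measure_restrict_space[OF _ assms])
  obtain A :: "'a set set" where A: "countable A" "A \<subseteq> sets lborel" "\<Union>A = space lborel" "\<forall>a\<in>A. emeasure lborel a \<noteq> \<infinity>"
    using lborel.sigma_finite_countable by blast
  have "emeasure lebesgue a = emeasure lborel a" if "a \<in> A" for a
    using A(2) that by (metis emeasure_completion main_part in_mono sets_completionI_sets)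
  then show "sigma_finite_measure (lebesgue :: 'a measure)"
    using A by (intro sigma_finite_measure.intro exI[of _ A]) auto
qed

context lipschitz_curve
begin

text \<open>
  The integrand is holomorphic in \<open>t\<close> and its derivative is bounded on a disc around \<open>t0\<close> that stays away
  from \<open>0\<close>. Holomorphy allows the contour to be replaced by the model contour.
\<close>

lemma transform_holomorphic:
  assumes u: "continuous_on {0..1} u" and v: "continuous_on {0..1} v"
  shows "arc_transform \<sigma> p D u v holomorphic_on - {0}"
proof (rule holomorphic_onI)
  fix t0 :: complex assume "t0 \<in> - {0}"
  then have t0: "t0 \<noteq> 0" by simp
  define r where "r = cmod t0 / 2"
  have r: "0 < r" using t0 by (simp add: r_def)
  have nz: "t \<noteq> 0" if "t \<in> cball t0 r" for t using that t0 by (auto simp: r_def dist_norm)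
  define e where "e t \<tau> = exp (- \<i> * t * p \<tau> + \<i> * \<sigma> * cnj (p \<tau>) / t)" for t \<tau>
  define e' where "e' t \<tau> = e t \<tau> * (- \<i> * p \<tau> - \<i> * \<sigma> * cnj (p \<tau>) / t\<^sup>2)" for t \<tau>
  define x where "x t \<tau> = e' t \<tau> * (u \<tau> * (\<i> * \<sigma> / t)) - e t \<tau> * (u \<tau> * (\<i> * \<sigma> / t\<^sup>2))" for t \<tau>
  define y where "y t \<tau> = e' t \<tau> * v \<tau>" for t \<tau>
  define K where "K t \<tau> = (e t \<tau> * (u \<tau> * (\<i> * \<sigma> / t))) * cnj (D \<tau>) + (e t \<tau> * v \<tau>) * D \<tau>" for t \<tau>
  define K1 where "K1 t \<tau> = x t \<tau> * cnj (D \<tau>) + y t \<tau> * D \<tau>" for t \<tau>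
  have ce: "continuous_on {0..1} (e t)" "continuous_on {0..1} (e' t)" if "t \<noteq> 0" for t
    unfolding e'_def e_def using that by (intro continuous_intros cont_p; simp)+
  have K_meas: "K t \<in> borel_measurable M" if "t \<noteq> 0" for t
    unfolding K_def by (intro measurable_linear_in_D continuous_intros ce that u v)
  have K1_meas: "K1 t \<in> borel_measurable M" if "t \<noteq> 0" for t
    unfolding K1_def x_def y_def by (intro measurable_linear_in_D continuous_intros ce that u v)
  have K_der: "((\<lambda>t. K t \<tau>) has_field_derivative K1 t \<tau>) (at t)" if "t \<noteq> 0" for t \<tau>
  proof -
    have 1: "((\<lambda>t. e t \<tau>) has_field_derivative e' t \<tau>) (at t)"
      unfolding e'_def e_def using that
      by (auto intro!: derivative_eq_intros simp: power2_eq_square)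
    have 2: "((\<lambda>t. u \<tau> * (\<i> * \<sigma> / t)) has_field_derivative - (u \<tau> * (\<i> * \<sigma> / t\<^sup>2))) (at t)"
      using that by (auto intro!: derivative_eq_intros simp: power2_eq_square)
    have "((\<lambda>t. K t \<tau>) has_field_derivative (e' t \<tau> * (u \<tau> * (\<i> * \<sigma> / t)) + - (u \<tau> * (\<i> * \<sigma> / t\<^sup>2)) * e t \<tau>) * cnj (D \<tau>) + (e' t \<tau> * v \<tau>) * D \<tau>) (at t)"
      unfolding K_def by (intro DERIV_add DERIV_cmult_right DERIV_mult 1 2)
    then show ?thesis by (simp add: K1_def x_def y_def mult.commute)
  qed
  have bound: "\<exists>B. \<forall>t\<in>cball t0 r. \<forall>\<tau>\<in>{0..1}. cmod (F t \<tau>) \<le> B"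
    if "continuous_on (cball t0 r \<times> {0..1}) (\<lambda>(t, \<tau>). F t \<tau>)" for F :: "complex \<Rightarrow> real \<Rightarrow> complex"
  proof -
    have "bounded ((\<lambda>(t, \<tau>). F t \<tau>) ` (cball t0 r \<times> {0..1}))"
      by (intro compact_imp_bounded compact_continuous_image that compact_Times compact_cball compact_Icc)
    then show ?thesis by (auto simp: bounded_iff)
  qed
  have c: "continuous_on (cball t0 r \<times> {0..1}) (\<lambda>z. p (snd z))" "continuous_on (cball t0 r \<times> {0..1}) (\<lambda>z. u (snd z))"
    "continuous_on (cball t0 r \<times> {0..1}) (\<lambda>z. v (snd z))"
    by (intro continuous_on_compose2[OF cont_p] continuous_on_compose2[OF u] continuous_on_compose2[OF v] continuous_intros; force)+
  have ce2: "continuous_on (cball t0 r \<times> {0..1}) (\<lambda>z. e (fst z) (snd z))" "continuous_on (cball t0 r \<times> {0..1}) (\<lambda>z. e' (fst z) (snd z))"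
    unfolding e'_def e_def using nz by (intro continuous_intros c; force)+
  have "continuous_on (cball t0 r \<times> {0..1}) (\<lambda>(t, \<tau>). x t \<tau>)" "continuous_on (cball t0 r \<times> {0..1}) (\<lambda>(t, \<tau>). y t \<tau>)"
    unfolding x_def y_def case_prod_beta' using nz by (intro continuous_intros c ce2; force)+
  from bound[OF this(1)] bound[OF this(2)]
  obtain X Y where XY: "\<And>t \<tau>. t \<in> cball t0 r \<Longrightarrow> \<tau> \<in> {0..1} \<Longrightarrow> cmod (x t \<tau>) \<le> X" "\<And>t \<tau>. t \<in> cball t0 r \<Longrightarrow> \<tau> \<in> {0..1} \<Longrightarrow> cmod (y t \<tau>) \<le> Y"
    by blast
  have X0: "0 \<le> X" "0 \<le> Y" using XY(1)[of t0 0] XY(2)[of t0 0] r by (auto intro: order_trans[OF norm_ge_zero])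
  have intK: "integrable M (K t)" if "t \<noteq> 0" for t
  proof -
    have "bounded ((\<lambda>\<tau>. e t \<tau> * (u \<tau> * (\<i> * \<sigma> / t))) ` {0..1})"
      by (intro compact_imp_bounded compact_continuous_image continuous_intros ce u v that compact_Icc)
    then obtain P where P: "0 < P" "\<And>\<tau>. \<tau> \<in> {0..1} \<Longrightarrow> cmod (e t \<tau> * (u \<tau> * (\<i> * \<sigma> / t))) \<le> P"
      unfolding bounded_pos by blast
    have "bounded ((\<lambda>\<tau>. e t \<tau> * v \<tau>) ` {0..1})"
      by (intro compact_imp_bounded compact_continuous_image continuous_intros ce u v that compact_Icc)
    then obtain Q where Q: "0 < Q" "\<And>\<tau>. \<tau> \<in> {0..1} \<Longrightarrow> cmod (e t \<tau> * v \<tau>) \<le> Q"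
      unfolding bounded_pos by blast
    show ?thesis
      by (intro integrable_M_bounded[where K="(P + Q) * C"] K_meas that) (unfold K_def, intro norm_linear_in_D P Q less_imp_le)
  qed
  have "((\<lambda>t. \<integral>\<tau>. K t \<tau> \<partial>M) has_derivative (\<lambda>h. \<integral>\<tau>. K1 t0 \<tau> * h \<partial>M)) (at t0)"
  proof (rule has_derivative_lebesgue_integral[where S="ball t0 r" and B="\<lambda>_. (X + Y) * C" and F'="\<lambda>t \<tau> h. K1 t \<tau> * h"])
    show "t0 \<in> ball t0 r" using r by simp
    show "integrable M (K t)" if "t \<in> ball t0 r" for t using that nz by (intro intK) auto
    show "((\<lambda>t. K t \<tau>) has_derivative (\<lambda>h. K1 t \<tau> * h)) (at t)" if "t \<in> ball t0 r" for t \<tau>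
      using K_der[of t \<tau>] nz that by (auto simp: has_field_derivative_def)
    show "cmod (K1 t \<tau> * h) \<le> (X + Y) * C * cmod h" if "t \<in> ball t0 r" "\<tau> \<in> space M" for t \<tau> h
      unfolding norm_mult[of _ h] K1_def using that XY X0 by (intro mult_right_mono norm_linear_in_D) auto
    show "integrable M (\<lambda>_. (X + Y) * C)" by (simp add: finite_measure.integrable_const[OF finite_M])
    show "(\<lambda>\<tau>. K1 t0 \<tau> * h) \<in> borel_measurable M" for h
      using K1_meas[OF t0] by measurable
  qed auto
  then have "((\<lambda>t. \<integral>\<tau>. K t \<tau> \<partial>M) has_field_derivative (\<integral>\<tau>. K1 t0 \<tau> \<partial>M)) (at t0)"
    by (simp add: has_field_derivative_def)
  then show "arc_transform \<sigma> p D u v field_differentiable (at t0 within - {0})"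
    unfolding K_def e_def field_differentiable_def arc_transform_def[abs_def]
    by (auto simp: ring_distribs mult.assoc intro: has_field_derivative_at_within)
qed

end

context model_contour
begin

text \<open>
  By compactness the rotated differences \<open>w\<close> have imaginary part at least some \<open>\<delta> > 0\<close> along the arc, so
  the joint integrand is dominated by an integrable function of the contour parameter alone and
  Fubini's theorem applies. The inner integrals are then moments of orders \<open>0\<close> and \<open>- 1\<close> at \<open>w\<close>, and their
  radial form removes the rotation.
\<close>

theorem arc_transform_has_integral:
  assumes curve: "lipschitz_curve g D C N"
    and u: "continuous_on {0..1} u" and v: "continuous_on {0..1} v"
    and above: "\<And>\<tau>. \<tau> \<in> {0..1} \<Longrightarrow> 0 < Im (cis (- \<beta>) * (z - g \<tau>))"
  defines "R \<equiv> arc_transform \<sigma> g D u v" and "c \<equiv> cis (- \<beta>)"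
  shows "((\<lambda>s. exp (\<i> * (c * pt s) * z - \<i> * \<sigma> * cnj z / (c * pt s)) * R (c * pt s) / (c * pt s) * (c * vel s)) has_integral
    (\<integral>\<tau>. u \<tau> * radial_flux (cmod (g \<tau> - z)) / cnj (g \<tau> - z) * cnj (D \<tau>) + radial (cmod (g \<tau> - z)) * v \<tau> * D \<tau> \<partial>lebesgue_on {0..1})) {0<..}"
proof -
  interpret lipschitz_curve g D C N by (rule curve)
  let ?L = "lebesgue_on {0::real<..}"
  define w where "w \<tau> = c * (z - g \<tau>)" for \<tau>
  have c: "c \<noteq> 0" "cmod c = 1" "cnj c = 1 / c" by (auto simp: c_def cis_cnj divide_inverse cis_inverse)
  have cw: "continuous_on {0..1} w" unfolding w_def by (intro continuous_intros cont_p)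
  obtain \<delta> where \<delta>: "0 < \<delta>" "\<And>\<tau>. \<tau> \<in> {0..1} \<Longrightarrow> \<delta> \<le> Im (w \<tau>)"
  proof -
    have "continuous_on {0..1} (\<lambda>\<tau>. Im (w \<tau>))" by (intro continuous_intros cw)
    then obtain \<tau>0 where "\<tau>0 \<in> {0..1}" "\<And>\<tau>. \<tau> \<in> {0..1} \<Longrightarrow> Im (w \<tau>0) \<le> Im (w \<tau>)"
      using continuous_attains_inf[of "{0..1::real}" "\<lambda>\<tau>. Im (w \<tau>)"] by auto
    then show ?thesis using that[of "Im (w \<tau>0)"] above[of \<tau>0] by (auto simp: w_def c_def)
  qed
  have bdd: "\<exists>B>0. \<forall>\<tau>\<in>{0..1}. cmod (h \<tau>) \<le> B" if "continuous_on {0..1} h" for h :: "real \<Rightarrow> complex"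
    using compact_imp_bounded[OF compact_continuous_image[OF that compact_Icc]] by (auto simp: bounded_pos)
  obtain W where W: "0 < W" "\<And>\<tau>. \<tau> \<in> {0..1} \<Longrightarrow> cmod (w \<tau>) \<le> W" using bdd[OF cw] by blast
  obtain U where U: "0 < U" "\<And>\<tau>. \<tau> \<in> {0..1} \<Longrightarrow> cmod (u \<tau>) \<le> U" using bdd[OF u] by blast
  obtain V where V: "0 < V" "\<And>\<tau>. \<tau> \<in> {0..1} \<Longrightarrow> cmod (v \<tau>) \<le> V" using bdd[OF v] by blast
  define \<Phi> where "\<Phi> s \<tau> = (\<i> * \<sigma> / c * u \<tau>) * moment_integrand (- 1) (w \<tau>) s * cnj (D \<tau>) + v \<tau> * moment_integrand 0 (w \<tau>) s * D \<tau>" for s \<tau>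
  define E where "E k s = vmax * exp (\<kappa> * W) * (s powi (k - 1) * exp (- (\<delta> * (s + cmod \<sigma> / s))))" for k and s :: real
  have mE: "cmod (moment_integrand k (w \<tau>) s) \<le> E k s" if s: "0 < s" and \<tau>: "\<tau> \<in> {0..1}" for k s \<tau>
  proof -
    have "exp (- (Im (w \<tau>) * (s + cmod \<sigma> / s))) \<le> exp (- (\<delta> * (s + cmod \<sigma> / s)))"
      using \<delta>(2)[OF \<tau>] s by (auto intro!: mult_right_mono add_nonneg_nonneg)
    moreover have "vmax * exp (\<kappa> * cmod (w \<tau>)) \<le> vmax * exp (\<kappa> * W)"
      using W(2)[OF \<tau>] vmax_ge_1 ab by (intro mult_left_mono) (auto simp: \<kappa>_def intro!: mult_left_mono)
    ultimately show ?thesis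
      unfolding E_def using s vmax_ge_1
      by (intro order_trans[OF norm_moment_integrand_le[OF s]] mult_mono) auto
  qed
  define b where "b s = (cmod \<sigma> * U * E (- 1) s + V * E 0 s) * C" for s
  have E0: "0 \<le> E k s" if "0 < s" for k s using that vmax_ge_1 by (simp add: E_def)
  have \<Phi>_le: "cmod (\<Phi> s \<tau>) \<le> b s" if s: "0 < s" and \<tau>: "\<tau> \<in> {0..1}" for s \<tau>
  proof -
    have "cmod (\<i> * \<sigma> / c * u \<tau> * moment_integrand (- 1) (w \<tau>) s) \<le> cmod \<sigma> * U * E (- 1) s"
      using U mE[OF s \<tau>] \<tau> E0[OF s] by (auto simp: norm_mult norm_divide c intro!: mult_mono)
    moreover have "cmod (v \<tau> * moment_integrand 0 (w \<tau>) s) \<le> V * E 0 s"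
      using V mE[OF s \<tau>] \<tau> E0[OF s] by (auto simp: norm_mult intro!: mult_mono)
    ultimately show ?thesis
      unfolding \<Phi>_def b_def using U(1) V(1) E0[OF s] by (intro norm_linear_in_D) auto
  qed
  have b_int: "integrable ?L b"
    unfolding b_def E_def using \<delta>(1) sigma_nz
    by (intro integrable_mult_left Bochner_Integration.integrable_add integrable_mult_right integrable_exponential_moment) auto
  have [measurable]: "D \<in> borel_measurable M" "(\<lambda>\<tau>. cnj (D \<tau>)) \<in> borel_measurable M" "w \<in> borel_measurable M"
    "(\<lambda>\<tau>. cnj (w \<tau>)) \<in> borel_measurable M" "u \<in> borel_measurable M" "v \<in> borel_measurable M"
    using D_meas cnj_D_meas cw u v by (auto intro!: measurable_cont continuous_intros)
  have [measurable]: "(\<lambda>s. pt s powi k) \<in> borel_measurable ?L" for k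
    by (intro continuous_imp_measurable_on_sets_lebesgue continuous_intros continuous_pt) (auto simp: pt_nz)
  have \<Phi>_meas [measurable]: "case_prod \<Phi> \<in> borel_measurable (?L \<Otimes>\<^sub>M M)"
    unfolding \<Phi>_def moment_integrand_def kern_def by measurable
  have sf: "sigma_finite_measure ?L"
    by (rule sigma_finite_lebesgue_on) auto
  interpret M: finite_measure M by (rule finite_M)
  interpret pair_sigma_finite ?L M
    by (intro pair_sigma_finite.intro sf M.sigma_finite_measure_axioms)
  have int_\<tau>: "integrable M (\<Phi> s)" if "s \<in> space ?L" for s
  proof (rule integrable_M_bounded)
    show "\<Phi> s \<in> borel_measurable M" using measurable_compose_Pair1[OF that \<Phi>_meas] by simp
    show "cmod (\<Phi> s \<tau>) \<le> b s" if "\<tau> \<in> {0..1}" for \<tau> using \<Phi>_le that \<open>s \<in> space ?L\<close> by simp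
  qed
  have \<Phi>_int: "integrable (?L \<Otimes>\<^sub>M M) (case_prod \<Phi>)"
  proof (rule Fubini_integrable)
    show "integrable ?L (\<lambda>s. \<integral>\<tau>. norm (case_prod \<Phi> (s, \<tau>)) \<partial>M)"
    proof (rule Bochner_Integration.integrable_bound[OF b_int])
      show "(\<lambda>s. \<integral>\<tau>. norm (case_prod \<Phi> (s, \<tau>)) \<partial>M) \<in> borel_measurable ?L" by measurable
      show "AE s in ?L. norm (\<integral>\<tau>. norm (case_prod \<Phi> (s, \<tau>)) \<partial>M) \<le> norm (b s)"
      proof (rule AE_I2)
        fix s assume s: "s \<in> space ?L"
        have "(\<integral>\<tau>. norm (\<Phi> s \<tau>) \<partial>M) \<le> (\<integral>\<tau>. b s \<partial>M)"
          using s \<Phi>_le int_\<tau>[OF s] by (intro integral_mono) auto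
        also have "\<dots> = b s" by (simp add: measure_restrict_space)
        finally show "norm (\<integral>\<tau>. norm (case_prod \<Phi> (s, \<tau>)) \<partial>M) \<le> norm (b s)" by simp
      qed
    qed
    show "AE s in ?L. integrable M (\<lambda>\<tau>. case_prod \<Phi> (s, \<tau>))" using int_\<tau> by auto
  qed measurable
  have "integrable ?L (\<lambda>s. \<integral>\<tau>. \<Phi> s \<tau> \<partial>M)"
    using integrable_fst'[OF \<Phi>_int] by simp
  then have hi: "((\<lambda>s. \<integral>\<tau>. \<Phi> s \<tau> \<partial>M) has_integral (\<integral>s. (\<integral>\<tau>. \<Phi> s \<tau> \<partial>M) \<partial>?L)) {0<..}"
    by (rule has_integral_integral_lebesgue_on) auto
  have "(\<integral>s. (\<integral>\<tau>. \<Phi> s \<tau> \<partial>M) \<partial>?L) = (\<integral>\<tau>. (\<integral>s. \<Phi> s \<tau> \<partial>?L) \<partial>M)"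
    using Fubini_integral[OF \<Phi>_int] by simp
  also have "\<dots> = (\<integral>\<tau>. u \<tau> * radial_flux (cmod (g \<tau> - z)) / cnj (g \<tau> - z) * cnj (D \<tau>) + radial (cmod (g \<tau> - z)) * v \<tau> * D \<tau> \<partial>M)"
  proof (rule Bochner_Integration.integral_cong[OF refl])
    fix \<tau> assume "\<tau> \<in> space M"
    then have \<tau>: "\<tau> \<in> {0..1}" by simp
    have w: "0 < Im (w \<tau>)" using \<delta>(1) \<delta>(2)[OF \<tau>] by linarith
    have nw: "cmod (w \<tau>) = cmod (g \<tau> - z)" by (simp add: w_def norm_mult c norm_minus_commute)
    have nz: "g \<tau> - z \<noteq> 0" using w by (auto simp: w_def)
    have "(\<integral>s. \<Phi> s \<tau> \<partial>?L) = (\<i> * \<sigma> / c * u \<tau>) * moment (- 1) (w \<tau>) * cnj (D \<tau>) + v \<tau> * moment 0 (w \<tau>) * D \<tau>"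
      unfolding \<Phi>_def moment_def using integrable_moment_integrand[OF w] by simp
    also have "moment 0 (w \<tau>) = radial (cmod (g \<tau> - z))"
      using moment_0_radial[OF w] by (simp add: radial_def nw)
    also have "\<i> * \<sigma> / c * u \<tau> * moment (- 1) (w \<tau>) = u \<tau> * radial_flux (cmod (g \<tau> - z)) / cnj (g \<tau> - z)"
    proof -
      define r where "r = complex_of_real (cmod (g \<tau> - z))"
      have r: "r \<noteq> 0" "r * r = (g \<tau> - z) * cnj (g \<tau> - z)"
      proof -
        show "r \<noteq> 0" using nz by (simp add: r_def)
        show "r * r = (g \<tau> - z) * cnj (g \<tau> - z)"
          unfolding r_def using complex_norm_square[of "g \<tau> - z"] by (simp only: of_real_mult power2_eq_square)
      qed
      define m where "m = moment (- 1) (\<i> * r)"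
      have mw: "moment (- 1) (w \<tau>) = - \<i> * (c * (z - g \<tau>)) / r * m"
        using moment_minus_1_radial[OF w] by (simp add: nw r_def m_def) (simp add: w_def)
      have "\<i> * \<sigma> / c * u \<tau> * moment (- 1) (w \<tau>) = - (\<sigma> * u \<tau> * m * (g \<tau> - z)) / r"
        unfolding mw using c(1) r(1) by (simp add: field_simps)
      also have "\<dots> = - (\<sigma> * u \<tau> * m * r) * ((g \<tau> - z) / (r * r))" using r(1) by simp
      also have "(g \<tau> - z) / (r * r) = 1 / cnj (g \<tau> - z)" unfolding r(2) using nz by simp
      finally show ?thesis by (simp add: radial_flux_def r_def m_def)
    qed
    finally show "(\<integral>s. \<Phi> s \<tau> \<partial>?L) = u \<tau> * radial_flux (cmod (g \<tau> - z)) / cnj (g \<tau> - z) * cnj (D \<tau>) + radial (cmod (g \<tau> - z)) * v \<tau> * D \<tau>"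
      by (simp add: mult.commute)
  qed
  finally have "((\<lambda>s. \<integral>\<tau>. \<Phi> s \<tau> \<partial>M) has_integral (\<integral>\<tau>. u \<tau> * radial_flux (cmod (g \<tau> - z)) / cnj (g \<tau> - z) * cnj (D \<tau>) + radial (cmod (g \<tau> - z)) * v \<tau> * D \<tau> \<partial>M)) {0<..}"
    using hi by simp
  then show ?thesis
  proof (rule has_integral_eq[rotated])
    fix s :: real assume "s \<in> {0<..}"
    then have s: "0 < s" by simp
    define t where "t = pt s"
    have t: "t \<noteq> 0" using pt_nz[OF s] by (simp add: t_def)
    have "\<Phi> s \<tau> = (exp (\<i> * (c * t) * z - \<i> * \<sigma> * cnj z / (c * t)) / (c * t) * (c * vel s))
       * (exp (- \<i> * (c * t) * g \<tau> + \<i> * \<sigma> * cnj (g \<tau>) / (c * t)) * (u \<tau> * (\<i> * \<sigma> / (c * t)) * cnj (D \<tau>) + v \<tau> * D \<tau>))" for \<tau>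
    proof -
      have "\<i> * t * w \<tau> - \<i> * \<sigma> * cnj (w \<tau>) / t
          = (\<i> * (c * t) * z - \<i> * \<sigma> * cnj z / (c * t)) + (- \<i> * (c * t) * g \<tau> + \<i> * \<sigma> * cnj (g \<tau>) / (c * t))"
        using t c(1) by (simp add: w_def c(3) field_simps)
      then have k: "kern (w \<tau>) t = exp (\<i> * (c * t) * z - \<i> * \<sigma> * cnj z / (c * t)) * exp (- \<i> * (c * t) * g \<tau> + \<i> * \<sigma> * cnj (g \<tau>) / (c * t))"
        unfolding kern_def by (simp only: exp_add)
      have m: "moment_integrand (- 1) (w \<tau>) s = kern (w \<tau>) t * vel s / (t * t)" "moment_integrand 0 (w \<tau>) s = kern (w \<tau>) t * vel s / t"
        by (simp_all add: moment_integrand_def t_def power_int_minus divide_inverse power2_eq_square)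
      have alg: "\<i> * \<sigma> / c * u \<tau> * (k1 * k2 * V / (t * t)) * d + v \<tau> * (k1 * k2 * V / t) * d'
         = (k1 / (c * t) * (c * V)) * (k2 * (u \<tau> * (\<i> * \<sigma> / (c * t)) * d + v \<tau> * d'))" for k1 k2 V d d'
        using t c(1) by (simp add: field_simps)
      show ?thesis unfolding \<Phi>_def m k by (rule alg)
    qed
    then have "(\<integral>\<tau>. \<Phi> s \<tau> \<partial>M) = (exp (\<i> * (c * t) * z - \<i> * \<sigma> * cnj z / (c * t)) / (c * t) * (c * vel s)) * R (c * t)"
      unfolding R_def arc_transform_def by simp
    then show "(\<integral>\<tau>. \<Phi> s \<tau> \<partial>M) = exp (\<i> * (c * pt s) * z - \<i> * \<sigma> * cnj z / (c * pt s)) * R (c * pt s) / (c * pt s) * (c * vel s)"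
      by (simp add: t_def)
  qed
qed

end

lemma rho_eq_arc_transform:
  assumes curve: "lipschitz_curve g D C N"
    and u: "continuous_on {0..1} (\<lambda>\<tau>. \<phi> (g \<tau>))" and v: "continuous_on {0..1} (\<lambda>\<tau>. wirtinger_deriv \<phi> (g \<tau>))"
    and t: "t \<noteq> 0"
  shows "rho \<sigma> \<phi> g t = arc_transform \<sigma> g D (\<lambda>\<tau>. \<phi> (g \<tau>)) (\<lambda>\<tau>. wirtinger_deriv \<phi> (g \<tau>)) t"
proof -
  interpret lipschitz_curve g D C N by (rule curve)
  define e where "e \<tau> = exp (- \<i> * t * g \<tau> + \<i> * \<sigma> * cnj (g \<tau>) / t)" for \<tau>
  let ?p = "\<lambda>\<zeta>. exp (- \<i> * t * \<zeta> + \<i> * \<sigma> * cnj \<zeta> / t) * (\<phi> \<zeta> * (\<i> * \<sigma> / t))" and ?q = "\<lambda>\<zeta>. exp (- \<i> * t * \<zeta> + \<i> * \<sigma> * cnj \<zeta> / t) * wirtinger_deriv \<phi> \<zeta>"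
  have ce: "continuous_on {0..1} e" unfolding e_def using t by (intro continuous_intros cont_p) simp
  define P where "P \<tau> = e \<tau> * (\<phi> (g \<tau>) * (\<i> * \<sigma> / t))" for \<tau>
  define Q where "Q \<tau> = e \<tau> * wirtinger_deriv \<phi> (g \<tau>)" for \<tau>
  have cP: "continuous_on {0..1} P" and cQ: "continuous_on {0..1} Q"
    unfolding P_def Q_def by (intro continuous_intros ce u v)+
  have int: "integrable M (\<lambda>\<tau>. f \<tau> * d \<tau>)"
    if f: "continuous_on {0..1} f" and d: "d \<in> borel_measurable M" "\<And>\<tau>. cmod (d \<tau>) \<le> C" for f d :: "real \<Rightarrow> complex"
  proof -
    obtain B where B: "0 < B" "\<And>\<tau>. \<tau> \<in> {0..1} \<Longrightarrow> cmod (f \<tau>) \<le> B"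
      using compact_imp_bounded[OF compact_continuous_image[OF f compact_Icc]] by (auto simp: bounded_pos)
    show ?thesis
    proof (rule integrable_M_bounded[where K="B * C"])
      show "(\<lambda>\<tau>. f \<tau> * d \<tau>) \<in> borel_measurable M" by (rule borel_measurable_times[OF measurable_cont[OF f] d(1)])
      show "cmod (f \<tau> * d \<tau>) \<le> B * C" if "\<tau> \<in> {0..1}" for \<tau>
        unfolding norm_mult using B(1) B(2)[OF that] d(2)[of \<tau>] by (intro mult_mono) auto
    qed
  qed
  have i1: "integrable M (\<lambda>\<tau>. P \<tau> * cnj (D \<tau>))" and i2: "integrable M (\<lambda>\<tau>. Q \<tau> * D \<tau>)"
    using cP cQ cnj_D_meas D_meas D_le by (auto intro!: int)
  have "contour_integral_cnj g ?p = (\<integral>\<tau>. P \<tau> * cnj (D \<tau>) \<partial>M)"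
  proof -
    have "contour_integral_cnj g ?p = integral {0..1} (\<lambda>\<tau>. P \<tau> * cnj (D \<tau>))"
      unfolding contour_integral_cnj_def
    proof (rule integral_spike[OF N])
      fix \<tau> :: real assume \<tau>: "\<tau> \<in> {0..1} - N"
      have "vector_derivative g (at \<tau> within {0..1}) = D \<tau>"
        using p_der[OF \<tau>] \<tau> by (intro vector_derivative_within_closed_interval) auto
      then show "P \<tau> * cnj (D \<tau>) = exp (- \<i> * t * g \<tau> + \<i> * \<sigma> * cnj (g \<tau>) / t) * (\<phi> (g \<tau>) * (\<i> * \<sigma> / t)) * cnj (vector_derivative g (at \<tau> within {0..1}))"
        by (simp add: P_def e_def)
    qed
    then show ?thesis using i1 by (simp add: lebesgue_integral_eq_integral)
  qed
  moreover have "contour_integral g ?q = (\<integral>\<tau>. Q \<tau> * D \<tau> \<partial>M)"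
  proof -
    have N2: "negligible (N \<union> {0, 1})" using N by simp
    have "contour_integral g ?q = integral {0..1} (\<lambda>\<tau>. Q \<tau> * D \<tau>)"
      unfolding contour_integral_integral
    proof (rule integral_spike[OF N2])
      fix \<tau> :: real assume \<tau>: "\<tau> \<in> {0..1} - (N \<union> {0, 1})"
      then have "(g has_vector_derivative D \<tau>) (at \<tau>)"
        using p_der[of \<tau>] by (auto simp: at_within_Icc_at)
      then have "vector_derivative g (at \<tau>) = D \<tau>" by (rule vector_derivative_at)
      then show "Q \<tau> * D \<tau> = exp (- \<i> * t * g \<tau> + \<i> * \<sigma> * cnj (g \<tau>) / t) * wirtinger_deriv \<phi> (g \<tau>) * vector_derivative g (at \<tau>)"
        by (simp add: Q_def e_def)
    qed
    then show ?thesis using i2 by (simp add: lebesgue_integral_eq_integral)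
  qed
  ultimately have "rho \<sigma> \<phi> g t = (\<integral>\<tau>. P \<tau> * cnj (D \<tau>) + Q \<tau> * D \<tau> \<partial>M)"
    unfolding rho_def using i1 i2 by simp
  then show ?thesis by (simp add: arc_transform_def P_def Q_def e_def ring_distribs mult.assoc)
qed

section \<open>The representation formula\<close>

theorem theorem3:
  fixes \<sigma> \<alpha> z :: complex and \<Omega> U T :: "complex set" and \<phi> :: "complex \<Rightarrow> complex"
    and v :: "nat \<Rightarrow> complex" and I :: "nat \<Rightarrow> real \<Rightarrow> complex"
    and \<beta> :: "nat \<Rightarrow> real" and L :: "real \<Rightarrow> complex"
  assumes sigma: "0 < Arg \<sigma>" "Arg \<sigma> < pi"
    and Omega: "open \<Omega>" "convex \<Omega>" "bounded \<Omega>" "\<Omega> \<noteq> {}"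
    and smooth: "open U" "closure \<Omega> \<subseteq> U" "real_C2_on \<phi> U"
    and helmholtz: "\<And>\<zeta>. \<zeta> \<in> \<Omega> \<Longrightarrow> laplacian \<phi> \<zeta> - 4 * \<sigma> * \<phi> \<zeta> = 0"
    and trapezoid: "horizontal_trapezoid v" "T = convex hull (v ` {1..4})"
      "v ` {1..4} \<subseteq> frontier \<Omega>" "T \<subseteq> closure \<Omega>"
    and boundary: "ccw_boundary \<Omega> (I 1 +++ I 2 +++ I 3 +++ I 4)"
    and arcs: "\<And>k. k \<in> {1..4} \<Longrightarrow>
      lipschitz_path (I k) \<and> pathstart (I k) = v k \<and> pathfinish (I k) = v (k mod 4 + 1)"
    and alpha: "\<alpha> \<in> interior T"
    and beta: "\<And>k. k \<in> {1..4} \<Longrightarrow> 0 \<le> \<beta> k \<and> \<beta> k < 2 * pi"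
    and below: "\<And>k \<zeta> w. k \<in> {1..4} \<Longrightarrow> \<zeta> \<in> path_image (I k) \<Longrightarrow> w \<in> interior T \<Longrightarrow>
      Im (exp (- \<i> * \<beta> k) * (\<zeta> - \<alpha>)) < 0 \<and>
      Im (exp (- \<i> * \<beta> k) * (\<zeta> - \<alpha>)) < Im (exp (- \<i> * \<beta> k) * (w - \<alpha>))"
    and contour: "helmholtz_contour \<sigma> L"
    and z: "z \<in> interior T"
  shows "(\<forall>j\<in>{1..4}. contour_integrable_0_inf (rotate_contour (\<beta> j) L)
             (\<lambda>t. exp (\<i> * t * z - \<i> * \<sigma> * cnj z / t) * rho \<sigma> \<phi> (I j) t / t)) \<and>
         \<phi> z = 1 / (2 * pi * \<i>) *
           (\<Sum>j=1..4. contour_integral_0_inf (rotate_contour (\<beta> j) L)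
             (\<lambda>t. exp (\<i> * t * z - \<i> * \<sigma> * cnj z / t) * rho \<sigma> \<phi> (I j) t / t))"
proof -
  let ?F = "\<lambda>j t. exp (\<i> * t * z - \<i> * \<sigma> * cnj z / t) * rho \<sigma> \<phi> (I j) t / t"
  obtain a b \<theta> where ab: "0 < a" "a < b"
    and L: "L piecewise_C1_differentiable_on {a..b}"
      "\<forall>s\<in>{0<..a}. L s = of_real s * cis (Arg \<sigma>)" "\<forall>s\<in>{b..}. L s = of_real s"
      "\<forall>s\<in>{0<..}. L s \<noteq> 0 \<and> L s = of_real (cmod (L s)) * cis (\<theta> s)"
      "continuous_on {0<..} \<theta>" "\<forall>s\<in>{0<..a}. \<theta> s = Arg \<sigma>" "\<forall>s\<in>{b..}. \<theta> s = 0"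
    using contour unfolding helmholtz_contour_def by (elim exE conjE) (rule that)
  have path: "helmholtz_path \<sigma> a b L \<theta>"
  proof
    show "L s \<noteq> 0 \<and> L s = of_real (cmod (L s)) * cis (\<theta> s)" if "s \<in> {0<..}" for s
      using L(4) that by blast
    show "L s = of_real s * cis (Arg \<sigma>)" if "s \<in> {0<..a}" for s using L(2) that by blast
    show "L s = of_real s" if "s \<in> {b..}" for s using L(3) that by blast
    show "\<theta> a = Arg \<sigma>" "\<theta> b = 0" using L(6,7) ab by auto
  qed (use ab L(1,5) sigma(1) in auto)
  interpret helmholtz_path \<sigma> a b L \<theta> by (rule path)
  have "\<forall>j\<in>{1..4}. \<exists>D C N. lipschitz_curve (I j) D C N"
    using arcs lipschitz_path_derivative unfolding lipschitz_curve_def by metis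
  then obtain D C N where curve: "\<And>j. j \<in> {1..4} \<Longrightarrow> lipschitz_curve (I j) (D j) (C j) (N j)"
    by metis
  have z\<Omega>: "z \<in> \<Omega>"
    using z interior_mono[OF trapezoid(4)] Omega convex_interior_closure[of \<Omega>] by (auto simp: interior_open)
  have ends: "pathstart (I 1) = v 1" "pathfinish (I 1) = v 2" "pathstart (I 2) = v 2" "pathfinish (I 2) = v 3"
    "pathstart (I 3) = v 3" "pathfinish (I 3) = v 4" "pathstart (I 4) = v 4" "pathfinish (I 4) = v 1"
    using arcs[of 1] arcs[of 2] arcs[of 3] arcs[of 4] by (auto simp flip: numeral_2_eq_2)
  have paths: "path (I j)" if "j \<in> {1..4}" for j
    unfolding path_def using lipschitz_curve.cont_p[OF curve[OF that]] .
  have one_to_four: "{1..4::nat} = {1, 2, 3, 4}" by auto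
  have "frontier \<Omega> = path_image (I 1) \<union> (path_image (I 2) \<union> (path_image (I 3) \<union> path_image (I 4)))"
    using boundary unfolding ccw_boundary_def by (simp add: path_image_join ends del: One_nat_def)
  then have image: "path_image (I j) \<subseteq> frontier \<Omega>" if "j \<in> {1..4}" for j
    using that unfolding one_to_four by auto
  have z_off: "z \<notin> path_image (I j)" if "j \<in> {1..4}" for j
    using image[OF that] z\<Omega> Omega(1) by (auto simp: frontier_def interior_open)
  have "winding_number (I 1 +++ I 2 +++ I 3 +++ I 4) z = 1"
    using boundary z\<Omega> unfolding ccw_boundary_def by blast
  then have winding: "(\<Sum>j=1..4. winding_number (I j) z) = 1"
    using paths z_off by (simp add: winding_number_join path_image_join ends one_to_four del: One_nat_def)
  have C1: "real_C1_on \<phi> U" using smooth(3) by (simp add: real_C2_on_def)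
  have cont: "continuous_on U \<phi>" "continuous_on U (wirtinger_deriv \<phi>)"
  proof -
    show "continuous_on U \<phi>"
      using real_C1_has_derivative[OF smooth(1) C1]
      by (intro continuous_at_imp_continuous_on ballI has_derivative_continuous)
    show "continuous_on U (wirtinger_deriv \<phi>)"
      unfolding wirtinger_deriv_def by (intro continuous_intros real_C1_continuous_dir_deriv[OF C1]; simp)
  qed
  have u: "continuous_on {0..1} (\<lambda>\<tau>. \<phi> (I j \<tau>))" "continuous_on {0..1} (\<lambda>\<tau>. wirtinger_deriv \<phi> (I j \<tau>))" if "j \<in> {1..4}" for j
  proof -
    have "I j ` {0..1} \<subseteq> U"
      using image[OF that] smooth(2) by (auto simp: path_image_def frontier_def)
    then show "continuous_on {0..1} (\<lambda>\<tau>. \<phi> (I j \<tau>))" "continuous_on {0..1} (\<lambda>\<tau>. wirtinger_deriv \<phi> (I j \<tau>))"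
      using paths[OF that] unfolding path_def by (auto intro: continuous_on_compose2[OF cont(1)] continuous_on_compose2[OF cont(2)])
  qed
  define J where "J j = (\<integral>\<tau>. \<phi> (I j \<tau>) * radial_flux (cmod (I j \<tau> - z)) / cnj (I j \<tau> - z) * cnj (D j \<tau>)
      + radial (cmod (I j \<tau> - z)) * wirtinger_deriv \<phi> (I j \<tau>) * D j \<tau> \<partial>lebesgue_on {0..1})" for j
  have arc: "((\<lambda>s. (?F j) (rotate_contour (\<beta> j) L s)
      * vector_derivative (rotate_contour (\<beta> j) L) (at s)) has_integral J j) {0<..}" if j: "j \<in> {1..4}" for j
  proof -
    define c where "c = cis (- \<beta> j)"
    define R where "R = arc_transform \<sigma> (I j) (D j) (\<lambda>\<tau>. \<phi> (I j \<tau>)) (\<lambda>\<tau>. wirtinger_deriv \<phi> (I j \<tau>))"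
    define G where "G t = exp (\<i> * t * z - \<i> * \<sigma> * cnj z / t) * R t / t" for t
    have c: "c \<noteq> 0" by (simp add: c_def)
    have "R holomorphic_on - {0}"
      unfolding R_def by (rule lipschitz_curve.transform_holomorphic[OF curve[OF j] u[OF j]])
    then have G: "G holomorphic_on - {0}"
      unfolding G_def by (intro holomorphic_intros) auto
    \<comment> \<open>The point \<open>\<alpha>\<close> cancels: only the difference of the two heights matters.\<close>
    have above: "0 < Im (cis (- \<beta> j) * (z - I j \<tau>))" if "\<tau> \<in> {0..1}" for \<tau>
    proof -
      have "I j \<tau> \<in> path_image (I j)" using that by (simp add: path_image_def)
      from below[OF j this z] have "Im (cis (- \<beta> j) * (I j \<tau> - \<alpha>)) < Im (cis (- \<beta> j) * (z - \<alpha>))"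
        by (simp add: cis_conv_exp)
      then show ?thesis by (simp add: algebra_simps)
    qed
    have "((\<lambda>s. G (c * pt s) * (c * vel s)) has_integral J j) {0<..}"
      using arc_transform_has_integral[OF curve[OF j] u[OF j] above] unfolding G_def R_def c_def J_def .
    from has_integral_rotated_helmholtz_path[OF G c this]
    show ?thesis
    proof (rule has_integral_eq[rotated])
      fix s :: real assume s: "s \<in> {0<..}"
      have nz: "c * L s \<noteq> 0" using c polar[OF s] by simp
      have rot: "rotate_contour (\<beta> j) L = (\<lambda>s. c * L s)" by (simp add: rotate_contour_def c_def fun_eq_iff)
      have "rho \<sigma> \<phi> (I j) (c * L s) = R (c * L s)"
        unfolding R_def by (rule rho_eq_arc_transform[OF curve[OF j] u[OF j] nz])
      then show "G (c * L s) * vector_derivative (\<lambda>s. c * L s) (at s)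
        = (?F j) (rotate_contour (\<beta> j) L s)
          * vector_derivative (rotate_contour (\<beta> j) L) (at s)"
        unfolding rot G_def by simp
    qed
  qed
  have green: "(\<Sum>j=1..4. J j) = 2 * pi * \<i> * \<phi> z"
    unfolding J_def
  proof (rule green_representation[OF radial_has_vector_derivative radial_flux_has_vector_derivative
        radial_flux_tendsto radial_mult_tendsto Omega(1,2) z\<Omega> smooth])
    show "laplacian \<phi> \<zeta> = 4 * \<sigma> * \<phi> \<zeta>" if "\<zeta> \<in> \<Omega>" for \<zeta> using helmholtz[OF that] by simp
    show "I j 1 = I (j mod 4 + 1) 0" if "j \<in> {1..4}" for j
    proof -
      have "j mod 4 + 1 \<in> {1..4}" by (auto simp: Suc_le_eq)
      then show ?thesis using arcs[OF that] arcs[of "j mod 4 + 1"] by (simp add: pathstart_def pathfinish_def)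
    qed
  qed (use curve image winding in auto)
  show ?thesis
  proof
    show "\<forall>j\<in>{1..4}. contour_integrable_0_inf (rotate_contour (\<beta> j) L) (?F j)"
      unfolding contour_integrable_0_inf_def using arc by blast
    have "(\<Sum>j=1..4. contour_integral_0_inf (rotate_contour (\<beta> j) L) (?F j)) = (\<Sum>j=1..4. J j)"
      unfolding contour_integral_0_inf_def by (intro sum.cong refl integral_unique arc)
    then show "\<phi> z = 1 / (2 * pi * \<i>) *
           (\<Sum>j=1..4. contour_integral_0_inf (rotate_contour (\<beta> j) L) (?F j))"
      unfolding green by simp
  qed
qed

end
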